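(* Assume $\Gamma_u=\emptyset$ (so $\Gamma_p=\partial\Omega$). Let $(u,p)$ be the solution of the continuous Darcy problem (C) and $(u_h,p_h)$ the solution of the discrete problem (D), both described in the context. Let $u\in[H^{\max(k_u+1,k_p+2)}(\Omega^{\mathrm{ext}})]^d$, where $u$ also denotes the stable extension of the flux solution from $\Omega$ to $\Omega^{\mathrm{ext}}$ described in the context. Assume that $\Omega$ enjoys elliptic regularity, that $h$ is small enough, and that the kernel of the pressure stabilisation has the approximation property (K) stated in the context. Then $$\|u-u_h\|_{L^2(\Omega)}\lesssim h^{k_u+1}\|u\|_{H^{k_u+1}(\Omega)}+h^{k_p+1}\|u\|_{H^{k_p+2}(\Omega)},$$ $$\|\mathrm{div}\,u-\mathrm{div}\,u_h\|_{L^2(\Omega)}\lesssim h^{k_p+1}\|u\|_{H^{k_p+2}(\Omega)}.$$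
   Context: Geometry. $\Omega\subset\mathbb{R}^d$ is a bounded Lipschitz domain with boundary $\partial\Omega$ and outward unit normal $n$; here the whole boundary carries a pressure condition, $\Gamma_p=\partial\Omega$. $\Omega$ is embedded in a background domain carrying a conforming, quasi-uniform, shape-regular mesh $\mathcal{T}_h^{\mathrm{bg}}$ of size $h$. $\mathcal{T}_h$ is the set of cells of $\mathcal{T}_h^{\mathrm{bg}}$ that intersect $\Omega$ (active cells), and the active domain $\Omega_h$ is the interior of the closure of $\bigcup_{T\in\mathcal{T}_h}T$, so $\Omega\subset\Omega_h$. $\Omega^{\mathrm{ext}}$ is a fixed smooth domain with $\Omega_h\subset\Omega^{\mathrm{ext}}$ for all $0<h\le h_0$. $(\cdot,\cdot)_\omega$ is the $L^2(\omega)$ inner product. The notation $a\lesssim b$ means $a\le Cb$ with $C>0$ independent of $h$ and of the location of the cuts (how $\partial\Omega$ intersects the mesh); $a\simeq b$ means $a\lesssim b$ and $b\lesssim a$. Elliptic regularity means: for every $\rho\in L^2(\Omega)$, the solution $\xi$ of $-\Delta\xi=\rho$ in $\Omega$, $\xi=0$ on $\partial\Omega$ lies in $H^2(\Omega)$ and $\|\xi\|_{H^2(\Omega)}\lesssim\|\rho\|_{L^2(\Omega)}$. Continuous problem (C): $u+\nabla p=f$ in $\Omega$, $\mathrm{div}\,u=-g$ in $\Omega$, $p=p_\Gamma$ on $\partial\Omega$ (the inverse permeability is taken equal to one), with $f\in[L^2(\Omega)]^d$, $g\in L^2(\Omega)$, $p_\Gamma\in H^{1/2}(\partial\Omega)$.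 Extension. $u$ is extended from $\Omega$ to $\Omega^{\mathrm{ext}}$ by a stable (Stein) extension, keeping the same symbol: $\|u\|_{H^r(\Omega^{\mathrm{ext}})}\lesssim\|u\|_{H^r(\Omega)}$ for $0\le r\le k_u+1$ and $\|\mathrm{div}\,u\|_{H^s(\Omega^{\mathrm{ext}})}\lesssim\|u\|_{H^{s+1}(\Omega)}$ for $0\le s\le k_p+1$. Discrete spaces. $V_{\mathrm{d},h}=\{v_h\in H(\mathrm{div},\Omega_h): v_h|_T\in\mathcal{V}_{\mathrm{d}}(T)\ \forall T\in\mathcal{T}_h\}$, where $\mathcal{V}_{\mathrm{d}}$ is a space of vector fields with polynomial components and $\mathcal{V}_{\mathrm{d}}(T)$ its restriction to $T$; $V_{0,h}\subset L^2(\Omega_h)$ is the space of discontinuous piecewise polynomials with restriction to each $T\in\mathcal{T}_h$ in $\mathcal{V}_0(T)$. They form the last part of a discrete de Rham complex with bounded cochain interpolators $\Pi_{\mathrm{d},h}$ and $\Pi_{0,h}$ onto $V_{\mathrm{d},h}$ and $V_{0,h}$ (acting as the identity on the discrete spaces, and $\mathrm{div}\,\Pi_{\mathrm{d},h}=\Pi_{0,h}\,\mathrm{div}$), and $\mathrm{div}\,V_{\mathrm{d},h}=V_{0,h}$. $k_u,k_p\ge 0$ are the largest integers with $[\mathbb{P}_{k_u}(T)]^d\subset\mathcal{V}_{\mathrm{d}}(T)$ and $\mathbb{P}_{k_p}(T)\subset\mathcal{V}_0(T)$ for all $T\in\mathcal{T}_h$. Moreover $\|u-\Pi_{\mathrm{d},h}u\|_{L^2(\Omega_h)}\lesssim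 h^r\|u\|_{H^r(\Omega_h)}$ for $r=0,\dots,k_u+1$ and $\|p-\Pi_{0,h}p\|_{L^2(\Omega_h)}\lesssim h^t\|p\|_{H^t(\Omega_h)}$ for $t=0,\dots,k_p+1$. Stabilisation. $s_h^{\mathrm{d}}$ and $s_h^0$ are symmetric positive semidefinite bilinear forms on $V_{\mathrm{d},h}$ and $V_{0,h}$ such that $\|w_h\|^2_{L^2(\Omega)}+s_h^{\mathrm{d}}(w_h,w_h)\simeq\|w_h\|^2_{L^2(\Omega_h)}$ for all $w_h\in V_{\mathrm{d},h}$; $\|r_h\|^2_{L^2(\Omega)}+s_h^0(r_h,r_h)\simeq\|r_h\|^2_{L^2(\Omega_h)}$ for all $r_h\in V_{0,h}$; $s_h^{\mathrm{d}}(\Pi_{\mathrm{d},h}w,v_h)\lesssim h^s\|w\|_{H^s(\Omega^{\mathrm{ext}})}\|v_h\|_{L^2(\Omega_h)}$ for $0\le s\le k_u+1$, $w\in[H^s(\Omega^{\mathrm{ext}})]^d$, $v_h\in V_{\mathrm{d},h}$; $s_h^0(\Pi_{0,h}r,q_h)\lesssim h^t\|r\|_{H^t(\Omega^{\mathrm{ext}})}\|q_h\|_{L^2(\Omega_h)}$ for $0\le t\le k_p+1$, $r\in H^t(\Omega^{\mathrm{ext}})$, $q_h\in V_{0,h}$; and $s_h^0(c,q_h)=0$ for every constant $c$ and $q_h\in V_{0,h}$. Property (K). Let $\mathcal{K}_h^p=\{q_h\in V_{0,h}: s_h^0(q_h,\phi_h)=0\ \forall\phi_h\in V_{0,h}\}$.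 For every $\tilde r\in H^t(\Omega^{\mathrm{ext}})$ with $0\le t\le k_p+1$ there exists $w_h\in\mathcal{K}_h^p$ with $\|\tilde r-w_h\|_{L^2(\Omega_h)}\lesssim h^t\|\tilde r\|_{H^t(\Omega^{\mathrm{ext}})}$. Discrete problem (D) (for $\Gamma_u=\emptyset$). For positive numerical parameters $\tau_{\mathrm{d}},\tau_0$ put $a_h(u_h,v_h)=(u_h,v_h)_\Omega+\tau_{\mathrm{d}}s_h^{\mathrm{d}}(u_h,v_h)$ and $b_h(v_h,p_h)=-(\mathrm{div}\,v_h,p_h)_\Omega-\tau_0 s_h^0(\mathrm{div}\,v_h,p_h)$. Find $(u_h,p_h)\in V_{\mathrm{d},h}\times V_{0,h}$ such that for all $(v_h,q_h)\in V_{\mathrm{d},h}\times V_{0,h}$, $a_h(u_h,v_h)+b_h(v_h,p_h)=(f,v_h)_\Omega-(v_h\cdot n,p_\Gamma)_{\partial\Omega}$ and $b_h(u_h,q_h)=(g,q_h)_\Omega$. *)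

theory Defs
  imports "HOL-Analysis.Analysis"
begin

text \<open>
  Functions on a domain are total functions on the whole space, of which only the restriction to the
  domain matters, up to null sets.
\<close>

section \<open>Square-integrable functions\<close>

definition sq_integrable :: "'a measure \<Rightarrow> ('a \<Rightarrow> 'b::euclidean_space) \<Rightarrow> bool" where
  "sq_integrable M f \<longleftrightarrow> f \<in> borel_measurable M \<and> integrable M (\<lambda>x. (norm (f x))\<^sup>2)"

definition L2_inner :: "'a measure \<Rightarrow> ('a \<Rightarrow> 'b::euclidean_space) \<Rightarrow> ('a \<Rightarrow> 'b) \<Rightarrow> real" where
  "L2_inner M f g = (\<integral>x. f x \<bullet> g x \<partial>M)"

definition L2_norm :: "'a measure \<Rightarrow> ('a \<Rightarrow> 'b::euclidean_space) \<Rightarrow> real" where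
  "L2_norm M f = sqrt (L2_inner M f f)"

section \<open>Smooth functions and test functions\<close>

definition partial_deriv :: "'n::finite \<Rightarrow> (real^'n \<Rightarrow> real) \<Rightarrow> real^'n \<Rightarrow> real" where
  "partial_deriv i f x = frechet_derivative f (at x) (axis i 1)"

text \<open>Derivatives of higher order are indexed by lists of coordinate directions.\<close>

definition iter_deriv :: "'n::finite list \<Rightarrow> (real^'n \<Rightarrow> real) \<Rightarrow> real^'n \<Rightarrow> real" where
  "iter_deriv \<alpha> f = foldr partial_deriv \<alpha> f"

definition gradient :: "(real^'n::finite \<Rightarrow> real) \<Rightarrow> real^'n \<Rightarrow> real^'n" where
  "gradient f x = (\<chi> i. partial_deriv i f x)"

primrec C_k :: "nat \<Rightarrow> (real^'n::finite \<Rightarrow> real) \<Rightarrow> bool" where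
  "C_k 0 f \<longleftrightarrow> continuous_on UNIV f"
| "C_k (Suc k) f \<longleftrightarrow> (\<forall>x. f differentiable (at x)) \<and> (\<forall>i. C_k k (partial_deriv i f))"

definition smooth :: "(real^'n::finite \<Rightarrow> real) \<Rightarrow> bool" where
  "smooth f \<longleftrightarrow> (\<forall>k. C_k k f)"

definition test_functions :: "(real^'n::finite) set \<Rightarrow> (real^'n \<Rightarrow> real) set" where
  "test_functions \<Omega> =
     {\<phi>. smooth \<phi> \<and> compact (closure {x. \<phi> x \<noteq> 0}) \<and> closure {x. \<phi> x \<noteq> 0} \<subseteq> \<Omega>}"

section \<open>Weak derivatives and Sobolev spaces\<close>

definition has_weak_deriv ::
  "(real^'n::finite) set \<Rightarrow> 'n list \<Rightarrow> (real^'n \<Rightarrow> 'b::euclidean_space) \<Rightarrow> (real^'n \<Rightarrow> 'b) \<Rightarrow> bool" where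
  "has_weak_deriv \<Omega> \<alpha> u v \<longleftrightarrow>
     sq_integrable (lebesgue_on \<Omega>) u \<and> sq_integrable (lebesgue_on \<Omega>) v \<and>
     (\<forall>\<phi>\<in>test_functions \<Omega>.
        (\<integral>x. iter_deriv \<alpha> \<phi> x *\<^sub>R u x \<partial>lebesgue_on \<Omega>) =
        (-1) ^ length \<alpha> *\<^sub>R (\<integral>x. \<phi> x *\<^sub>R v x \<partial>lebesgue_on \<Omega>))"

definition weak_deriv ::
  "(real^'n::finite) set \<Rightarrow> 'n list \<Rightarrow> (real^'n \<Rightarrow> 'b::euclidean_space) \<Rightarrow> real^'n \<Rightarrow> 'b" where
  "weak_deriv \<Omega> \<alpha> u = (SOME v. has_weak_deriv \<Omega> \<alpha> u v)"

definition weak_grad :: "(real^'n::finite) set \<Rightarrow> (real^'n \<Rightarrow> real) \<Rightarrow> real^'n \<Rightarrow> real^'n" where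
  "weak_grad \<Omega> p x = (\<chi> i. weak_deriv \<Omega> [i] p x)"

definition has_weak_div ::
  "(real^'n::finite) set \<Rightarrow> (real^'n \<Rightarrow> real^'n) \<Rightarrow> (real^'n \<Rightarrow> real) \<Rightarrow> bool" where
  "has_weak_div \<Omega> u g \<longleftrightarrow>
     sq_integrable (lebesgue_on \<Omega>) u \<and> sq_integrable (lebesgue_on \<Omega>) g \<and>
     (\<forall>\<phi>\<in>test_functions \<Omega>. (\<integral>x. u x \<bullet> gradient \<phi> x \<partial>lebesgue_on \<Omega>) =
                            - (\<integral>x. g x * \<phi> x \<partial>lebesgue_on \<Omega>))"

definition weak_div :: "(real^'n::finite) set \<Rightarrow> (real^'n \<Rightarrow> real^'n) \<Rightarrow> real^'n \<Rightarrow> real" where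
  "weak_div \<Omega> u = (SOME g. has_weak_div \<Omega> u g)"

definition H_div :: "(real^'n::finite) set \<Rightarrow> (real^'n \<Rightarrow> real^'n) set" where
  "H_div \<Omega> = {u. \<exists>g. has_weak_div \<Omega> u g}"

text \<open>
  The double integral of the Sobolev-Slobodeckij seminorm; on the diagonal the integrand is zero,
  because division by zero yields zero.
\<close>

definition slobodeckij ::
  "'a::metric_space measure \<Rightarrow> real \<Rightarrow> ('a \<Rightarrow> 'b::euclidean_space) \<Rightarrow> ennreal" where
  "slobodeckij M e f = (\<integral>\<^sup>+ x. \<integral>\<^sup>+ y. ennreal ((norm (f x - f y))\<^sup>2 / dist x y powr e) \<partial>M \<partial>M)"

text \<open>
  The space of real order \<open>r \<ge> 0\<close>, for scalar and (componentwise) for vector-valued functions.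
  For \<open>r\<close> a natural number the Slobodeckij part is absent. In the norm the derivative of order \<open>j\<close>
  enters as a full tensor, so each mixed derivative is counted once for each order of its directions.
\<close>

definition sobolev ::
  "(real^'n::finite) set \<Rightarrow> real \<Rightarrow> (real^'n \<Rightarrow> 'b::euclidean_space) set" where
  "sobolev \<Omega> r =
     {u. sq_integrable (lebesgue_on \<Omega>) u \<and>
         (\<forall>\<alpha>. length \<alpha> \<le> nat \<lfloor>r\<rfloor> \<longrightarrow> (\<exists>v. has_weak_deriv \<Omega> \<alpha> u v)) \<and>
         (frac r > 0 \<longrightarrow> (\<forall>\<alpha>. length \<alpha> = nat \<lfloor>r\<rfloor> \<longrightarrow>
            slobodeckij (lebesgue_on \<Omega>) (real CARD('n) + 2 * frac r) (weak_deriv \<Omega> \<alpha> u) < \<infinity>))}"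

definition sobolev_norm ::
  "(real^'n::finite) set \<Rightarrow> real \<Rightarrow> (real^'n \<Rightarrow> 'b::euclidean_space) \<Rightarrow> real" where
  "sobolev_norm \<Omega> r u =
     sqrt ((\<Sum>\<alpha> | length \<alpha> \<le> nat \<lfloor>r\<rfloor>. (L2_norm (lebesgue_on \<Omega>) (weak_deriv \<Omega> \<alpha> u))\<^sup>2) +
           (if frac r > 0
            then \<Sum>\<alpha> | length \<alpha> = nat \<lfloor>r\<rfloor>.
                   enn2real (slobodeckij (lebesgue_on \<Omega>) (real CARD('n) + 2 * frac r) (weak_deriv \<Omega> \<alpha> u))
            else 0))"

section \<open>Domains\<close>

text \<open>
  Near each boundary point the set is the region above the graph, in the direction \<open>e\<close> and over the
  hyperplane orthogonal to \<open>e\<close>, of a function of the given class.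
\<close>

definition locally_epigraph ::
  "((real^'n::finite) \<Rightarrow> (real^'n \<Rightarrow> real) \<Rightarrow> bool) \<Rightarrow> (real^'n) set \<Rightarrow> bool" where
  "locally_epigraph P \<Omega> \<longleftrightarrow>
     (\<forall>x\<in>frontier \<Omega>. \<exists>r>0. \<exists>e \<gamma>. norm e = 1 \<and> P e \<gamma> \<and>
        \<Omega> \<inter> ball x r = {y \<in> ball x r. \<gamma> (y - (y \<bullet> e) *\<^sub>R e) < y \<bullet> e})"

definition lipschitz_domain :: "(real^'n::finite) set \<Rightarrow> bool" where
  "lipschitz_domain \<Omega> \<longleftrightarrow> open \<Omega> \<and> connected \<Omega> \<and> \<Omega> \<noteq> {} \<and>
     locally_epigraph (\<lambda>e \<gamma>. \<exists>L. L-lipschitz_on {y. y \<bullet> e = 0} \<gamma>) \<Omega>"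

definition smooth_domain :: "(real^'n::finite) set \<Rightarrow> bool" where
  "smooth_domain \<Omega> \<longleftrightarrow> open \<Omega> \<and> connected \<Omega> \<and> \<Omega> \<noteq> {} \<and> locally_epigraph (\<lambda>e \<gamma>. smooth \<gamma>) \<Omega>"

section \<open>The boundary\<close>

text \<open>The \<open>s\<close>-dimensional Hausdorff measure, normalised to agree with Lebesgue measure.\<close>

definition hausdorff_pre :: "nat \<Rightarrow> real \<Rightarrow> 'a::metric_space set \<Rightarrow> ennreal" where
  "hausdorff_pre s \<delta> A =
     (INF U \<in> {U :: nat \<Rightarrow> 'a set. A \<subseteq> (\<Union>i. U i) \<and> (\<forall>i. bounded (U i) \<and> diameter (U i) \<le> \<delta>)}.
        \<Sum>i. if U i = {} then 0 else ennreal (unit_ball_vol (real s) * (diameter (U i) / 2) ^ s))"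

definition hausdorff_measure :: "nat \<Rightarrow> 'a::metric_space measure" where
  "hausdorff_measure s = measure_of UNIV (sets borel) (\<lambda>A. SUP \<delta>\<in>{0<..}. hausdorff_pre s \<delta> A)"

definition surface :: "(real^'n::finite) set \<Rightarrow> (real^'n) measure" where
  "surface \<Omega> = restrict_space (hausdorff_measure (CARD('n) - 1)) (frontier \<Omega>)"

text \<open>
  The boundary has dimension \<open>d - 1\<close>, so the exponent in the \<open>H\<^sup>1\<^sup>/\<^sup>2\<close> seminorm is
  \<open>(d - 1) + 2 \<cdot> 1/2 = d\<close>.
\<close>

definition H_half_boundary :: "(real^'n::finite) set \<Rightarrow> (real^'n \<Rightarrow> real) set" where
  "H_half_boundary \<Omega> =
     {q. sq_integrable (surface \<Omega>) q \<and> slobodeckij (surface \<Omega>) (real CARD('n)) q < \<infinity>}"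

text \<open>
  The trace operator is the continuous extension to \<open>H\<^sup>1\<close> of the restriction to the boundary of
  functions that are smooth up to the boundary.
\<close>

definition has_trace ::
  "(real^'n::finite) set \<Rightarrow> (real^'n \<Rightarrow> real) \<Rightarrow> (real^'n \<Rightarrow> real) \<Rightarrow> bool" where
  "has_trace \<Omega> p q \<longleftrightarrow>
     p \<in> sobolev \<Omega> 1 \<and> sq_integrable (surface \<Omega>) q \<and>
     (\<exists>\<phi>. (\<forall>k::nat. smooth (\<phi> k) \<and> \<phi> k \<in> sobolev \<Omega> 1 \<and> sq_integrable (surface \<Omega>) (\<phi> k)) \<and>
          (\<lambda>k. sobolev_norm \<Omega> 1 (\<lambda>x. \<phi> k x - p x)) \<longlonglongrightarrow> 0 \<and>
          (\<lambda>k. L2_norm (surface \<Omega>) (\<lambda>x. \<phi> k x - q x)) \<longlonglongrightarrow> 0)"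

text \<open>
  The normal component \<open>v \<cdot> n\<close> on the boundary, with \<open>n\<close> the outward unit normal, of a field
  \<open>v \<in> H(div)\<close> that need not be continuous: it is determined, as usual, by Green's formula, tested
  with functions smooth up to the boundary. For a bounded field with bounded divergence, such as a
  piecewise polynomial one, on a bounded Lipschitz domain it exists, and is unique up to null sets.
\<close>

definition has_normal_trace ::
  "(real^'n::finite) set \<Rightarrow> (real^'n \<Rightarrow> real^'n) \<Rightarrow> (real^'n \<Rightarrow> real) \<Rightarrow> bool" where
  "has_normal_trace \<Omega> v \<mu> \<longleftrightarrow>
     v \<in> H_div \<Omega> \<and> sq_integrable (surface \<Omega>) \<mu> \<and>
     (\<forall>\<phi>. smooth \<phi> \<longrightarrow>
        L2_inner (lebesgue_on \<Omega>) v (gradient \<phi>) + L2_inner (lebesgue_on \<Omega>) (weak_div \<Omega> v) \<phi>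
        = L2_inner (surface \<Omega>) \<mu> \<phi>)"

section \<open>The continuous problem, elliptic regularity and extension\<close>

definition darcy_solution ::
  "(real^'n::finite) set \<Rightarrow> (real^'n \<Rightarrow> real^'n) \<Rightarrow> (real^'n \<Rightarrow> real) \<Rightarrow> (real^'n \<Rightarrow> real) \<Rightarrow>
   (real^'n \<Rightarrow> real^'n) \<Rightarrow> (real^'n \<Rightarrow> real) \<Rightarrow> bool" where
  "darcy_solution \<Omega> f g p\<^sub>\<Gamma> u p \<longleftrightarrow>
     u \<in> H_div \<Omega> \<and> p \<in> sobolev \<Omega> 1 \<and>
     (AE x in lebesgue_on \<Omega>. u x + weak_grad \<Omega> p x = f x) \<and>
     (AE x in lebesgue_on \<Omega>. weak_div \<Omega> u x = - g x) \<and>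
     has_trace \<Omega> p p\<^sub>\<Gamma>"

definition dirichlet_solution ::
  "(real^'n::finite) set \<Rightarrow> (real^'n \<Rightarrow> real) \<Rightarrow> (real^'n \<Rightarrow> real) \<Rightarrow> bool" where
  "dirichlet_solution \<Omega> \<rho> \<xi> \<longleftrightarrow>
     \<xi> \<in> sobolev \<Omega> 1 \<and> has_trace \<Omega> \<xi> (\<lambda>_. 0) \<and>
     (\<forall>\<phi>\<in>test_functions \<Omega>.
        L2_inner (lebesgue_on \<Omega>) (weak_grad \<Omega> \<xi>) (gradient \<phi>) = L2_inner (lebesgue_on \<Omega>) \<rho> \<phi>)"

definition elliptic_regularity :: "(real^'n::finite) set \<Rightarrow> bool" where
  "elliptic_regularity \<Omega> \<longleftrightarrow>
     (\<exists>C>0. \<forall>\<rho> \<xi>. sq_integrable (lebesgue_on \<Omega>) \<rho> \<and> dirichlet_solution \<Omega> \<rho> \<xi> \<longrightarrow>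
        \<xi> \<in> sobolev \<Omega> 2 \<and> sobolev_norm \<Omega> 2 \<xi> \<le> C * L2_norm (lebesgue_on \<Omega>) \<rho>)"

definition stable_extension ::
  "(real^'n::finite) set \<Rightarrow> (real^'n) set \<Rightarrow> nat \<Rightarrow> nat \<Rightarrow>
   ((real^'n \<Rightarrow> real^'n) \<Rightarrow> (real^'n \<Rightarrow> real^'n)) \<Rightarrow> bool" where
  "stable_extension \<Omega> \<Omega>ext ku kp E \<longleftrightarrow>
     (\<forall>u. sq_integrable (lebesgue_on \<Omega>) u \<longrightarrow> (AE x in lebesgue_on \<Omega>. E u x = u x)) \<and>
     (\<forall>r. 0 \<le> r \<and> r \<le> real (ku + 1) \<longrightarrow>
        (\<exists>C>0. \<forall>u\<in>sobolev \<Omega> r. E u \<in> sobolev \<Omega>ext r \<and>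
           sobolev_norm \<Omega>ext r (E u) \<le> C * sobolev_norm \<Omega> r u)) \<and>
     (\<forall>s. 0 \<le> s \<and> s \<le> real (kp + 1) \<longrightarrow>
        (\<exists>C>0. \<forall>u\<in>sobolev \<Omega> (s + 1). E u \<in> H_div \<Omega>ext \<and> weak_div \<Omega>ext (E u) \<in> sobolev \<Omega>ext s \<and>
           sobolev_norm \<Omega>ext s (weak_div \<Omega>ext (E u)) \<le> C * sobolev_norm \<Omega> (s + 1) u))"

section \<open>Discretisations\<close>

text \<open>
  One member of a family of cut discretisations: a background domain and its mesh, the interpolators
  onto the two discrete spaces and the two stabilisation forms.
\<close>

record 'n discretisation =
  background :: "(real^'n) set"
  bg_mesh :: "(real^'n) set set"
  interp_d :: "(real^'n \<Rightarrow> real^'n) \<Rightarrow> (real^'n \<Rightarrow> real^'n)"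
  interp_0 :: "(real^'n \<Rightarrow> real) \<Rightarrow> (real^'n \<Rightarrow> real)"
  stab_d :: "(real^'n \<Rightarrow> real^'n) \<Rightarrow> (real^'n \<Rightarrow> real^'n) \<Rightarrow> real"
  stab_0 :: "(real^'n \<Rightarrow> real) \<Rightarrow> (real^'n \<Rightarrow> real) \<Rightarrow> real"

definition conforming_mesh :: "(real^'n::finite) set \<Rightarrow> (real^'n) set set \<Rightarrow> bool" where
  "conforming_mesh B \<T> \<longleftrightarrow>
     finite \<T> \<and> \<Union>\<T> = closure B \<and>
     (\<forall>T\<in>\<T>. polytope T \<and> interior T \<noteq> {}) \<and>
     (\<forall>T\<in>\<T>. \<forall>T'\<in>\<T>. (T \<inter> T') face_of T \<and> (T \<inter> T') face_of T')"

definition mesh_size :: "'n::finite discretisation \<Rightarrow> real" where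
  "mesh_size D = Max (diameter ` bg_mesh D)"

definition active_mesh :: "(real^'n::finite) set \<Rightarrow> 'n discretisation \<Rightarrow> (real^'n) set set" where
  "active_mesh \<Omega> D = {T \<in> bg_mesh D. T \<inter> \<Omega> \<noteq> {}}"

definition active_domain :: "(real^'n::finite) set \<Rightarrow> 'n discretisation \<Rightarrow> (real^'n) set" where
  "active_domain \<Omega> D = interior (closure (\<Union>(active_mesh \<Omega> D)))"

definition shape_regular :: "'n::finite discretisation set \<Rightarrow> bool" where
  "shape_regular \<F> \<longleftrightarrow>
     (\<exists>\<kappa>>0. \<forall>D\<in>\<F>. \<forall>T\<in>bg_mesh D. \<exists>x. cball x (\<kappa> * diameter T) \<subseteq> T)"

definition quasi_uniform :: "'n::finite discretisation set \<Rightarrow> bool" where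
  "quasi_uniform \<F> \<longleftrightarrow> (\<exists>\<kappa>>0. \<forall>D\<in>\<F>. \<forall>T\<in>bg_mesh D. \<kappa> * mesh_size D \<le> diameter T)"

text \<open>
  Throughout, an estimate \<open>a \<lesssim> b\<close> becomes the existence of one constant for all members of a family
  \<open>\<F>\<close>, which varies both the mesh size and the position of the mesh relative to the boundary.
\<close>

definition mesh_family ::
  "(real^'n::finite) set \<Rightarrow> (real^'n) set \<Rightarrow> real \<Rightarrow> 'n discretisation set \<Rightarrow> bool" where
  "mesh_family \<Omega> \<Omega>ext h\<^sub>0 \<F> \<longleftrightarrow>
     (\<forall>D\<in>\<F>. open (background D) \<and> connected (background D) \<and> bounded (background D) \<and>
        \<Omega> \<subseteq> background D \<and> conforming_mesh (background D) (bg_mesh D) \<and>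
        0 < mesh_size D \<and> mesh_size D \<le> h\<^sub>0 \<and> active_domain \<Omega> D \<subseteq> \<Omega>ext) \<and>
     shape_regular \<F> \<and> quasi_uniform \<F>"

section \<open>Discrete spaces\<close>

definition polynomial_space :: "(real^'n::finite \<Rightarrow> 'b::euclidean_space) set \<Rightarrow> bool" where
  "polynomial_space V \<longleftrightarrow>
     (\<forall>v\<in>V. polynomial_function v) \<and> (\<lambda>_. 0) \<in> V \<and>
     (\<forall>v\<in>V. \<forall>w\<in>V. (\<lambda>x. v x + w x) \<in> V) \<and> (\<forall>v\<in>V. \<forall>c. (\<lambda>x. c *\<^sub>R v x) \<in> V)"

definition poly_le :: "nat \<Rightarrow> (real^'n::finite \<Rightarrow> real) set" where
  "poly_le k = {q. \<exists>c :: ('n \<Rightarrow> nat) \<Rightarrow> real.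
     q = (\<lambda>x. \<Sum>a | sum a UNIV \<le> k. c a * (\<Prod>i\<in>UNIV. x $ i ^ a i))}"

definition vec_poly_le :: "nat \<Rightarrow> (real^'n::finite \<Rightarrow> real^'n) set" where
  "vec_poly_le k = {v. \<forall>i. (\<lambda>x. v x $ i) \<in> poly_le k}"

definition local_space :: "('a \<Rightarrow> 'b) set \<Rightarrow> 'a set \<Rightarrow> ('a \<Rightarrow> 'b) set" where
  "local_space V T = (\<lambda>v. restrict v T) ` V"

definition largest_degree ::
  "(nat \<Rightarrow> ('a \<Rightarrow> 'b) set) \<Rightarrow> ('a \<Rightarrow> 'b) set \<Rightarrow> 'a set set \<Rightarrow> nat \<Rightarrow> bool" where
  "largest_degree P V \<T> k \<longleftrightarrow>
     (\<forall>T\<in>\<T>. local_space (P k) T \<subseteq> local_space V T) \<and>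
     (\<forall>j. (\<forall>T\<in>\<T>. local_space (P j) T \<subseteq> local_space V T) \<longrightarrow> j \<le> k)"

definition V_d ::
  "(real^'n::finite) set \<Rightarrow> (real^'n \<Rightarrow> real^'n) set \<Rightarrow> 'n discretisation \<Rightarrow> (real^'n \<Rightarrow> real^'n) set" where
  "V_d \<Omega> Pd D =
     {v \<in> H_div (active_domain \<Omega> D).
        \<forall>T\<in>active_mesh \<Omega> D. \<exists>w\<in>local_space Pd T. AE x in lebesgue_on T. v x = w x}"

definition V_0 ::
  "(real^'n::finite) set \<Rightarrow> (real^'n \<Rightarrow> real) set \<Rightarrow> 'n discretisation \<Rightarrow> (real^'n \<Rightarrow> real) set" where
  "V_0 \<Omega> P0 D =
     {q. sq_integrable (lebesgue_on (active_domain \<Omega> D)) q \<and>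
        (\<forall>T\<in>active_mesh \<Omega> D. \<exists>w\<in>local_space P0 T. AE x in lebesgue_on T. q x = w x)}"

text \<open>A linear projection from \<open>X\<close> onto \<open>V\<close>, for functions identified up to null sets.\<close>

definition linear_projection ::
  "'a measure \<Rightarrow> ('a \<Rightarrow> 'b::euclidean_space) set \<Rightarrow> ('a \<Rightarrow> 'b) set \<Rightarrow> (('a \<Rightarrow> 'b) \<Rightarrow> ('a \<Rightarrow> 'b)) \<Rightarrow> bool" where
  "linear_projection M X V I \<longleftrightarrow>
     (\<forall>u\<in>X. I u \<in> V) \<and> (\<forall>v\<in>V. AE x in M. I v x = v x) \<and>
     (\<forall>u\<in>X. \<forall>w\<in>X. AE x in M. I (\<lambda>y. u y + w y) x = I u x + I w x) \<and>
     (\<forall>u\<in>X. \<forall>c. AE x in M. I (\<lambda>y. c *\<^sub>R u y) x = c *\<^sub>R I u x)"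

text \<open>
  The interpolator of the flux is only required to be defined on \<open>H(div)\<close>. For orders \<open>r \<ge> 1\<close> the
  intersection with \<open>H(div)\<close> below is no restriction.
\<close>

definition discrete_complex ::
  "(real^'n::finite) set \<Rightarrow> (real^'n \<Rightarrow> real^'n) set \<Rightarrow> (real^'n \<Rightarrow> real) set \<Rightarrow> nat \<Rightarrow> nat \<Rightarrow>
   'n discretisation set \<Rightarrow> bool" where
  "discrete_complex \<Omega> Pd P0 ku kp \<F> \<longleftrightarrow>
     polynomial_space Pd \<and> polynomial_space P0 \<and>
     (\<forall>D\<in>\<F>. let \<Omega>h = active_domain \<Omega> D; M = lebesgue_on \<Omega>h in
        largest_degree vec_poly_le Pd (active_mesh \<Omega> D) ku \<and>
        largest_degree poly_le P0 (active_mesh \<Omega> D) kp \<and>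
        (\<forall>v\<in>V_d \<Omega> Pd D. weak_div \<Omega>h v \<in> V_0 \<Omega> P0 D) \<and>
        (\<forall>q\<in>V_0 \<Omega> P0 D. \<exists>v\<in>V_d \<Omega> Pd D. AE x in M. weak_div \<Omega>h v x = q x) \<and>
        linear_projection M (H_div \<Omega>h) (V_d \<Omega> Pd D) (interp_d D) \<and>
        linear_projection M {q. sq_integrable M q} (V_0 \<Omega> P0 D) (interp_0 D) \<and>
        (\<forall>u\<in>H_div \<Omega>h. AE x in M. weak_div \<Omega>h (interp_d D u) x = interp_0 D (weak_div \<Omega>h u) x)) \<and>
     (\<forall>r\<le>ku + 1. \<exists>C>0. \<forall>D\<in>\<F>. let \<Omega>h = active_domain \<Omega> D in
        \<forall>u\<in>sobolev \<Omega>h (real r) \<inter> H_div \<Omega>h.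
          L2_norm (lebesgue_on \<Omega>h) (\<lambda>x. u x - interp_d D u x)
          \<le> C * mesh_size D ^ r * sobolev_norm \<Omega>h (real r) u) \<and>
     (\<forall>t\<le>kp + 1. \<exists>C>0. \<forall>D\<in>\<F>. let \<Omega>h = active_domain \<Omega> D in
        \<forall>p\<in>sobolev \<Omega>h (real t).
          L2_norm (lebesgue_on \<Omega>h) (\<lambda>x. p x - interp_0 D p x)
          \<le> C * mesh_size D ^ t * sobolev_norm \<Omega>h (real t) p)"

section \<open>Stabilisation\<close>

definition sym_psd_form ::
  "('a \<Rightarrow> 'b::real_vector) set \<Rightarrow> (('a \<Rightarrow> 'b) \<Rightarrow> ('a \<Rightarrow> 'b) \<Rightarrow> real) \<Rightarrow> bool" where
  "sym_psd_form V s \<longleftrightarrow>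
     (\<forall>v\<in>V. \<forall>w\<in>V. s v w = s w v) \<and> (\<forall>v\<in>V. 0 \<le> s v v) \<and>
     (\<forall>v\<in>V. \<forall>w\<in>V. \<forall>z\<in>V. s (\<lambda>x. v x + w x) z = s v z + s w z) \<and>
     (\<forall>v\<in>V. \<forall>z\<in>V. \<forall>c. s (\<lambda>x. c *\<^sub>R v x) z = c * s v z)"

definition norm_equivalence ::
  "(real^'n::finite) set \<Rightarrow> 'n discretisation set \<Rightarrow>
   ('n discretisation \<Rightarrow> (real^'n \<Rightarrow> 'b::euclidean_space) set) \<Rightarrow>
   ('n discretisation \<Rightarrow> (real^'n \<Rightarrow> 'b) \<Rightarrow> (real^'n \<Rightarrow> 'b) \<Rightarrow> real) \<Rightarrow> bool" where
  "norm_equivalence \<Omega> \<F> V s \<longleftrightarrow>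
     (\<exists>C>0. \<forall>D\<in>\<F>. \<forall>w\<in>V D.
        (L2_norm (lebesgue_on \<Omega>) w)\<^sup>2 + s D w w \<le> C * (L2_norm (lebesgue_on (active_domain \<Omega> D)) w)\<^sup>2 \<and>
        (L2_norm (lebesgue_on (active_domain \<Omega> D)) w)\<^sup>2 \<le> C * ((L2_norm (lebesgue_on \<Omega>) w)\<^sup>2 + s D w w))"

definition stabilisation ::
  "(real^'n::finite) set \<Rightarrow> (real^'n) set \<Rightarrow> (real^'n \<Rightarrow> real^'n) set \<Rightarrow> (real^'n \<Rightarrow> real) set \<Rightarrow>
   nat \<Rightarrow> nat \<Rightarrow> 'n discretisation set \<Rightarrow> bool" where
  "stabilisation \<Omega> \<Omega>ext Pd P0 ku kp \<F> \<longleftrightarrow>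
     (\<forall>D\<in>\<F>. sym_psd_form (V_d \<Omega> Pd D) (stab_d D) \<and> sym_psd_form (V_0 \<Omega> P0 D) (stab_0 D)) \<and>
     norm_equivalence \<Omega> \<F> (V_d \<Omega> Pd) stab_d \<and>
     norm_equivalence \<Omega> \<F> (V_0 \<Omega> P0) stab_0 \<and>
     (\<forall>s. 0 \<le> s \<and> s \<le> real (ku + 1) \<longrightarrow> (\<exists>C>0. \<forall>D\<in>\<F>.
        \<forall>w\<in>sobolev \<Omega>ext s \<inter> H_div (active_domain \<Omega> D). \<forall>v\<in>V_d \<Omega> Pd D.
          stab_d D (interp_d D w) v
          \<le> C * mesh_size D powr s * sobolev_norm \<Omega>ext s w
              * L2_norm (lebesgue_on (active_domain \<Omega> D)) v)) \<and>
     (\<forall>t. 0 \<le> t \<and> t \<le> real (kp + 1) \<longrightarrow> (\<exists>C>0. \<forall>D\<in>\<F>.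
        \<forall>r\<in>sobolev \<Omega>ext t. \<forall>q\<in>V_0 \<Omega> P0 D.
          stab_0 D (interp_0 D r) q
          \<le> C * mesh_size D powr t * sobolev_norm \<Omega>ext t r
              * L2_norm (lebesgue_on (active_domain \<Omega> D)) q)) \<and>
     (\<forall>D\<in>\<F>. \<forall>c. \<forall>q\<in>V_0 \<Omega> P0 D. stab_0 D (\<lambda>_. c) q = 0)"

definition stab_kernel ::
  "(real^'n::finite) set \<Rightarrow> (real^'n \<Rightarrow> real) set \<Rightarrow> 'n discretisation \<Rightarrow> (real^'n \<Rightarrow> real) set" where
  "stab_kernel \<Omega> P0 D = {q \<in> V_0 \<Omega> P0 D. \<forall>\<phi>\<in>V_0 \<Omega> P0 D. stab_0 D q \<phi> = 0}"

definition kernel_approximation ::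
  "(real^'n::finite) set \<Rightarrow> (real^'n) set \<Rightarrow> (real^'n \<Rightarrow> real) set \<Rightarrow> nat \<Rightarrow> 'n discretisation set \<Rightarrow> bool" where
  "kernel_approximation \<Omega> \<Omega>ext P0 kp \<F> \<longleftrightarrow>
     (\<forall>t. 0 \<le> t \<and> t \<le> real (kp + 1) \<longrightarrow> (\<exists>C>0. \<forall>D\<in>\<F>. \<forall>r\<in>sobolev \<Omega>ext t. \<exists>w\<in>stab_kernel \<Omega> P0 D.
        L2_norm (lebesgue_on (active_domain \<Omega> D)) (\<lambda>x. r x - w x)
        \<le> C * mesh_size D powr t * sobolev_norm \<Omega>ext t r))"

section \<open>The discrete problem\<close>

definition a_h ::
  "(real^'n::finite) set \<Rightarrow> real \<Rightarrow> 'n discretisation \<Rightarrow>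
   (real^'n \<Rightarrow> real^'n) \<Rightarrow> (real^'n \<Rightarrow> real^'n) \<Rightarrow> real" where
  "a_h \<Omega> \<tau>d D u v = L2_inner (lebesgue_on \<Omega>) u v + \<tau>d * stab_d D u v"

definition b_h ::
  "(real^'n::finite) set \<Rightarrow> real \<Rightarrow> 'n discretisation \<Rightarrow>
   (real^'n \<Rightarrow> real^'n) \<Rightarrow> (real^'n \<Rightarrow> real) \<Rightarrow> real" where
  "b_h \<Omega> \<tau>0 D v q =
     - L2_inner (lebesgue_on \<Omega>) (weak_div (active_domain \<Omega> D) v) q
     - \<tau>0 * stab_0 D (weak_div (active_domain \<Omega> D) v) q"

definition discrete_solution ::
  "(real^'n::finite) set \<Rightarrow> (real^'n \<Rightarrow> real^'n) set \<Rightarrow> (real^'n \<Rightarrow> real) set \<Rightarrow> real \<Rightarrow> real \<Rightarrow>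
   'n discretisation \<Rightarrow> (real^'n \<Rightarrow> real^'n) \<Rightarrow> (real^'n \<Rightarrow> real) \<Rightarrow> (real^'n \<Rightarrow> real) \<Rightarrow>
   (real^'n \<Rightarrow> real^'n) \<Rightarrow> (real^'n \<Rightarrow> real) \<Rightarrow> bool" where
  "discrete_solution \<Omega> Pd P0 \<tau>d \<tau>0 D f g p\<^sub>\<Gamma> uh ph \<longleftrightarrow>
     uh \<in> V_d \<Omega> Pd D \<and> ph \<in> V_0 \<Omega> P0 D \<and>
     (\<forall>v\<in>V_d \<Omega> Pd D. \<exists>vn. has_normal_trace \<Omega> v vn \<and>
        a_h \<Omega> \<tau>d D uh v + b_h \<Omega> \<tau>0 D v ph
        = L2_inner (lebesgue_on \<Omega>) f v - L2_inner (surface \<Omega>) vn p\<^sub>\<Gamma>) \<and>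
     (\<forall>q\<in>V_0 \<Omega> P0 D. b_h \<Omega> \<tau>0 D uh q = L2_inner (lebesgue_on \<Omega>) g q)"

end

theory Submission
  imports Defs "HOL-Computational_Algebra.Polynomial"
begin

text \<open>
  The idea is to estimate the divergence first, and then the flux with divergence-free test functions,
  so that the pressure never has to be estimated. Write \<open>\<Omega>\<^sub>h\<close> for the active domain, \<open>N\<close> for the norm of
  \<open>L\<^sup>2(\<Omega>\<^sub>h)\<close>, \<open>U\<close> for the extension of the exact flux \<open>u\<close> and \<open>r\<close> for the divergence of \<open>U\<close>. On
  the discrete spaces the norm equivalences turn bounds of the form
  \<open>\<parallel>v\<parallel>\<^sup>2 + \<tau> s(v, v) \<le> K N(v)\<close>, with the norm of \<open>L\<^sup>2(\<Omega>)\<close> on the left, into bounds of \<open>N(v)\<close>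
  by a multiple of \<open>K\<close> (\<open>energy_bound\<close>).

  Divergence. Since \<open>div V\<^sub>d \<subseteq> V\<^sub>0\<close>, the function \<open>e = div u\<^sub>h - \<Pi>\<^sub>0 r\<close> is admissible in the second
  discrete equation. Together with \<open>div u = -g\<close> this bounds \<open>N(e)\<close> by the interpolation error of \<open>r\<close>
  and the consistency error of the stabilisation, both of order \<open>h^(kp+1)\<close> (\<open>divergence_error\<close>).

  Lifting. The field \<open>u\<^sub>h - \<Pi>\<^sub>d U\<close> has divergence \<open>e\<close>, because the interpolators commute with the
  divergence. To make it divergence-free, a discrete field \<open>z\<close> with \<open>div z = e\<close> and \<open>N(z) \<le> C N(e)\<close>
  is subtracted (\<open>discrete_divergence_lifting\<close>): \<open>z = \<Pi>\<^sub>d w\<close>, where \<open>w\<close> is obtained by integrating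
  \<open>e\<close> along a coordinate direction (\<open>weak_div_right_inverse\<close>). The interpolator \<open>\<Pi>\<^sub>d\<close> is bounded in
  \<open>L\<^sup>2(\<Omega>\<^sub>h)\<close>, by its error estimate of order zero, and so it suffices that \<open>w\<close> lies in \<open>H(div)\<close>.

  Flux. The field \<open>v = u\<^sub>h - \<Pi>\<^sub>d U - z\<close> is a divergence-free test function for the first discrete
  equation. The discrete pressure drops out, and so does the exact one by Green's formula, leaving
  \<open>a\<^sub>h(u\<^sub>h, v) = (u, v)\<close> (\<open>divergence_free_consistency\<close>). Hence the energy of \<open>v\<close> is bounded by the
  interpolation error of \<open>U\<close>, the consistency error of the stabilisation and \<open>N(z)\<close> (\<open>flux_error\<close>).

  All this presupposes that weak derivatives and weak divergences are determined up to null sets, and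
  so agree on nested domains. This is the fundamental lemma of the calculus of variations, which is
  proved with smooth bump functions that increase to the indicator of a box (\<open>fundamental_lemma\<close>).
\<close>

section \<open>Symmetric positive semidefinite forms\<close>

definition function_subspace :: "('a \<Rightarrow> 'b::real_vector) set \<Rightarrow> bool" where
  "function_subspace V \<longleftrightarrow>
     (\<forall>v\<in>V. \<forall>w\<in>V. (\<lambda>x. v x + w x) \<in> V) \<and> (\<forall>v\<in>V. \<forall>c. (\<lambda>x. c *\<^sub>R v x) \<in> V)"

lemma function_subspaceD:
  assumes "function_subspace V" "v \<in> V" "w \<in> V"
  shows "(\<lambda>x. v x + w x) \<in> V" "(\<lambda>x. c *\<^sub>R v x) \<in> V" "(\<lambda>x. v x - w x) \<in> V"
proof -
  have add: "(\<lambda>x. f x + g x) \<in> V" if "f \<in> V" "g \<in> V" for f g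
    using assms(1) that by (simp add: function_subspace_def)
  have scale: "(\<lambda>x. c *\<^sub>R f x) \<in> V" if "f \<in> V" for f c
    using assms(1) that by (simp add: function_subspace_def)
  show "(\<lambda>x. v x + w x) \<in> V" "(\<lambda>x. c *\<^sub>R v x) \<in> V"
    using add scale assms(2,3) by auto
  show "(\<lambda>x. v x - w x) \<in> V"
    using add[OF assms(2) scale[OF assms(3), of "-1"]] by simp
qed

lemma sym_psd_form_add:
  assumes "sym_psd_form V s" "v \<in> V" "w \<in> V" "z \<in> V"
  shows "s (\<lambda>x. v x + w x) z = s v z + s w z"
  using assms by (simp add: sym_psd_form_def)

lemma sym_psd_form_scale:
  assumes "sym_psd_form V s" "v \<in> V" "z \<in> V"
  shows "s (\<lambda>x. c *\<^sub>R v x) z = c * s v z"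
  using assms unfolding sym_psd_form_def by blast

lemma sym_psd_form_diff:
  assumes "sym_psd_form V s" "function_subspace V" "v \<in> V" "w \<in> V" "z \<in> V"
  shows "s (\<lambda>x. v x - w x) z = s v z - s w z"
proof -
  have "(\<lambda>x. (-1) *\<^sub>R w x) \<in> V"
    using function_subspaceD(2)[OF assms(2,4,4)] .
  from sym_psd_form_add[OF assms(1,3) this assms(5)] sym_psd_form_scale[OF assms(1,4,5), of "-1"]
  show ?thesis by simp
qed

lemma sym_psd_form_sym:
  assumes "sym_psd_form V s" "v \<in> V" "z \<in> V"
  shows "s v z = s z v"
  using assms unfolding sym_psd_form_def by blast

lemma sym_psd_form_nonneg:
  assumes "sym_psd_form V s" "v \<in> V"
  shows "0 \<le> s v v"
  using assms unfolding sym_psd_form_def by blast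

text \<open>
  The form is nonnegative along the line \<open>v + c w\<close>, so this quadratic polynomial in \<open>c\<close> has a
  nonpositive discriminant.
\<close>

lemma sym_psd_form_Cauchy_Schwarz:
  assumes s: "sym_psd_form V s" and V: "function_subspace V" and v: "v \<in> V" and w: "w \<in> V"
  shows "\<bar>s v w\<bar> \<le> sqrt (s v v) * sqrt (s w w)"
proof -
  have quad: "0 \<le> s v v + 2 * c * s v w + c\<^sup>2 * s w w" for c
  proof -
    have cw: "(\<lambda>x. c *\<^sub>R w x) \<in> V"
      using V w by (simp add: function_subspaceD)
    have vcw: "(\<lambda>x. v x + c *\<^sub>R w x) \<in> V"
      using V v cw by (rule function_subspaceD)
    have line: "s (\<lambda>x. v x + c *\<^sub>R w x) z = s v z + c * s w z" if "z \<in> V" for z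
      using sym_psd_form_add[OF s v cw that] sym_psd_form_scale[OF s w that] by simp
    have "s (\<lambda>x. v x + c *\<^sub>R w x) (\<lambda>x. v x + c *\<^sub>R w x)
        = s v (\<lambda>x. v x + c *\<^sub>R w x) + c * s w (\<lambda>x. v x + c *\<^sub>R w x)"
      using line vcw .
    also have "s v (\<lambda>x. v x + c *\<^sub>R w x) = s v v + c * s v w"
      using sym_psd_form_sym[OF s v vcw] line[OF v] sym_psd_form_sym[OF s v w] by simp
    also have "s w (\<lambda>x. v x + c *\<^sub>R w x) = s v w + c * s w w"
      using sym_psd_form_sym[OF s w vcw] line[OF w] by simp
    finally show ?thesis
      using sym_psd_form_nonneg[OF s vcw] by (simp add: algebra_simps power2_eq_square)
  qed
  have nn: "0 \<le> s v v" "0 \<le> s w w"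
    using sym_psd_form_nonneg s v w by blast+
  have "(s v w)\<^sup>2 \<le> s v v * s w w"
  proof (cases "s w w = 0")
    case True
    have "s v w = 0"
    proof (rule ccontr)
      assume nz: "s v w \<noteq> 0"
      have "0 \<le> s v v + 2 * (- (s v v + 1) / (2 * s v w)) * s v w"
        using quad[of "- (s v v + 1) / (2 * s v w)"] True by simp
      also have "\<dots> = - 1"
        using nz by (simp add: field_simps)
      finally show False by simp
    qed
    then show ?thesis using nn by simp
  next
    case False
    then have pos: "0 < s w w" using nn by simp
    have "0 \<le> s v v - (s v w)\<^sup>2 / s w w"
      using quad[of "- s v w / s w w"] pos by (simp add: field_simps power2_eq_square)
    then show ?thesis
      using pos by (simp add: field_simps)
  qed
  then have "sqrt ((s v w)\<^sup>2) \<le> sqrt (s v v * s w w)"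
    by (rule real_sqrt_le_mono)
  then show ?thesis
    by (simp add: real_sqrt_mult)
qed

lemma sym_psd_form_null:
  assumes "sym_psd_form V s" "function_subspace V" "v \<in> V" "w \<in> V" "s v v = 0"
  shows "s v w = 0"
  using sym_psd_form_Cauchy_Schwarz[OF assms(1-4)] assms(5) by simp

section \<open>Square-integrable functions\<close>

lemma sq_integrable_borel: "sq_integrable M f \<Longrightarrow> f \<in> borel_measurable M"
  by (simp add: sq_integrable_def)

lemma integrable_inner_sq:
  assumes f: "sq_integrable M f" and g: "sq_integrable M g"
  shows "integrable M (\<lambda>x. f x \<bullet> g x)"
proof (rule Bochner_Integration.integrable_bound)
  show "integrable M (\<lambda>x. (norm (f x))\<^sup>2 + (norm (g x))\<^sup>2)"
    using f g by (auto simp: sq_integrable_def)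
  show "(\<lambda>x. f x \<bullet> g x) \<in> borel_measurable M"
    using f g by (auto simp: sq_integrable_def)
  show "AE x in M. norm (f x \<bullet> g x) \<le> norm ((norm (f x))\<^sup>2 + (norm (g x))\<^sup>2)"
  proof (rule AE_I2)
    fix x
    have "\<bar>f x \<bullet> g x\<bar> \<le> norm (f x) * norm (g x)"
      by (rule Cauchy_Schwarz_ineq2)
    also have "\<dots> \<le> (norm (f x))\<^sup>2 + (norm (g x))\<^sup>2"
      using sum_squares_bound[of "norm (f x)" "norm (g x)"]
        mult_nonneg_nonneg[OF norm_ge_zero[of "f x"] norm_ge_zero[of "g x"]] by linarith
    finally show "norm (f x \<bullet> g x) \<le> norm ((norm (f x))\<^sup>2 + (norm (g x))\<^sup>2)" by simp
  qed
qed

lemma sq_integrable_scaleR: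
  assumes "sq_integrable M f" shows "sq_integrable M (\<lambda>x. c *\<^sub>R f x)"
  using assms by (auto simp: sq_integrable_def power_mult_distrib)

lemma sq_integrable_add:
  assumes f: "sq_integrable M f" and g: "sq_integrable M g"
  shows "sq_integrable M (\<lambda>x. f x + g x)"
proof -
  have "integrable M (\<lambda>x. (norm (f x))\<^sup>2 + 2 * (f x \<bullet> g x) + (norm (g x))\<^sup>2)"
    using f g integrable_inner_sq[OF f g] by (auto simp: sq_integrable_def)
  moreover have "(norm (f x))\<^sup>2 + 2 * (f x \<bullet> g x) + (norm (g x))\<^sup>2 = (norm (f x + g x))\<^sup>2" for x
    by (simp add: power2_norm_eq_inner inner_simps inner_commute)
  ultimately show ?thesis
    using f g by (auto simp: sq_integrable_def)
qed

lemma function_subspace_sq_integrable: "function_subspace {f. sq_integrable M f}"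
  by (simp add: function_subspace_def sq_integrable_add sq_integrable_scaleR)

lemma sq_integrable_diff:
  assumes "sq_integrable M f" "sq_integrable M g"
  shows "sq_integrable M (\<lambda>x. f x - g x)"
  using function_subspaceD(3)[OF function_subspace_sq_integrable, of f M g] assms by simp

lemma L2_inner_form: "sym_psd_form {f. sq_integrable M f} (L2_inner M)"
proof -
  have "L2_inner M (\<lambda>x. v x + w x) z = L2_inner M v z + L2_inner M w z"
    if "sq_integrable M v" "sq_integrable M w" "sq_integrable M z" for v w z
    using integrable_inner_sq[OF that(1,3)] integrable_inner_sq[OF that(2,3)]
    by (simp add: L2_inner_def inner_simps)
  then show ?thesis
    by (auto simp: sym_psd_form_def L2_inner_def inner_commute)
qed

lemma L2_inner_add_left:
  assumes "sq_integrable M f" "sq_integrable M g" "sq_integrable M k"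
  shows "L2_inner M (\<lambda>x. f x + g x) k = L2_inner M f k + L2_inner M g k"
  using sym_psd_form_add[OF L2_inner_form] assms by blast

lemma L2_inner_diff_left:
  assumes "sq_integrable M f" "sq_integrable M g" "sq_integrable M k"
  shows "L2_inner M (\<lambda>x. f x - g x) k = L2_inner M f k - L2_inner M g k"
  using sym_psd_form_diff[OF L2_inner_form function_subspace_sq_integrable] assms by blast

lemma L2_inner_commute: "L2_inner M f g = L2_inner M g f"
  by (simp add: L2_inner_def inner_commute)

lemma L2_inner_diff_right:
  assumes "sq_integrable M f" "sq_integrable M g" "sq_integrable M k"
  shows "L2_inner M k (\<lambda>x. f x - g x) = L2_inner M k f - L2_inner M k g"
  using L2_inner_diff_left[OF assms] by (simp add: L2_inner_commute)

lemma L2_inner_minus_left: "L2_inner M (\<lambda>x. - f x) k = - L2_inner M f k"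
  by (simp add: L2_inner_def)

lemma L2_inner_self_nonneg: "0 \<le> L2_inner M f f"
  by (simp add: L2_inner_def)

lemma L2_norm_nonneg: "0 \<le> L2_norm M f"
  by (simp add: L2_norm_def L2_inner_self_nonneg)

lemma L2_norm_square: "(L2_norm M f)\<^sup>2 = L2_inner M f f"
  by (simp add: L2_norm_def L2_inner_self_nonneg)

lemma L2_Cauchy_Schwarz:
  assumes "sq_integrable M f" "sq_integrable M g"
  shows "\<bar>L2_inner M f g\<bar> \<le> L2_norm M f * L2_norm M g"
  using sym_psd_form_Cauchy_Schwarz[OF L2_inner_form function_subspace_sq_integrable] assms
  by (simp add: L2_norm_def)

lemma L2_norm_minus: "L2_norm M (\<lambda>x. - f x) = L2_norm M f"
  by (simp add: L2_norm_def L2_inner_def)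

lemma L2_norm_triangle:
  assumes f: "sq_integrable M f" and g: "sq_integrable M g"
  shows "L2_norm M (\<lambda>x. f x + g x) \<le> L2_norm M f + L2_norm M g"
proof (rule power2_le_imp_le)
  have fg: "sq_integrable M (\<lambda>x. f x + g x)"
    using f g by (rule sq_integrable_add)
  have "(L2_norm M (\<lambda>x. f x + g x))\<^sup>2 = L2_inner M f f + 2 * L2_inner M f g + L2_inner M g g"
    using L2_inner_add_left[OF f g fg] L2_inner_add_left[OF f g f] L2_inner_add_left[OF f g g]
    by (simp add: L2_norm_square L2_inner_commute)
  also have "\<dots> \<le> (L2_norm M f + L2_norm M g)\<^sup>2"
    using L2_Cauchy_Schwarz[OF f g] by (simp add: power2_sum L2_norm_square)
  finally show "(L2_norm M (\<lambda>x. f x + g x))\<^sup>2 \<le> (L2_norm M f + L2_norm M g)\<^sup>2" .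
  show "0 \<le> L2_norm M f + L2_norm M g"
    by (simp add: L2_norm_nonneg)
qed

lemma L2_norm_triangle_diff:
  assumes "sq_integrable M f" "sq_integrable M g"
  shows "L2_norm M (\<lambda>x. f x - g x) \<le> L2_norm M f + L2_norm M g"
  using L2_norm_triangle[OF assms(1), of "\<lambda>x. - g x"] sq_integrable_scaleR[OF assms(2), of "-1"]
  by (simp add: L2_norm_minus)

lemma L2_norm_cong_AE:
  assumes "AE x in M. f x = g x" "f \<in> borel_measurable M" "g \<in> borel_measurable M"
  shows "L2_norm M f = L2_norm M g"
proof -
  have "L2_inner M f f = L2_inner M g g"
    unfolding L2_inner_def using assms by (intro integral_cong_AE) auto
  then show ?thesis by (simp add: L2_norm_def)
qed

lemma L2_inner_cong_AE:
  assumes "AE x in M. f x = f' x" "AE x in M. g x = g' x"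
    "f \<in> borel_measurable M" "f' \<in> borel_measurable M" "g \<in> borel_measurable M" "g' \<in> borel_measurable M"
  shows "L2_inner M f g = L2_inner M f' g'"
  unfolding L2_inner_def using assms by (intro integral_cong_AE) auto

lemma L2_norm_eq_0_iff:
  assumes "sq_integrable M f"
  shows "L2_norm M f = 0 \<longleftrightarrow> (AE x in M. f x = 0)"
proof -
  have "L2_inner M f f = 0 \<longleftrightarrow> (AE x in M. f x \<bullet> f x = 0)"
    unfolding L2_inner_def
    by (rule integral_nonneg_eq_0_iff_AE) (use integrable_inner_sq[OF assms assms] in auto)
  then show ?thesis by (simp add: L2_norm_def L2_inner_self_nonneg)
qed

lemma sq_integrable_inner_const:
  assumes "sq_integrable M f" shows "sq_integrable M (\<lambda>x. f x \<bullet> b)"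
  unfolding sq_integrable_def
proof
  show m: "(\<lambda>x. f x \<bullet> b) \<in> borel_measurable M"
    using assms by (auto simp: sq_integrable_def)
  show "integrable M (\<lambda>x. (norm (f x \<bullet> b))\<^sup>2)"
  proof (rule Bochner_Integration.integrable_bound)
    show "integrable M (\<lambda>x. (norm b)\<^sup>2 * (norm (f x))\<^sup>2)"
      using assms by (simp add: sq_integrable_def)
    show "AE x in M. norm ((norm (f x \<bullet> b))\<^sup>2) \<le> norm ((norm b)\<^sup>2 * (norm (f x))\<^sup>2)"
    proof (rule AE_I2)
      fix x
      have "\<bar>f x \<bullet> b\<bar>\<^sup>2 \<le> (norm (f x) * norm b)\<^sup>2"
        by (rule power_mono) (auto simp: Cauchy_Schwarz_ineq2)
      then show "norm ((norm (f x \<bullet> b))\<^sup>2) \<le> norm ((norm b)\<^sup>2 * (norm (f x))\<^sup>2)"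
        by (simp add: power_mult_distrib mult.commute)
    qed
  qed (use m in auto)
qed

section \<open>Restriction to a smaller domain\<close>

lemma lebesgue_on_subset:
  "S \<subseteq> T \<Longrightarrow> T \<in> sets lebesgue \<Longrightarrow> S \<in> sets lebesgue \<Longrightarrow>
    lebesgue_on S = restrict_space (lebesgue_on T) S"
  by (simp add: restrict_restrict_space Int_absorb1)

lemma AE_lebesgue_on_subset:
  assumes "AE x in lebesgue_on T. P x" "S \<subseteq> T" "S \<in> sets lebesgue" "T \<in> sets lebesgue"
  shows "AE x in lebesgue_on S. P x"
  using assms by (auto simp: AE_restrict_space_iff)

lemma borel_measurable_lebesgue_on_subset:
  assumes "f \<in> borel_measurable (lebesgue_on T)" "S \<subseteq> T" "S \<in> sets lebesgue" "T \<in> sets lebesgue"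
  shows "f \<in> borel_measurable (lebesgue_on S)"
  using measurable_restrict_space1[OF assms(1), of S] assms(2-4)
  by (simp add: lebesgue_on_subset[symmetric])

lemma integral_lebesgue_on_indicator:
  fixes f :: "_ \<Rightarrow> 'b::euclidean_space"
  assumes "S \<in> sets lebesgue"
  shows "(\<integral>x. f x \<partial>lebesgue_on S) = (\<integral>x. indicator S x *\<^sub>R f x \<partial>lebesgue)"
  using assms by (subst integral_restrict_space) auto

lemma integrable_lebesgue_on_indicator:
  fixes f :: "_ \<Rightarrow> 'b::euclidean_space"
  assumes "S \<in> sets lebesgue"
  shows "integrable (lebesgue_on S) f \<longleftrightarrow> integrable lebesgue (\<lambda>x. indicator S x *\<^sub>R f x)"
  using assms by (subst integrable_restrict_space) auto

lemma integral_lebesgue_on_subset: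
  fixes f :: "_ \<Rightarrow> 'b::euclidean_space"
  assumes "S \<subseteq> T" "S \<in> sets lebesgue" "T \<in> sets lebesgue" "\<And>x. x \<in> T - S \<Longrightarrow> f x = 0"
  shows "(\<integral>x. f x \<partial>lebesgue_on S) = (\<integral>x. f x \<partial>lebesgue_on T)"
  unfolding integral_lebesgue_on_indicator[OF assms(2)] integral_lebesgue_on_indicator[OF assms(3)]
  by (rule arg_cong[where f="integral\<^sup>L lebesgue"]) (use assms(1,4) in \<open>auto simp: fun_eq_iff indicator_def\<close>)

lemma sq_integrable_lebesgue_on_subset:
  assumes f: "sq_integrable (lebesgue_on T) f" and "S \<subseteq> T" "S \<in> sets lebesgue" "T \<in> sets lebesgue"
  shows "sq_integrable (lebesgue_on S) f"
    and "L2_norm (lebesgue_on S) f \<le> L2_norm (lebesgue_on T) f"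
proof -
  have int: "integrable lebesgue (\<lambda>x. indicator T x *\<^sub>R (norm (f x))\<^sup>2)"
    using f unfolding sq_integrable_def integrable_lebesgue_on_indicator[OF assms(4)] by blast
  have m: "f \<in> borel_measurable (lebesgue_on S)"
    using borel_measurable_lebesgue_on_subset[OF sq_integrable_borel[OF f] assms(2-4)] .
  have "integrable lebesgue (\<lambda>x. indicator S x *\<^sub>R indicator T x *\<^sub>R (norm (f x))\<^sup>2)"
    using assms(3) int by (rule integrable_mult_indicator)
  also have "(\<lambda>x. indicator S x *\<^sub>R indicator T x *\<^sub>R (norm (f x))\<^sup>2) = (\<lambda>x. indicator S x *\<^sub>R (norm (f x))\<^sup>2)"
    using assms(2) by (auto simp: fun_eq_iff indicator_def)
  finally have intS: "integrable lebesgue (\<lambda>x. indicator S x *\<^sub>R (norm (f x))\<^sup>2)" .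
  then show "sq_integrable (lebesgue_on S) f"
    using m unfolding sq_integrable_def integrable_lebesgue_on_indicator[OF assms(3)] by blast
  have "(\<integral>x. indicator S x *\<^sub>R (norm (f x))\<^sup>2 \<partial>lebesgue) \<le> (\<integral>x. indicator T x *\<^sub>R (norm (f x))\<^sup>2 \<partial>lebesgue)"
    using assms(2) by (intro integral_mono intS int) (auto simp: indicator_def)
  then show "L2_norm (lebesgue_on S) f \<le> L2_norm (lebesgue_on T) f"
    unfolding L2_norm_def L2_inner_def dot_square_norm
      integral_lebesgue_on_indicator[OF assms(3)] integral_lebesgue_on_indicator[OF assms(4)]
    by (rule real_sqrt_le_mono)
qed

section \<open>Calculus of smooth functions\<close>

lemma partial_deriv_eq: "(f has_derivative f') (at x) \<Longrightarrow> partial_deriv i f x = f' (axis i 1)"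
  by (metis frechet_derivative_at partial_deriv_def)

lemma partial_deriv_add:
  assumes "f differentiable (at x)" "g differentiable (at x)"
  shows "partial_deriv i (\<lambda>x. f x + g x) x = partial_deriv i f x + partial_deriv i g x"
  using partial_deriv_eq[OF has_derivative_add[OF frechet_derivative_works[THEN iffD1, OF assms(1)]
        frechet_derivative_works[THEN iffD1, OF assms(2)]]]
  by (simp add: partial_deriv_def)

lemma partial_deriv_mult:
  assumes "f differentiable (at x)" "g differentiable (at x)"
  shows "partial_deriv i (\<lambda>x. f x * g x) x = partial_deriv i f x * g x + f x * partial_deriv i g x"
  using partial_deriv_eq[OF has_derivative_mult[OF frechet_derivative_works[THEN iffD1, OF assms(1)]
        frechet_derivative_works[THEN iffD1, OF assms(2)]]]
  by (simp add: partial_deriv_def)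

lemma C_k_continuous: "C_k k f \<Longrightarrow> continuous_on UNIV f"
proof (cases k)
  case (Suc j)
  assume "C_k k f"
  then have "f differentiable_on UNIV"
    using Suc by (simp add: differentiable_on_def)
  then show ?thesis by (rule differentiable_imp_continuous_on)
qed simp

lemma C_k_Suc_imp: "C_k (Suc k) f \<Longrightarrow> C_k k f"
proof (induction k arbitrary: f)
  case 0
  then show ?case using C_k_continuous[of "Suc 0" f] by simp
next
  case (Suc k)
  then show ?case by auto
qed

lemma C_k_const: "C_k k (\<lambda>x::real^'a::finite. c)"
proof (induction k arbitrary: c)
  case (Suc k)
  have "partial_deriv i (\<lambda>x::real^'a. c) = (\<lambda>x. 0)" for i
    by (rule ext) (simp add: partial_deriv_eq[OF has_derivative_const])
  then show ?case using Suc by simp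
qed simp

lemma C_k_add: "C_k k f \<Longrightarrow> C_k k g \<Longrightarrow> C_k k (\<lambda>x. f x + g x)"
proof (induction k arbitrary: f g)
  case (Suc k)
  then have "partial_deriv i (\<lambda>x. f x + g x) = (\<lambda>x. partial_deriv i f x + partial_deriv i g x)" for i
    by (intro ext partial_deriv_add) auto
  then show ?case using Suc by auto
qed (auto intro: continuous_intros)

lemma C_k_mult: "C_k k f \<Longrightarrow> C_k k g \<Longrightarrow> C_k k (\<lambda>x. f x * g x)"
proof (induction k arbitrary: f g)
  case (Suc k)
  then have "partial_deriv i (\<lambda>x. f x * g x)
      = (\<lambda>x. partial_deriv i f x * g x + f x * partial_deriv i g x)" for i
    by (intro ext partial_deriv_mult) auto
  moreover have "C_k k f" "C_k k g"
    using Suc.prems by (auto dest: C_k_Suc_imp simp del: C_k.simps)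
  ultimately show ?case using Suc by (auto intro!: C_k_add)
qed (auto intro: continuous_intros)

lemma smooth_const: "smooth (\<lambda>x. c)"
  by (simp add: smooth_def C_k_const)

lemma smooth_mult: "smooth f \<Longrightarrow> smooth g \<Longrightarrow> smooth (\<lambda>x. f x * g x)"
  by (simp add: smooth_def C_k_mult)

lemma smooth_prod: "finite I \<Longrightarrow> (\<And>i. i \<in> I \<Longrightarrow> smooth (f i)) \<Longrightarrow> smooth (\<lambda>x. \<Prod>i\<in>I. f i x)"
  by (induction I rule: finite_induct) (simp_all add: smooth_const smooth_mult)

lemma smooth_differentiable: "smooth f \<Longrightarrow> f differentiable (at x)"
  unfolding smooth_def by (metis C_k.simps(2))

lemma smooth_continuous: "smooth f \<Longrightarrow> continuous_on S f"
  unfolding smooth_def by (metis C_k_continuous continuous_on_subset top_greatest)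

lemma smooth_partial_deriv: "smooth f \<Longrightarrow> smooth (partial_deriv i f)"
  unfolding smooth_def by (metis C_k.simps(2))

lemma iter_deriv_Nil [simp]: "iter_deriv [] f = f"
  and iter_deriv_Cons [simp]: "iter_deriv (i # \<alpha>) f = partial_deriv i (iter_deriv \<alpha> f)"
  by (simp_all add: iter_deriv_def)

lemma smooth_iter_deriv: "smooth f \<Longrightarrow> smooth (iter_deriv \<alpha> f)"
  by (induction \<alpha>) (simp_all add: smooth_partial_deriv)

lemma partial_deriv_zero_on_open:
  assumes "open U" "x \<in> U" "\<And>y. y \<in> U \<Longrightarrow> f y = 0"
  shows "partial_deriv i f x = 0"
proof -
  have "(f has_derivative (\<lambda>_. 0)) (at x)"
    by (rule has_derivative_transform_within_open[OF has_derivative_const[of 0] assms(1,2)])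
      (simp add: assms(3))
  then show ?thesis by (simp add: partial_deriv_eq)
qed

lemma iter_deriv_off_support:
  assumes "x \<notin> closure {x. f x \<noteq> 0}"
  shows "iter_deriv \<alpha> f x = 0"
  using assms
proof (induction \<alpha> arbitrary: x)
  case Nil
  then show ?case using closure_subset[of "{x. f x \<noteq> 0}"] by auto
next
  case (Cons i \<alpha>)
  then show ?case
    by (auto intro!: partial_deriv_zero_on_open[of "- closure {x. f x \<noteq> 0}"])
qed

lemma partial_deriv_off_support:
  assumes "x \<notin> closure {x. f x \<noteq> 0}" shows "partial_deriv i f x = 0"
  using iter_deriv_off_support[OF assms, of "[i]"] by simp

section \<open>Bump functions\<close>

text \<open>
  The functions \<open>q(1/t) e\<^sup>-\<^sup>1\<^sup>/\<^sup>t\<close>, continued by zero to \<open>t \<le> 0\<close>. Keeping the polynomial factor \<open>q\<close>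
  arbitrary makes the class closed under differentiation.
\<close>

definition flat :: "real poly \<Rightarrow> real \<Rightarrow> real" where
  "flat q t = (if t > 0 then poly q (1 / t) * exp (- 1 / t) else 0)"

text \<open>The factor \<open>X\<^sup>2\<close> stems from the derivative of \<open>1/t\<close>, which is \<open>-1/t\<^sup>2\<close>.\<close>

definition flat_deriv :: "real poly \<Rightarrow> real poly" where
  "flat_deriv q = [:0, 0, 1:] * (q - pderiv q)"

lemma poly_over_exp_tendsto_0: "((\<lambda>x::real. poly q x / exp x) \<longlongrightarrow> 0) at_top"
proof -
  have "((\<lambda>x::real. \<Sum>i\<le>degree q. coeff q i * (x ^ i / exp x)) \<longlongrightarrow> (\<Sum>i\<le>degree q. coeff q i * 0)) at_top"
    by (intro tendsto_sum tendsto_mult_left tendsto_power_div_exp_0)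
  then show ?thesis
    by (simp add: poly_altdef sum_divide_distrib)
qed

lemma flat_has_derivative: "(flat q has_real_derivative flat (flat_deriv q) t) (at t)"
proof -
  consider "t < 0" | "t = 0" | "t > 0" by linarith
  then show ?thesis
  proof cases
    case 1
    have "((\<lambda>_. 0) has_real_derivative 0) (at t)" by simp
    then have "(flat q has_real_derivative 0) (at t)"
      by (rule has_field_derivative_transform_within_open[of _ _ _ "{..<0}"]) (use 1 in \<open>auto simp: flat_def\<close>)
    then show ?thesis using 1 by (simp add: flat_def)
  next
    case 3
    have inv: "((\<lambda>t. 1 / t) has_real_derivative - (1 / t ^ 2)) (at t)"
      using 3 by (auto intro!: derivative_eq_intros simp: power2_eq_square)
    have "((\<lambda>t. poly q (1 / t) * exp (- (1 / t))) has_real_derivative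
        (poly (pderiv q) (1 / t) * - (1 / t ^ 2)) * exp (- (1 / t))
        + (exp (- (1 / t)) * - (- (1 / t ^ 2))) * poly q (1 / t)) (at t)"
      by (rule DERIV_mult[OF DERIV_chain2[OF poly_DERIV inv] DERIV_chain2[OF DERIV_exp DERIV_minus[OF inv]]])
    moreover have "(poly (pderiv q) (1 / t) * - (1 / t ^ 2)) * exp (- (1 / t))
        + (exp (- (1 / t)) * - (- (1 / t ^ 2))) * poly q (1 / t)
        = poly (flat_deriv q) (1 / t) * exp (- 1 / t)"
      by (simp add: flat_deriv_def algebra_simps power2_eq_square)
    ultimately have "((\<lambda>t. poly q (1 / t) * exp (- 1 / t)) has_real_derivative
        poly (flat_deriv q) (1 / t) * exp (- 1 / t)) (at t)"
      by simp
    then have "(flat q has_real_derivative poly (flat_deriv q) (1 / t) * exp (- 1 / t)) (at t)"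
      by (rule has_field_derivative_transform_within_open[of _ _ _ "{0<..}"]) (use 3 in \<open>auto simp: flat_def\<close>)
    then show ?thesis using 3 by (simp add: flat_def)
  next
    case 2
    have right: "((\<lambda>h. flat q h / h) \<longlongrightarrow> 0) (at_right 0)"
      unfolding filterlim_at_right_to_top
    proof (rule Lim_transform_eventually[OF poly_over_exp_tendsto_0[of "pCons 0 q"]])
      show "\<forall>\<^sub>F x in at_top. poly (pCons 0 q) x / exp x = flat q (inverse x) / inverse x"
        using eventually_gt_at_top[of 0]
        by eventually_elim (simp add: flat_def field_simps exp_minus)
    qed
    have left: "((\<lambda>h. flat q h / h) \<longlongrightarrow> 0) (at_left 0)"
    proof (rule Lim_transform_eventually[OF tendsto_const])
      show "\<forall>\<^sub>F x in at_left 0. 0 = flat q x / x"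
        by (simp add: eventually_at_filter flat_def)
    qed
    have "((\<lambda>h. flat q h / h) \<longlongrightarrow> 0) (at 0)"
      using left right by (simp add: filterlim_at_split)
    then show ?thesis using 2 by (simp add: DERIV_def flat_def)
  qed
qed

lemma C_k_flat_coordinate: "C_k k (\<lambda>x::real^'n::finite. flat q (c * x $ i + d))"
proof (induction k arbitrary: q)
  case 0
  have "continuous_on UNIV (flat q)"
    using flat_has_derivative by (intro continuous_at_imp_continuous_on) (blast intro: DERIV_isCont)
  then show ?case
    by (auto intro!: continuous_on_compose2[of UNIV "flat q"] continuous_intros)
next
  case (Suc k)
  have D: "((\<lambda>x::real^'n. flat q (c * x $ i + d)) has_derivative
      (\<lambda>v. flat (flat_deriv q) (c * x $ i + d) * (c * v $ i))) (at x)" for x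
  proof -
    have "((\<lambda>x::real^'n. c * x $ i + d) has_derivative (\<lambda>v. c * v $ i)) (at x)"
      by (auto intro!: derivative_eq_intros bounded_linear.has_derivative[OF bounded_linear_vec_nth])
    from has_derivative_compose[OF this flat_has_derivative[unfolded has_field_derivative_def]]
    show ?thesis by simp
  qed
  have "partial_deriv j (\<lambda>x::real^'n. flat q (c * x $ i + d))
      = (\<lambda>x. (if j = i then c else 0) * flat (flat_deriv q) (c * x $ i + d))" for j
    by (rule ext) (simp add: partial_deriv_eq[OF D] axis_def)
  moreover have "C_k k (\<lambda>x::real^'n. (if j = i then c else 0) * flat (flat_deriv q) (c * x $ i + d))" for j
    by (intro C_k_mult C_k_const Suc)
  ultimately show ?case
    using D by (auto simp: differentiable_def)
qed

text \<open>
  A product of smooth functions of one coordinate each, supported in a box. As \<open>m\<close> grows, each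
  factor \<open>e\<^sup>-\<^sup>1\<^sup>/\<^sup>t\<close> with \<open>t = m (x\<^sub>i - a\<^sub>i)\<close> or \<open>t = m (b\<^sub>i - x\<^sub>i)\<close> increases to the indicator of a
  half-space, and the product to the indicator of the open box.
\<close>

definition bump :: "real^'n::finite \<Rightarrow> real^'n \<Rightarrow> nat \<Rightarrow> real^'n \<Rightarrow> real" where
  "bump a b m x = (\<Prod>i\<in>UNIV. flat 1 (real m * (x $ i - a $ i)) * flat 1 (real m * (b $ i - x $ i)))"

lemma flat_one_bounds: "0 \<le> flat 1 t" "flat 1 t \<le> 1"
  by (auto simp: flat_def)

lemma bump_bounds: "0 \<le> bump a b m x" "bump a b m x \<le> 1"
proof -
  have "0 \<le> flat 1 s * flat 1 t" "flat 1 s * flat 1 t \<le> 1" for s t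
    using flat_one_bounds[of s] flat_one_bounds[of t] by (simp_all add: mult_le_one)
  then show "0 \<le> bump a b m x" "bump a b m x \<le> 1"
    unfolding bump_def by (intro prod_nonneg prod_le_1; blast)+
qed

lemma bump_off_box: "x \<notin> box a b \<Longrightarrow> bump a b m x = 0"
proof -
  assume "x \<notin> box a b"
  then obtain i where "\<not> (a $ i < x $ i \<and> x $ i < b $ i)"
    by (auto simp: mem_box_cart)
  then have "flat 1 (real m * (x $ i - a $ i)) * flat 1 (real m * (b $ i - x $ i)) = 0"
    by (auto simp: flat_def zero_less_mult_iff)
  then show ?thesis
    unfolding bump_def by (intro prod_zero[OF finite]) (rule bexI[of _ i], auto)
qed

lemma smooth_bump: "smooth (bump a b m)"
proof -
  have "smooth (\<lambda>x. flat 1 (real m * (x $ i - a $ i)))" for i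
    using C_k_flat_coordinate[where c="real m" and d="- real m * a $ i" and i=i]
    by (simp add: smooth_def algebra_simps)
  moreover have "smooth (\<lambda>x. flat 1 (real m * (b $ i - x $ i)))" for i
    using C_k_flat_coordinate[where c="- real m" and d="real m * b $ i" and i=i]
    by (simp add: smooth_def algebra_simps)
  ultimately show ?thesis
    unfolding bump_def[abs_def] by (intro smooth_prod smooth_mult) auto
qed

lemma bump_test_function:
  assumes "cbox a b \<subseteq> \<Omega>" shows "bump a b m \<in> test_functions \<Omega>"
proof -
  have "{x. bump a b m x \<noteq> 0} \<subseteq> cbox a b"
    using bump_off_box box_subset_cbox by blast
  then have "closure {x. bump a b m x \<noteq> 0} \<subseteq> cbox a b"
    by (rule closure_minimal) (rule closed_cbox)
  moreover from this have "compact (closure {x. bump a b m x \<noteq> 0})"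
    by (meson bounded_cbox bounded_subset closed_closure compact_eq_bounded_closed)
  ultimately show ?thesis
    using assms smooth_bump by (auto simp: test_functions_def)
qed

lemma flat_one_tendsto:
  assumes "t > 0" shows "(\<lambda>m. flat 1 (real m * t)) \<longlonglongrightarrow> 1"
proof (rule Lim_transform_eventually)
  have "(\<lambda>m. exp (- (1 / t) * inverse (real m))) \<longlonglongrightarrow> exp (- (1 / t) * 0)"
    by (intro tendsto_intros lim_inverse_n)
  then show "(\<lambda>m. exp (- (1 / t) * inverse (real m))) \<longlonglongrightarrow> 1" by simp
  show "\<forall>\<^sub>F m in sequentially. exp (- (1 / t) * inverse (real m)) = flat 1 (real m * t)"
    using eventually_gt_at_top[of 0] by eventually_elim (use assms in \<open>simp add: flat_def field_simps\<close>)
qed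

lemma bump_tendsto: "(\<lambda>m. bump a b m x) \<longlonglongrightarrow> indicator (box a b) x"
proof (cases "x \<in> box a b")
  case True
  have "(\<lambda>m. bump a b m x) \<longlonglongrightarrow> (\<Prod>i\<in>(UNIV::'a set). 1 * 1)"
    unfolding bump_def using True
    by (intro tendsto_prod tendsto_mult flat_one_tendsto) (auto simp: mem_box_cart)
  then show ?thesis using True by simp
next
  case False
  then show ?thesis by (simp add: bump_off_box)
qed

section \<open>The fundamental lemma of the calculus of variations\<close>

lemma continuous_compact_support_integrable:
  fixes f :: "'a::euclidean_space \<Rightarrow> 'b::euclidean_space"
  assumes "continuous_on UNIV f" "compact K" "\<And>x. x \<notin> K \<Longrightarrow> f x = 0"
  shows "integrable lborel f"
proof -
  have "integrable lborel (\<lambda>x. indicator K x *\<^sub>R f x)"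
    using assms(2) continuous_on_subset[OF assms(1)] by (intro borel_integrable_compact) auto
  also have "(\<lambda>x. indicator K x *\<^sub>R f x) = f"
    using assms(3) by (auto simp: fun_eq_iff indicator_def)
  finally show ?thesis .
qed

lemma integrable_lborel_lebesgue:
  fixes f :: "'a::euclidean_space \<Rightarrow> 'b::euclidean_space"
  shows "integrable lborel f \<Longrightarrow> integrable lebesgue f"
  by (subst integrable_completion) (auto dest: borel_measurable_integrable)

lemma continuous_compact_support_sq_integrable:
  fixes f :: "'a::euclidean_space \<Rightarrow> 'b::euclidean_space"
  assumes "continuous_on UNIV f" "compact K" "\<And>x. x \<notin> K \<Longrightarrow> f x = 0" "S \<in> sets lebesgue"
  shows "sq_integrable (lebesgue_on S) f"
proof -
  have "integrable lborel (\<lambda>x. (norm (f x))\<^sup>2)"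
    using assms(1-3) by (intro continuous_compact_support_integrable[of _ K] continuous_intros) auto
  then have "integrable lebesgue (\<lambda>x. indicator S x *\<^sub>R (norm (f x))\<^sup>2)"
    by (intro integrable_mult_indicator assms(4) integrable_lborel_lebesgue)
  then have "integrable (lebesgue_on S) (\<lambda>x. (norm (f x))\<^sup>2)"
    unfolding integrable_lebesgue_on_indicator[OF assms(4)] .
  moreover have "f \<in> borel_measurable (lebesgue_on S)"
  proof -
    have "f \<in> borel_measurable borel"
      using assms(1) by (rule borel_measurable_continuous_onI)
    then have "f \<in> borel_measurable lebesgue"
      by (simp add: measurable_completion)
    then show ?thesis by (rule measurable_restrict_space1)
  qed
  ultimately show ?thesis by (simp add: sq_integrable_def)
qed

lemma test_function_sq_integrable:
  assumes "\<phi> \<in> test_functions \<Omega>" "S \<in> sets lebesgue"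
  shows "sq_integrable (lebesgue_on S) (iter_deriv \<alpha> \<phi>)"
  using assms iter_deriv_off_support[of _ \<phi> \<alpha>]
  by (intro continuous_compact_support_sq_integrable[of _ "closure {x. \<phi> x \<noteq> 0}"] smooth_continuous
      smooth_iter_deriv) (auto simp: test_functions_def)

lemma integrable_scaleR_sq:
  fixes g :: "_ \<Rightarrow> 'b::euclidean_space"
  assumes f: "sq_integrable M f" and g: "sq_integrable M g"
  shows "integrable M (\<lambda>x. f x *\<^sub>R g x)"
proof (rule Bochner_Integration.integrable_bound)
  show "integrable M (\<lambda>x. (norm (f x))\<^sup>2 + (norm (g x))\<^sup>2)"
    using f g by (auto simp: sq_integrable_def)
  show "(\<lambda>x. f x *\<^sub>R g x) \<in> borel_measurable M"
    using f g by (auto simp: sq_integrable_def)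
  show "AE x in M. norm (f x *\<^sub>R g x) \<le> norm ((norm (f x))\<^sup>2 + (norm (g x))\<^sup>2)"
  proof (rule AE_I2)
    fix x
    have "norm (f x) * norm (g x) \<le> (norm (f x))\<^sup>2 + (norm (g x))\<^sup>2"
      using sum_squares_bound[of "norm (f x)" "norm (g x)"]
        mult_nonneg_nonneg[OF norm_ge_zero[of "f x"] norm_ge_zero[of "g x"]] by linarith
    then show "norm (f x *\<^sub>R g x) \<le> norm ((norm (f x))\<^sup>2 + (norm (g x))\<^sup>2)" by simp
  qed
qed

text \<open>
  The densities given by the positive and the negative part agree on the boxes, hence on all Borel
  sets, and so the two parts agree almost everywhere.
\<close>

lemma AE_zero_if_box_integrals_zero:
  fixes f :: "'a::euclidean_space \<Rightarrow> real"
  assumes f: "integrable lborel f" and zero: "\<And>a b. (\<integral>x. indicator (box a b) x * f x \<partial>lborel) = 0"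
  shows "AE x in lborel. f x = 0"
proof -
  have [measurable]: "f \<in> borel_measurable borel"
    using borel_measurable_integrable[OF f] by simp
  have pos: "integrable lborel (\<lambda>x. max 0 (f x))" and neg: "integrable lborel (\<lambda>x. max 0 (- f x))"
    using f by auto
  have dens: "emeasure (density lborel (\<lambda>x. ennreal (max 0 (g x)))) (box a b)
      = ennreal (\<integral>x. indicator (box a b) x * max 0 (g x) \<partial>lborel)"
    if g: "integrable lborel g" for g :: "'a \<Rightarrow> real" and a b
  proof -
    have [measurable]: "g \<in> borel_measurable borel"
      using borel_measurable_integrable[OF g] by simp
    have i: "integrable lborel (\<lambda>x. indicator (box a b) x * max 0 (g x))"
      using integrable_mult_indicator[of "box a b" lborel "\<lambda>x. max 0 (g x)"] g by auto
    have "emeasure (density lborel (\<lambda>x. ennreal (max 0 (g x)))) (box a b)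
        = (\<integral>\<^sup>+x. ennreal (max 0 (g x)) * indicator (box a b) x \<partial>lborel)"
      by (rule emeasure_density) auto
    also have "\<dots> = (\<integral>\<^sup>+x. ennreal (indicator (box a b) x * max 0 (g x)) \<partial>lborel)"
      by (rule nn_integral_cong) (auto simp: indicator_def)
    also have "\<dots> = ennreal (\<integral>x. indicator (box a b) x * max 0 (g x) \<partial>lborel)"
      by (rule nn_integral_eq_integral[OF i]) auto
    finally show ?thesis .
  qed
  have eq: "(\<integral>x. indicator (box a b) x * max 0 (f x) \<partial>lborel)
      = (\<integral>x. indicator (box a b) x * max 0 (- f x) \<partial>lborel)" for a b
  proof -
    have "(\<integral>x. indicator (box a b) x * max 0 (f x) \<partial>lborel) - (\<integral>x. indicator (box a b) x * max 0 (- f x) \<partial>lborel)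
        = (\<integral>x. indicator (box a b) x * max 0 (f x) - indicator (box a b) x * max 0 (- f x) \<partial>lborel)"
      using integrable_mult_indicator[OF _ pos, of "box a b"] integrable_mult_indicator[OF _ neg, of "box a b"]
      by (intro Bochner_Integration.integral_diff[symmetric]) auto
    also have "\<dots> = (\<integral>x. indicator (box a b) x * f x \<partial>lborel)"
      by (rule Bochner_Integration.integral_cong) (auto simp: indicator_def)
    finally show ?thesis using zero by simp
  qed
  have "density lborel (\<lambda>x. ennreal (max 0 (f x))) = density lborel (\<lambda>x. ennreal (max 0 (- f x)))"
    (is "?M = ?N")
  proof (rule measure_eqI_generator_eq)
    let ?E = "range (\<lambda>(a, b). box a b::'a set)"
    show "Int_stable ?E"
      by (auto simp: Int_stable_def box_Int_box)
    show "?E \<subseteq> Pow UNIV" "sets ?M = sigma_sets UNIV ?E" "sets ?N = sigma_sets UNIV ?E"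
      by (simp_all add: borel_eq_box)
    let ?A = "\<lambda>n::nat. box (- (real n *\<^sub>R One)) (real n *\<^sub>R One) :: 'a set"
    show "range ?A \<subseteq> ?E" "(\<Union>i. ?A i) = UNIV"
      unfolding UN_box_eq_UNIV by auto
    show "emeasure ?M (?A i) \<noteq> \<infinity>" for i
      using dens[OF f] by simp
    fix X assume "X \<in> ?E"
    then obtain a b where "X = box a b" by auto
    then show "emeasure ?M X = emeasure ?N X"
      using dens[OF f, of a b] dens[of "\<lambda>x. - f x" a b] f eq[of a b] by simp
  qed
  moreover have "(\<integral>\<^sup>+x. ennreal (max 0 (f x)) \<partial>lborel) \<noteq> \<infinity>"
    by (subst nn_integral_eq_integral[OF pos]) auto
  ultimately have "AE x in lborel. ennreal (max 0 (f x)) = ennreal (max 0 (- f x))"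
    using finite_density_unique[of "\<lambda>x. ennreal (max 0 (f x))" lborel "\<lambda>x. ennreal (max 0 (- f x))"] by auto
  then show ?thesis
    by eventually_elim (auto simp: max_def split: if_splits)
qed

lemma AE_lebesgue_zero_if_box_integrals_zero:
  fixes f :: "'a::euclidean_space \<Rightarrow> real"
  assumes f: "integrable lebesgue f" and zero: "\<And>a b. (\<integral>x. indicator (box a b) x * f x \<partial>lebesgue) = 0"
  shows "AE x in lebesgue. f x = 0"
proof -
  obtain f' where f'[measurable]: "f' \<in> borel_measurable borel" and eq: "AE x in lborel. f x = f' x"
    using completion_ex_borel_measurable_real[of f lborel] borel_measurable_integrable[OF f] by auto
  have eq': "AE x in lebesgue. f x = f' x"
    using eq by (rule AE_completion)
  have m': "f' \<in> borel_measurable lebesgue"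
    by (simp add: measurable_completion)
  have "integrable lebesgue f'"
    using f m' eq' by (rule integrable_cong_AE_imp)
  then have "integrable lborel f'"
    by (subst (asm) integrable_completion) auto
  moreover have "(\<integral>x. indicator (box a b) x * f' x \<partial>lborel) = 0" for a b
  proof -
    have [measurable]: "(\<lambda>x. indicator (box a b) x * f' x) \<in> borel_measurable lborel" by measurable
    have "(\<integral>x. indicator (box a b) x * f' x \<partial>lborel) = (\<integral>x. indicator (box a b) x * f' x \<partial>lebesgue)"
      by (subst integral_completion) auto
    also have "\<dots> = (\<integral>x. indicator (box a b) x * f x \<partial>lebesgue)"
    proof (rule integral_cong_AE)
      show "(\<lambda>x. indicator (box a b) x * f' x) \<in> borel_measurable lebesgue"
        by (rule measurable_completion) measurable
      have "(\<lambda>x. indicator (box a b) x :: real) \<in> borel_measurable lebesgue" 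
        by (rule measurable_completion) measurable
      then show "(\<lambda>x. indicator (box a b) x * f x) \<in> borel_measurable lebesgue"
        using borel_measurable_integrable[OF f] by (rule borel_measurable_times)
      show "AE x in lebesgue. indicator (box a b) x * f' x = indicator (box a b) x * f x"
        using eq' by eventually_elim simp
    qed
    finally show ?thesis using zero by simp
  qed
  ultimately have "AE x in lborel. f' x = 0"
    by (rule AE_zero_if_box_integrals_zero)
  then have "AE x in lebesgue. f' x = 0"
    by (rule AE_completion)
  then show ?thesis using eq' by eventually_elim simp
qed

text \<open>
  Testing with bump functions that increase to the indicator of a box shows that the integral over
  each box whose closure lies in the domain vanishes.
\<close>

lemma fundamental_lemma_real:
  fixes g :: "real^'n::finite \<Rightarrow> real"
  assumes \<Omega>: "open \<Omega>" and g: "sq_integrable (lebesgue_on \<Omega>) g"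
    and zero: "\<And>\<phi>. \<phi> \<in> test_functions \<Omega> \<Longrightarrow> (\<integral>x. \<phi> x * g x \<partial>lebesgue_on \<Omega>) = 0"
  shows "AE x in lebesgue_on \<Omega>. g x = 0"
proof -
  have \<Omega>_meas: "\<Omega> \<in> sets lebesgue" using \<Omega> by auto
  have loc: "integrable lebesgue (\<lambda>x. indicator (box a b) x * g x)"
    and box0: "(\<integral>x. indicator (box a b) x * g x \<partial>lebesgue) = 0" if sub: "cbox a b \<subseteq> \<Omega>" for a b
  proof -
    have ind_meas: "(\<lambda>x. indicator (box a b) x :: real) \<in> borel_measurable (lebesgue_on \<Omega>)"
      by (intro measurable_restrict_space1 borel_measurable_indicator) auto
    have g_meas: "g \<in> borel_measurable (lebesgue_on \<Omega>)"
      using g by (rule sq_integrable_borel)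
    have "sq_integrable (lebesgue_on \<Omega>) (\<lambda>x. indicator (box a b) x :: real)"
    proof -
      have "integrable lebesgue (\<lambda>x. indicator (box a b) x :: real)"
        by (rule integrable_real_indicator) (auto simp: emeasure_lborel_box_eq)
      then have "integrable lebesgue (\<lambda>x. indicator \<Omega> x *\<^sub>R (indicator (box a b) x :: real))"
        by (intro integrable_mult_indicator \<Omega>_meas)
      then have "integrable (lebesgue_on \<Omega>) (\<lambda>x. indicator (box a b) x :: real)"
        unfolding integrable_lebesgue_on_indicator[OF \<Omega>_meas] .
      moreover have "(norm (indicator (box a b) x :: real))\<^sup>2 = indicator (box a b) x" for x
        by (simp add: indicator_def)
      ultimately show ?thesis
        using ind_meas by (simp add: sq_integrable_def)
    qed
    from integrable_scaleR_sq[OF this g]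
    have i\<Omega>: "integrable (lebesgue_on \<Omega>) (\<lambda>x. indicator (box a b) x * g x)" by simp
    have move: "indicator \<Omega> x *\<^sub>R (indicator (box a b) x * g x) = indicator (box a b) x * g x" for x
      using sub box_subset_cbox[of a b] by (auto simp: indicator_def)
    show "integrable lebesgue (\<lambda>x. indicator (box a b) x * g x)"
      using i\<Omega> unfolding integrable_lebesgue_on_indicator[OF \<Omega>_meas] move .
    have "(\<lambda>m. \<integral>x. bump a b m x * g x \<partial>lebesgue_on \<Omega>) \<longlonglongrightarrow> (\<integral>x. indicator (box a b) x * g x \<partial>lebesgue_on \<Omega>)"
    proof (rule integral_dominated_convergence)
      show "(\<lambda>x. indicator (box a b) x * g x) \<in> borel_measurable (lebesgue_on \<Omega>)"
        using i\<Omega> by (rule borel_measurable_integrable)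
      show "(\<lambda>x. bump a b m x * g x) \<in> borel_measurable (lebesgue_on \<Omega>)" for m
        using sq_integrable_borel[OF test_function_sq_integrable[OF bump_test_function[OF sub] \<Omega>_meas, of "[]"]]
          g_meas by simp
      show "integrable (lebesgue_on \<Omega>) (\<lambda>x. norm (indicator (box a b) x * g x))"
        using i\<Omega> by (rule integrable_norm)
      show "AE x in lebesgue_on \<Omega>. (\<lambda>m. bump a b m x * g x) \<longlonglongrightarrow> indicator (box a b) x * g x"
        by (intro AE_I2 tendsto_mult_right bump_tendsto)
      show "AE x in lebesgue_on \<Omega>. norm (bump a b m x * g x) \<le> norm (indicator (box a b) x * g x)" for m
      proof (rule AE_I2)
        fix x
        show "norm (bump a b m x * g x) \<le> norm (indicator (box a b) x * g x)"
          using bump_bounds[of a b m x]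
          by (cases "x \<in> box a b") (auto simp: bump_off_box abs_mult mult_left_le_one_le)
      qed
    qed
    moreover have "(\<integral>x. bump a b m x * g x \<partial>lebesgue_on \<Omega>) = 0" for m
      using bump_test_function[OF sub] zero by blast
    ultimately have "(\<integral>x. indicator (box a b) x * g x \<partial>lebesgue_on \<Omega>) = 0"
      by (simp add: LIMSEQ_const_iff)
    then show "(\<integral>x. indicator (box a b) x * g x \<partial>lebesgue) = 0"
      unfolding integral_lebesgue_on_indicator[OF \<Omega>_meas] move .
  qed
  have on_box: "AE x in lebesgue. x \<in> cbox c d \<longrightarrow> g x = 0" if sub: "cbox c d \<subseteq> \<Omega>" for c d
  proof -
    have "(\<integral>x. indicator (box a b) x * (indicator (box c d) x * g x) \<partial>lebesgue) = 0" for a b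
    proof -
      obtain a' b' where ab: "box a b \<inter> box c d = box a' b'"
        by (auto simp: box_Int_box)
      have *: "indicator (box a b) x * (indicator (box c d) x * g x) = indicator (box a' b') x * g x" for x
        unfolding ab[symmetric] by (auto simp: indicator_def)
      show ?thesis
      proof (cases "box a' b' = {}")
        case True
        then show ?thesis unfolding * by simp
      next
        case False
        have "cbox a' b' = closure (box a' b')"
          using False by (simp add: closure_box)
        also have "\<dots> \<subseteq> cbox c d"
          using ab box_subset_cbox[of c d] by (intro closure_minimal) auto
        finally show ?thesis unfolding * using sub box0[of a' b'] by blast
      qed
    qed
    from AE_lebesgue_zero_if_box_integrals_zero[OF loc[OF sub] this]
    have "AE x in lebesgue. indicator (box c d) x * g x = 0" .
    moreover have "AE x in lebesgue. x \<notin> cbox c d - box c d"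
      using null_sets_cbox_Diff_box[of c d] by (intro AE_completion AE_not_in)
    ultimately show ?thesis
      by eventually_elim (auto simp: indicator_def split: if_splits)
  qed
  obtain \<D> where D: "countable \<D>" "\<And>X. X \<in> \<D> \<Longrightarrow> X \<subseteq> \<Omega> \<and> (\<exists>a b. X = cbox a b)" "\<Union>\<D> = \<Omega>"
    using open_countable_Union_open_cbox[OF \<Omega>] by (metis PowD subsetD)
  have "AE x in lebesgue. \<forall>X\<in>\<D>. x \<in> X \<longrightarrow> g x = 0"
    using D(1)
  proof (rule AE_ball_countable[THEN iffD2], intro ballI)
    fix X assume "X \<in> \<D>"
    then obtain c d where "X = cbox c d" "cbox c d \<subseteq> \<Omega>" using D(2) by metis
    then show "AE x in lebesgue. x \<in> X \<longrightarrow> g x = 0" using on_box by simp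
  qed
  then have "AE x in lebesgue. x \<in> \<Omega> \<longrightarrow> g x = 0"
    by eventually_elim (use D(3) in blast)
  then show ?thesis
    using \<Omega>_meas by (simp add: AE_restrict_space_iff)
qed

lemma fundamental_lemma:
  fixes g :: "real^'n::finite \<Rightarrow> 'b::euclidean_space"
  assumes \<Omega>: "open \<Omega>" and g: "sq_integrable (lebesgue_on \<Omega>) g"
    and zero: "\<And>\<phi>. \<phi> \<in> test_functions \<Omega> \<Longrightarrow> (\<integral>x. \<phi> x *\<^sub>R g x \<partial>lebesgue_on \<Omega>) = 0"
  shows "AE x in lebesgue_on \<Omega>. g x = 0"
proof -
  have \<Omega>_meas: "\<Omega> \<in> sets lebesgue" using \<Omega> by auto
  have "AE x in lebesgue_on \<Omega>. g x \<bullet> b = 0" for b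
  proof (rule fundamental_lemma_real[OF \<Omega> sq_integrable_inner_const[OF g]])
    fix \<phi> assume \<phi>: "\<phi> \<in> test_functions \<Omega>"
    have "integrable (lebesgue_on \<Omega>) (\<lambda>x. \<phi> x *\<^sub>R g x)"
      using test_function_sq_integrable[OF \<phi> \<Omega>_meas, of "[]"] g by (simp add: integrable_scaleR_sq)
    then have "(\<integral>x. (\<phi> x *\<^sub>R g x) \<bullet> b \<partial>lebesgue_on \<Omega>) = (\<integral>x. \<phi> x *\<^sub>R g x \<partial>lebesgue_on \<Omega>) \<bullet> b"
      by (intro integral_inner_left) 
    then show "(\<integral>x. \<phi> x * (g x \<bullet> b) \<partial>lebesgue_on \<Omega>) = 0"
      using zero[OF \<phi>] by simp
  qed
  then have "AE x in lebesgue_on \<Omega>. \<forall>b\<in>Basis. g x \<bullet> b = 0"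
    by (intro AE_finite_allI) auto
  then show ?thesis
    by eventually_elim (simp add: euclidean_all_zero_iff)
qed

section \<open>Weak derivatives\<close>

lemma has_weak_derivD:
  assumes "has_weak_deriv \<Omega> \<alpha> u v"
  shows "sq_integrable (lebesgue_on \<Omega>) u" "sq_integrable (lebesgue_on \<Omega>) v"
    "\<phi> \<in> test_functions \<Omega> \<Longrightarrow> (\<integral>x. iter_deriv \<alpha> \<phi> x *\<^sub>R u x \<partial>lebesgue_on \<Omega>)
        = (-1) ^ length \<alpha> *\<^sub>R (\<integral>x. \<phi> x *\<^sub>R v x \<partial>lebesgue_on \<Omega>)"
  using assms by (simp_all add: has_weak_deriv_def)

lemma integrable_test_scaleR:
  fixes u :: "real^'n::finite \<Rightarrow> 'b::euclidean_space"
  assumes "open \<Omega>" "\<phi> \<in> test_functions \<Omega>'" "sq_integrable (lebesgue_on \<Omega>) u"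
  shows "integrable (lebesgue_on \<Omega>) (\<lambda>x. iter_deriv \<alpha> \<phi> x *\<^sub>R u x)"
    "integrable (lebesgue_on \<Omega>) (\<lambda>x. \<phi> x *\<^sub>R u x)"
  using integrable_scaleR_sq[OF test_function_sq_integrable[OF assms(2), of \<Omega> \<alpha>] assms(3)]
    integrable_scaleR_sq[OF test_function_sq_integrable[OF assms(2), of \<Omega> "[]"] assms(3)] assms(1)
  by auto

text \<open>
  Uniqueness up to null sets is what makes the value chosen by \<^const>\<open>weak_deriv\<close> meaningful; in
  particular derivatives on nested domains agree on the smaller one.
\<close>

lemma has_weak_deriv_unique:
  fixes u :: "real^'n::finite \<Rightarrow> 'b::euclidean_space"
  assumes \<Omega>: "open \<Omega>" and v: "has_weak_deriv \<Omega> \<alpha> u v" and w: "has_weak_deriv \<Omega> \<alpha> u w"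
  shows "AE x in lebesgue_on \<Omega>. v x = w x"
proof -
  have "AE x in lebesgue_on \<Omega>. v x - w x = 0"
  proof (rule fundamental_lemma[OF \<Omega>])
    show "sq_integrable (lebesgue_on \<Omega>) (\<lambda>x. v x - w x)"
      using v w by (intro sq_integrable_diff has_weak_derivD(2))
    fix \<phi> assume \<phi>: "\<phi> \<in> test_functions \<Omega>"
    have "(\<integral>x. \<phi> x *\<^sub>R v x \<partial>lebesgue_on \<Omega>) = (\<integral>x. \<phi> x *\<^sub>R w x \<partial>lebesgue_on \<Omega>)"
      using has_weak_derivD(3)[OF v \<phi>] has_weak_derivD(3)[OF w \<phi>] by simp
    then show "(\<integral>x. \<phi> x *\<^sub>R (v x - w x) \<partial>lebesgue_on \<Omega>) = 0"
      using integrable_test_scaleR(2)[OF \<Omega> \<phi> has_weak_derivD(2)[OF v]]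
        integrable_test_scaleR(2)[OF \<Omega> \<phi> has_weak_derivD(2)[OF w]]
      by (simp add: scaleR_diff_right)
  qed
  then show ?thesis by eventually_elim simp
qed

lemma weak_deriv_has_weak_deriv:
  "has_weak_deriv \<Omega> \<alpha> u v \<Longrightarrow> has_weak_deriv \<Omega> \<alpha> u (weak_deriv \<Omega> \<alpha> u)"
  unfolding weak_deriv_def by (rule someI[of "has_weak_deriv \<Omega> \<alpha> u"])

lemma weak_deriv_AE_eq:
  fixes u :: "real^'n::finite \<Rightarrow> 'b::euclidean_space"
  assumes "open \<Omega>" "has_weak_deriv \<Omega> \<alpha> u v"
  shows "AE x in lebesgue_on \<Omega>. weak_deriv \<Omega> \<alpha> u x = v x"
  using has_weak_deriv_unique[OF assms(1) weak_deriv_has_weak_deriv[OF assms(2)] assms(2)] .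

lemma L2_norm_weak_deriv:
  fixes u :: "real^'n::finite \<Rightarrow> 'b::euclidean_space"
  assumes "open \<Omega>" "has_weak_deriv \<Omega> \<alpha> u v"
  shows "L2_norm (lebesgue_on \<Omega>) (weak_deriv \<Omega> \<alpha> u) = L2_norm (lebesgue_on \<Omega>) v"
  using weak_deriv_AE_eq[OF assms] has_weak_derivD(2)[OF weak_deriv_has_weak_deriv[OF assms(2)]]
    has_weak_derivD(2)[OF assms(2)]
  by (intro L2_norm_cong_AE) (auto simp: sq_integrable_def)

lemma has_weak_deriv_Nil:
  fixes u :: "real^'n::finite \<Rightarrow> 'b::euclidean_space"
  assumes "sq_integrable (lebesgue_on \<Omega>) u" shows "has_weak_deriv \<Omega> [] u u"
  using assms by (simp add: has_weak_deriv_def)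

lemma has_weak_deriv_cong_AE:
  fixes u :: "real^'n::finite \<Rightarrow> 'b::euclidean_space"
  assumes \<Omega>: "open \<Omega>" and D: "has_weak_deriv \<Omega> \<alpha> u v"
    and eq: "AE x in lebesgue_on \<Omega>. u x = u' x" and u': "sq_integrable (lebesgue_on \<Omega>) u'"
  shows "has_weak_deriv \<Omega> \<alpha> u' v"
proof -
  have "(\<integral>x. iter_deriv \<alpha> \<phi> x *\<^sub>R u' x \<partial>lebesgue_on \<Omega>) = (\<integral>x. iter_deriv \<alpha> \<phi> x *\<^sub>R u x \<partial>lebesgue_on \<Omega>)"
    if \<phi>: "\<phi> \<in> test_functions \<Omega>" for \<phi>
  proof (rule integral_cong_AE)
    show "AE x in lebesgue_on \<Omega>. iter_deriv \<alpha> \<phi> x *\<^sub>R u' x = iter_deriv \<alpha> \<phi> x *\<^sub>R u x"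
      using eq by eventually_elim simp
  qed (use integrable_test_scaleR(1)[OF \<Omega> \<phi>] u' has_weak_derivD(1)[OF D] in
      \<open>auto intro!: borel_measurable_integrable\<close>)
  then show ?thesis
    using D u' by (simp add: has_weak_deriv_def)
qed

lemma has_weak_deriv_diff:
  fixes u :: "real^'n::finite \<Rightarrow> 'b::euclidean_space"
  assumes \<Omega>: "open \<Omega>" and v: "has_weak_deriv \<Omega> \<alpha> u v" and v': "has_weak_deriv \<Omega> \<alpha> u' v'"
  shows "has_weak_deriv \<Omega> \<alpha> (\<lambda>x. u x - u' x) (\<lambda>x. v x - v' x)"
  unfolding has_weak_deriv_def
proof (intro conjI ballI sq_integrable_diff has_weak_derivD[OF v] has_weak_derivD[OF v'])
  fix \<phi> assume \<phi>: "\<phi> \<in> test_functions \<Omega>"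
  show "(\<integral>x. iter_deriv \<alpha> \<phi> x *\<^sub>R (u x - u' x) \<partial>lebesgue_on \<Omega>)
      = (-1) ^ length \<alpha> *\<^sub>R (\<integral>x. \<phi> x *\<^sub>R (v x - v' x) \<partial>lebesgue_on \<Omega>)"
    using integrable_test_scaleR[OF \<Omega> \<phi> has_weak_derivD(1)[OF v]] integrable_test_scaleR[OF \<Omega> \<phi> has_weak_derivD(2)[OF v]]
      integrable_test_scaleR[OF \<Omega> \<phi> has_weak_derivD(1)[OF v']] integrable_test_scaleR[OF \<Omega> \<phi> has_weak_derivD(2)[OF v']]
      has_weak_derivD(3)[OF v \<phi>] has_weak_derivD(3)[OF v' \<phi>]
    by (simp add: scaleR_diff_right)
qed

lemma test_functions_mono: "\<Omega> \<subseteq> \<Omega>' \<Longrightarrow> test_functions \<Omega> \<subseteq> test_functions \<Omega>'"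
  by (auto simp: test_functions_def)

lemma test_function_iter_deriv_off:
  assumes "\<phi> \<in> test_functions \<Omega>" "x \<notin> \<Omega>" shows "iter_deriv \<alpha> \<phi> x = 0"
  using assms by (intro iter_deriv_off_support) (auto simp: test_functions_def)

lemma test_function_off: "\<phi> \<in> test_functions \<Omega> \<Longrightarrow> x \<notin> \<Omega> \<Longrightarrow> \<phi> x = 0"
  using test_function_iter_deriv_off[of \<phi> \<Omega> x "[]"] by simp

lemma test_function_gradient_off: "\<phi> \<in> test_functions \<Omega> \<Longrightarrow> x \<notin> \<Omega> \<Longrightarrow> gradient \<phi> x = 0"
  using test_function_iter_deriv_off[of \<phi> \<Omega> x "[_]"] by (simp add: gradient_def vec_eq_iff)

lemma has_weak_deriv_subset:
  fixes u :: "real^'n::finite \<Rightarrow> 'b::euclidean_space"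
  assumes D: "has_weak_deriv \<Omega> \<alpha> u v" and sub: "\<Omega>' \<subseteq> \<Omega>" and open': "open \<Omega>'" "open \<Omega>"
  shows "has_weak_deriv \<Omega>' \<alpha> u v"
proof -
  have meas: "\<Omega>' \<in> sets lebesgue" "\<Omega> \<in> sets lebesgue" using open' by auto
  have "(\<integral>x. iter_deriv \<alpha> \<phi> x *\<^sub>R u x \<partial>lebesgue_on \<Omega>') = (-1) ^ length \<alpha> *\<^sub>R (\<integral>x. \<phi> x *\<^sub>R v x \<partial>lebesgue_on \<Omega>')"
    if \<phi>: "\<phi> \<in> test_functions \<Omega>'" for \<phi>
  proof -
    have "(\<integral>x. iter_deriv \<alpha> \<phi> x *\<^sub>R u x \<partial>lebesgue_on \<Omega>') = (\<integral>x. iter_deriv \<alpha> \<phi> x *\<^sub>R u x \<partial>lebesgue_on \<Omega>)"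
      using test_function_iter_deriv_off[OF \<phi>] by (intro integral_lebesgue_on_subset sub meas) auto
    moreover have "(\<integral>x. \<phi> x *\<^sub>R v x \<partial>lebesgue_on \<Omega>') = (\<integral>x. \<phi> x *\<^sub>R v x \<partial>lebesgue_on \<Omega>)"
      using test_function_off[OF \<phi>] by (intro integral_lebesgue_on_subset sub meas) auto
    moreover have "\<phi> \<in> test_functions \<Omega>"
      using \<phi> test_functions_mono[OF sub] by blast
    ultimately show ?thesis using has_weak_derivD(3)[OF D] by simp
  qed
  then show ?thesis
    using sq_integrable_lebesgue_on_subset(1)[OF has_weak_derivD(1)[OF D] sub meas]
      sq_integrable_lebesgue_on_subset(1)[OF has_weak_derivD(2)[OF D] sub meas]
    by (simp add: has_weak_deriv_def)
qed

section \<open>Sobolev spaces of natural order\<close>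

lemma sobolev_nat_iff:
  fixes u :: "real^'n::finite \<Rightarrow> 'b::euclidean_space"
  shows "u \<in> sobolev \<Omega> (real k) \<longleftrightarrow> sq_integrable (lebesgue_on \<Omega>) u \<and>
    (\<forall>\<alpha>. length \<alpha> \<le> k \<longrightarrow> (\<exists>v. has_weak_deriv \<Omega> \<alpha> u v))"
  by (simp add: sobolev_def)

lemma sobolev_norm_nat:
  fixes u :: "real^'n::finite \<Rightarrow> 'b::euclidean_space"
  shows "sobolev_norm \<Omega> (real k) u =
    sqrt (\<Sum>\<alpha> | length \<alpha> \<le> k. (L2_norm (lebesgue_on \<Omega>) (weak_deriv \<Omega> \<alpha> u))\<^sup>2)"
  by (simp add: sobolev_norm_def)

lemma finite_multi_indices: "finite {\<alpha> :: 'n::finite list. length \<alpha> \<le> k}"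
  using finite_lists_length_le[of "UNIV :: 'n set" k] by simp

lemma sobolev_norm_nat_nonneg:
  fixes u :: "real^'n::finite \<Rightarrow> 'b::euclidean_space"
  shows "0 \<le> sobolev_norm \<Omega> (real k) u"
  by (simp add: sobolev_norm_nat sum_nonneg)

lemma sobolev_order_mono:
  fixes u :: "real^'n::finite \<Rightarrow> 'b::euclidean_space"
  shows "u \<in> sobolev \<Omega> (real k) \<Longrightarrow> j \<le> k \<Longrightarrow> u \<in> sobolev \<Omega> (real j)"
  by (auto simp: sobolev_nat_iff)

lemma sobolev_cong_AE:
  fixes u :: "real^'n::finite \<Rightarrow> 'b::euclidean_space"
  assumes "open \<Omega>" "u \<in> sobolev \<Omega> (real k)" "AE x in lebesgue_on \<Omega>. u x = u' x"
    "sq_integrable (lebesgue_on \<Omega>) u'"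
  shows "u' \<in> sobolev \<Omega> (real k)"
  using assms has_weak_deriv_cong_AE[OF assms(1) _ assms(3,4)] by (auto simp: sobolev_nat_iff) blast

lemma sobolev_subset:
  fixes u :: "real^'n::finite \<Rightarrow> 'b::euclidean_space"
  assumes u: "u \<in> sobolev \<Omega> (real k)" and sub: "\<Omega>' \<subseteq> \<Omega>" and open': "open \<Omega>'" "open \<Omega>"
  shows "u \<in> sobolev \<Omega>' (real k)" and "sobolev_norm \<Omega>' (real k) u \<le> sobolev_norm \<Omega> (real k) u"
proof -
  have meas: "\<Omega>' \<in> sets lebesgue" "\<Omega> \<in> sets lebesgue" using open' by auto
  show "u \<in> sobolev \<Omega>' (real k)"
    using u has_weak_deriv_subset[OF _ sub open'] sq_integrable_lebesgue_on_subset(1)[OF _ sub meas]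
    by (fastforce simp: sobolev_nat_iff)
  show "sobolev_norm \<Omega>' (real k) u \<le> sobolev_norm \<Omega> (real k) u"
    unfolding sobolev_norm_nat
  proof (intro real_sqrt_le_mono sum_mono power_mono L2_norm_nonneg)
    fix \<alpha> :: "'n list" assume "\<alpha> \<in> {\<alpha>. length \<alpha> \<le> k}"
    then obtain v where v: "has_weak_deriv \<Omega> \<alpha> u v"
      using u by (auto simp: sobolev_nat_iff)
    have "L2_norm (lebesgue_on \<Omega>') (weak_deriv \<Omega>' \<alpha> u) = L2_norm (lebesgue_on \<Omega>') v"
      by (rule L2_norm_weak_deriv[OF open'(1) has_weak_deriv_subset[OF v sub open']])
    also have "\<dots> \<le> L2_norm (lebesgue_on \<Omega>) v"
      by (rule sq_integrable_lebesgue_on_subset(2)[OF has_weak_derivD(2)[OF v] sub meas])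
    also have "\<dots> = L2_norm (lebesgue_on \<Omega>) (weak_deriv \<Omega> \<alpha> u)"
      by (rule L2_norm_weak_deriv[OF open'(2) v, symmetric])
    finally show "L2_norm (lebesgue_on \<Omega>') (weak_deriv \<Omega>' \<alpha> u) \<le> L2_norm (lebesgue_on \<Omega>) (weak_deriv \<Omega> \<alpha> u)" .
  qed
qed

lemma sobolev_zero:
  fixes u :: "real^'n::finite \<Rightarrow> 'b::euclidean_space"
  assumes "open \<Omega>" "sq_integrable (lebesgue_on \<Omega>) u"
  shows "u \<in> sobolev \<Omega> (real 0)" "sobolev_norm \<Omega> (real 0) u = L2_norm (lebesgue_on \<Omega>) u"
proof -
  show "u \<in> sobolev \<Omega> (real 0)"
    unfolding sobolev_nat_iff using assms has_weak_deriv_Nil by auto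
  have "{\<alpha> :: 'n list. length \<alpha> \<le> 0} = {[]}" by auto
  then show "sobolev_norm \<Omega> (real 0) u = L2_norm (lebesgue_on \<Omega>) u"
    unfolding sobolev_norm_nat using L2_norm_weak_deriv[OF assms(1) has_weak_deriv_Nil[OF assms(2)]]
    by (simp add: L2_norm_nonneg)
qed

lemma L2_norm_weak_deriv_le_sobolev_norm:
  fixes u :: "real^'n::finite \<Rightarrow> 'b::euclidean_space"
  assumes "length \<alpha> \<le> k"
  shows "L2_norm (lebesgue_on \<Omega>) (weak_deriv \<Omega> \<alpha> u) \<le> sobolev_norm \<Omega> (real k) u"
proof -
  have "(L2_norm (lebesgue_on \<Omega>) (weak_deriv \<Omega> \<alpha> u))\<^sup>2
      \<le> (\<Sum>\<beta> | length \<beta> \<le> k. (L2_norm (lebesgue_on \<Omega>) (weak_deriv \<Omega> \<beta> u))\<^sup>2)"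
    using assms by (intro member_le_sum finite_multi_indices) auto
  then show ?thesis
    unfolding sobolev_norm_nat by (rule real_le_rsqrt)
qed

section \<open>The weak divergence\<close>

lemma has_weak_divD:
  assumes "has_weak_div \<Omega> u g"
  shows "sq_integrable (lebesgue_on \<Omega>) u" "sq_integrable (lebesgue_on \<Omega>) g"
    "\<phi> \<in> test_functions \<Omega> \<Longrightarrow>
      (\<integral>x. u x \<bullet> gradient \<phi> x \<partial>lebesgue_on \<Omega>) = - (\<integral>x. g x * \<phi> x \<partial>lebesgue_on \<Omega>)"
  using assms by (simp_all add: has_weak_div_def)

lemma smooth_gradient_continuous: "smooth \<phi> \<Longrightarrow> continuous_on S (gradient \<phi>)"
  unfolding gradient_def by (intro continuous_on_vec_lambda smooth_continuous smooth_partial_deriv)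

lemma test_gradient_sq_integrable:
  assumes "\<phi> \<in> test_functions \<Omega>'" "S \<in> sets lebesgue"
  shows "sq_integrable (lebesgue_on S) (gradient \<phi>)"
  using assms partial_deriv_off_support[of _ \<phi>]
  by (intro continuous_compact_support_sq_integrable[of _ "closure {x. \<phi> x \<noteq> 0}"]
      smooth_gradient_continuous) (auto simp: test_functions_def gradient_def vec_eq_iff)

lemma integrable_test_div:
  assumes "open \<Omega>" "\<phi> \<in> test_functions \<Omega>'"
  shows "sq_integrable (lebesgue_on \<Omega>) u \<Longrightarrow> integrable (lebesgue_on \<Omega>) (\<lambda>x. u x \<bullet> gradient \<phi> x)"
    "sq_integrable (lebesgue_on \<Omega>) g \<Longrightarrow> integrable (lebesgue_on \<Omega>) (\<lambda>x. g x * \<phi> x)"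
  using integrable_inner_sq[OF _ test_gradient_sq_integrable[OF assms(2)], of \<Omega> u] 
    integrable_inner_sq[OF _ test_function_sq_integrable[OF assms(2), of \<Omega> "[]"], of g] assms(1)
  by auto

lemma has_weak_div_unique:
  assumes \<Omega>: "open \<Omega>" and g: "has_weak_div \<Omega> u g" and h: "has_weak_div \<Omega> u h"
  shows "AE x in lebesgue_on \<Omega>. g x = h x"
proof -
  have "AE x in lebesgue_on \<Omega>. g x - h x = 0"
  proof (rule fundamental_lemma[OF \<Omega>])
    show "sq_integrable (lebesgue_on \<Omega>) (\<lambda>x. g x - h x)"
      using g h by (intro sq_integrable_diff has_weak_divD(2))
    fix \<phi> assume \<phi>: "\<phi> \<in> test_functions \<Omega>"
    have "(\<integral>x. g x * \<phi> x \<partial>lebesgue_on \<Omega>) = (\<integral>x. h x * \<phi> x \<partial>lebesgue_on \<Omega>)"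
      using has_weak_divD(3)[OF g \<phi>] has_weak_divD(3)[OF h \<phi>] by simp
    then show "(\<integral>x. \<phi> x *\<^sub>R (g x - h x) \<partial>lebesgue_on \<Omega>) = 0"
      using integrable_test_div(2)[OF \<Omega> \<phi> has_weak_divD(2)[OF g]]
        integrable_test_div(2)[OF \<Omega> \<phi> has_weak_divD(2)[OF h]]
      by (simp add: right_diff_distrib mult.commute)
  qed
  then show ?thesis by eventually_elim simp
qed

lemma weak_div_has_weak_div: "u \<in> H_div \<Omega> \<Longrightarrow> has_weak_div \<Omega> u (weak_div \<Omega> u)"
  unfolding weak_div_def H_div_def by (auto intro: someI[of "has_weak_div \<Omega> u"])

lemma has_weak_div_H_div: "has_weak_div \<Omega> u g \<Longrightarrow> u \<in> H_div \<Omega>"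
  by (auto simp: H_div_def)

lemma H_div_sq_integrable:
  assumes "u \<in> H_div \<Omega>"
  shows "sq_integrable (lebesgue_on \<Omega>) u" "sq_integrable (lebesgue_on \<Omega>) (weak_div \<Omega> u)"
  using has_weak_divD[OF weak_div_has_weak_div[OF assms]] by blast+

lemma weak_div_AE_eq:
  assumes "open \<Omega>" "has_weak_div \<Omega> u g"
  shows "AE x in lebesgue_on \<Omega>. weak_div \<Omega> u x = g x"
  using has_weak_div_unique[OF assms(1) weak_div_has_weak_div[OF has_weak_div_H_div[OF assms(2)]] assms(2)] .

lemma has_weak_div_cong_AE:
  assumes \<Omega>: "open \<Omega>" and D: "has_weak_div \<Omega> u g"
    and eq: "AE x in lebesgue_on \<Omega>. u x = u' x" and u': "sq_integrable (lebesgue_on \<Omega>) u'"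
  shows "has_weak_div \<Omega> u' g"
proof -
  have "(\<integral>x. u' x \<bullet> gradient \<phi> x \<partial>lebesgue_on \<Omega>) = (\<integral>x. u x \<bullet> gradient \<phi> x \<partial>lebesgue_on \<Omega>)"
    if \<phi>: "\<phi> \<in> test_functions \<Omega>" for \<phi>
  proof (rule integral_cong_AE)
    show "AE x in lebesgue_on \<Omega>. u' x \<bullet> gradient \<phi> x = u x \<bullet> gradient \<phi> x"
      using eq by eventually_elim simp
  qed (use integrable_test_div(1)[OF \<Omega> \<phi>] u' has_weak_divD(1)[OF D] in
      \<open>auto intro!: borel_measurable_integrable\<close>)
  then show ?thesis
    using D u' by (simp add: has_weak_div_def)
qed

lemma has_weak_div_subset:
  assumes D: "has_weak_div \<Omega> u g" and sub: "\<Omega>' \<subseteq> \<Omega>" and open': "open \<Omega>'" "open \<Omega>"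
  shows "has_weak_div \<Omega>' u g"
proof -
  have meas: "\<Omega>' \<in> sets lebesgue" "\<Omega> \<in> sets lebesgue" using open' by auto
  have "(\<integral>x. u x \<bullet> gradient \<phi> x \<partial>lebesgue_on \<Omega>') = - (\<integral>x. g x * \<phi> x \<partial>lebesgue_on \<Omega>')"
    if \<phi>: "\<phi> \<in> test_functions \<Omega>'" for \<phi>
  proof -
    have "(\<integral>x. u x \<bullet> gradient \<phi> x \<partial>lebesgue_on \<Omega>') = (\<integral>x. u x \<bullet> gradient \<phi> x \<partial>lebesgue_on \<Omega>)"
      using test_function_gradient_off[OF \<phi>] by (intro integral_lebesgue_on_subset sub meas) auto
    moreover have "(\<integral>x. g x * \<phi> x \<partial>lebesgue_on \<Omega>') = (\<integral>x. g x * \<phi> x \<partial>lebesgue_on \<Omega>)"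
      using test_function_off[OF \<phi>] by (intro integral_lebesgue_on_subset sub meas) auto
    moreover have "\<phi> \<in> test_functions \<Omega>"
      using \<phi> test_functions_mono[OF sub] by blast
    ultimately show ?thesis using has_weak_divD(3)[OF D] by simp
  qed
  then show ?thesis
    using sq_integrable_lebesgue_on_subset(1)[OF has_weak_divD(1)[OF D] sub meas]
      sq_integrable_lebesgue_on_subset(1)[OF has_weak_divD(2)[OF D] sub meas]
    by (simp add: has_weak_div_def)
qed

lemma weak_div_subset_AE_eq:
  assumes "u \<in> H_div \<Omega>" "\<Omega>' \<subseteq> \<Omega>" "open \<Omega>'" "open \<Omega>"
  shows "u \<in> H_div \<Omega>'" "AE x in lebesgue_on \<Omega>'. weak_div \<Omega>' u x = weak_div \<Omega> u x"
proof -
  have "has_weak_div \<Omega>' u (weak_div \<Omega> u)"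
    using has_weak_div_subset[OF weak_div_has_weak_div[OF assms(1)] assms(2-4)] .
  then show "u \<in> H_div \<Omega>'" "AE x in lebesgue_on \<Omega>'. weak_div \<Omega>' u x = weak_div \<Omega> u x"
    using has_weak_div_H_div weak_div_AE_eq[OF assms(3)] by blast+
qed

lemma has_weak_div_add:
  assumes \<Omega>: "open \<Omega>" and g: "has_weak_div \<Omega> u g" and h: "has_weak_div \<Omega> w h"
  shows "has_weak_div \<Omega> (\<lambda>x. u x + w x) (\<lambda>x. g x + h x)"
  unfolding has_weak_div_def
proof (intro conjI ballI sq_integrable_add has_weak_divD[OF g] has_weak_divD[OF h])
  fix \<phi> assume \<phi>: "\<phi> \<in> test_functions \<Omega>"
  show "(\<integral>x. (u x + w x) \<bullet> gradient \<phi> x \<partial>lebesgue_on \<Omega>) = - (\<integral>x. (g x + h x) * \<phi> x \<partial>lebesgue_on \<Omega>)"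
    using integrable_test_div(1)[OF \<Omega> \<phi> has_weak_divD(1)[OF g]] integrable_test_div(2)[OF \<Omega> \<phi> has_weak_divD(2)[OF g]]
      integrable_test_div(1)[OF \<Omega> \<phi> has_weak_divD(1)[OF h]] integrable_test_div(2)[OF \<Omega> \<phi> has_weak_divD(2)[OF h]]
      has_weak_divD(3)[OF g \<phi>] has_weak_divD(3)[OF h \<phi>]
    by (simp add: inner_add_left distrib_right)
qed

lemma has_weak_div_scaleR:
  assumes g: "has_weak_div \<Omega> u g"
  shows "has_weak_div \<Omega> (\<lambda>x. c *\<^sub>R u x) (\<lambda>x. c * g x)"
  using has_weak_divD[OF g] sq_integrable_scaleR[OF has_weak_divD(2)[OF g], of c]
  by (auto simp: has_weak_div_def sq_integrable_scaleR mult.assoc)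

lemma weak_div_diff_AE:
  assumes \<Omega>: "open \<Omega>" and u: "u \<in> H_div \<Omega>" and w: "w \<in> H_div \<Omega>"
  shows "AE x in lebesgue_on \<Omega>. weak_div \<Omega> (\<lambda>x. u x - w x) x = weak_div \<Omega> u x - weak_div \<Omega> w x"
  using weak_div_AE_eq[OF \<Omega> has_weak_div_add[OF \<Omega> weak_div_has_weak_div[OF u]
        has_weak_div_scaleR[OF weak_div_has_weak_div[OF w], of "-1"]]] by simp

section \<open>Averages along a segment\<close>

lemma nn_integral_lborel_translate:
  fixes f :: "'a::euclidean_space \<Rightarrow> ennreal"
  assumes "f \<in> borel_measurable borel"
  shows "(\<integral>\<^sup>+x. f (c + x) \<partial>lborel) = (\<integral>\<^sup>+x. f x \<partial>lborel)"
proof -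
  have "(\<integral>\<^sup>+x. f x \<partial>lborel) = (\<integral>\<^sup>+x. f x \<partial>distr lborel borel ((+) c))"
    by (simp add: lborel_distr_plus)
  also have "\<dots> = (\<integral>\<^sup>+x. f (c + x) \<partial>lborel)"
    by (rule nn_integral_distr) (use assms in auto)
  finally show ?thesis by simp
qed

lemma integral_lborel_translate:
  fixes f :: "'a::euclidean_space \<Rightarrow> 'b::euclidean_space"
  assumes "f \<in> borel_measurable borel"
  shows "integrable lborel (\<lambda>x. f (c + x)) \<longleftrightarrow> integrable lborel f"
    "(\<integral>x. f (c + x) \<partial>lborel) = (\<integral>x. f x \<partial>lborel)"
proof -
  have "integrable (distr lborel borel ((+) c)) f \<longleftrightarrow> integrable lborel (\<lambda>x. f (c + x))"
    by (rule integrable_distr_eq) (use assms in auto)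
  then show "integrable lborel (\<lambda>x. f (c + x)) \<longleftrightarrow> integrable lborel f"
    by (simp add: lborel_distr_plus)
  have "integral\<^sup>L (distr lborel borel ((+) c)) f = (\<integral>x. f (c + x) \<partial>lborel)"
    by (rule integral_distr) (use assms in auto)
  then show "(\<integral>x. f (c + x) \<partial>lborel) = (\<integral>x. f x \<partial>lborel)"
    by (simp add: lborel_distr_plus)
qed

lemma continuous_compact_support_bounded:
  fixes f :: "'a::euclidean_space \<Rightarrow> real"
  assumes "continuous_on UNIV f" "compact K" "\<And>x. x \<notin> K \<Longrightarrow> f x = 0"
  obtains B where "\<And>x. \<bar>f x\<bar> \<le> B"
proof -
  have "compact (f ` K)"
    using assms(1,2) compact_continuous_image continuous_on_subset by blast
  then obtain B where "\<And>x. x \<in> K \<Longrightarrow> \<bar>f x\<bar> \<le> B" "B > 0"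
    by (metis bounded_pos compact_imp_bounded image_eqI real_norm_def)
  then have "\<bar>f x\<bar> \<le> B" for x
    using assms(3) by (cases "x \<in> K") auto
  then show ?thesis using that by blast
qed

definition segment_integral :: "'n::finite \<Rightarrow> real \<Rightarrow> (real^'n \<Rightarrow> real) \<Rightarrow> real^'n \<Rightarrow> real" where
  "segment_integral i L e x = (\<integral>s. indicator {0..L} s * e (x - s *\<^sub>R axis i 1) \<partial>lborel)"

lemma segment_integral_measurable [measurable]:
  assumes [measurable]: "e \<in> borel_measurable borel"
  shows "segment_integral i L e \<in> borel_measurable borel"
proof -
  have "(\<lambda>x. \<integral>s. indicator {0..L} s * e (x - s *\<^sub>R axis i 1) \<partial>lborel) \<in> borel_measurable (borel :: (real^'a) measure)"
    by (rule lborel.borel_measurable_lebesgue_integral) measurable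
  then show ?thesis by (simp add: segment_integral_def[abs_def])
qed

lemma has_derivative_along_axis:
  fixes \<phi> :: "real^'n::finite \<Rightarrow> real"
  assumes "\<phi> differentiable (at (y + s *\<^sub>R axis i 1))"
  shows "((\<lambda>s. \<phi> (y + s *\<^sub>R axis i 1)) has_real_derivative partial_deriv i \<phi> (y + s *\<^sub>R axis i 1)) (at s)"
proof -
  have line: "((\<lambda>s. y + s *\<^sub>R axis i 1) has_derivative (\<lambda>t. t *\<^sub>R axis i 1)) (at s)"
    by (auto intro!: derivative_eq_intros)
  have D: "(\<phi> has_derivative frechet_derivative \<phi> (at (y + s *\<^sub>R axis i 1))) (at (y + s *\<^sub>R axis i 1))"
    using assms frechet_derivative_works by blast
  have "((\<lambda>s. \<phi> (y + s *\<^sub>R axis i 1)) has_derivative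
      (\<lambda>t. frechet_derivative \<phi> (at (y + s *\<^sub>R axis i 1)) (t *\<^sub>R axis i 1))) (at s)"
    using has_derivative_compose[OF line D] .
  also have "(\<lambda>t. frechet_derivative \<phi> (at (y + s *\<^sub>R axis i 1)) (t *\<^sub>R axis i 1))
      = (*) (partial_deriv i \<phi> (y + s *\<^sub>R axis i 1))"
    using linear_scale[OF has_derivative_linear[OF D]]
    by (simp add: partial_deriv_def fun_eq_iff mult.commute)
  finally show ?thesis by (simp add: has_field_derivative_def)
qed

text \<open>
  Both sides are the double integral of \<open>e(x - s a) \<partial>\<^sub>i\<phi>(x)\<close> over \<open>x\<close> and \<open>0 \<le> s \<le> L\<close>, where \<open>a\<close> is
  the \<open>i\<close>-th unit vector: after the substitution \<open>x = y + s a\<close> the inner integral over \<open>s\<close> is that of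
  the derivative of \<open>\<phi>\<close> along a line.
\<close>

lemma integral_segment_integral_partial_deriv:
  fixes \<phi> e :: "real^'n::finite \<Rightarrow> real"
  assumes \<phi>: "smooth \<phi>" and K: "compact (closure {x. \<phi> x \<noteq> 0})"
    and e[measurable]: "e \<in> borel_measurable borel" and int: "integrable lborel e" and L: "0 \<le> L"
  shows "(\<integral>x. segment_integral i L e x * partial_deriv i \<phi> x \<partial>lborel)
    = (\<integral>y. e y * (\<phi> (y + L *\<^sub>R axis i 1) - \<phi> y) \<partial>lborel)"
proof -
  let ?a = "axis i 1 :: real^'n" and ?d = "partial_deriv i \<phi>"
  have cont: "continuous_on UNIV ?d"
    by (rule smooth_continuous[OF smooth_partial_deriv[OF \<phi>]])
  have [measurable]: "?d \<in> borel_measurable borel"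
    using cont by (rule borel_measurable_continuous_onI)
  have [measurable]: "\<phi> \<in> borel_measurable borel"
    using smooth_continuous[OF \<phi>] by (rule borel_measurable_continuous_onI)
  obtain B where B: "\<And>x. \<bar>?d x\<bar> \<le> B"
    by (rule continuous_compact_support_bounded[OF cont K]) (auto simp: partial_deriv_off_support)
  then have B0: "0 \<le> B" using abs_ge_zero order_trans by blast
  have indL: "integrable lborel (\<lambda>s. indicator {0..L} s :: real)"
    using L by (intro integrable_real_indicator) auto
  have dominated: "integrable (lborel \<Otimes>\<^sub>M lborel) (\<lambda>p::real \<times> (real^'n). indicator {0..L} (fst p) * (B * \<bar>e (snd p - r (fst p) *\<^sub>R ?a)\<bar>))"
    if r[measurable]: "r \<in> borel_measurable borel" for r :: "real \<Rightarrow> real"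
  proof (rule lborel_pair.Fubini_integrable)
    have shift: "integrable lborel (\<lambda>y. e (y - t *\<^sub>R ?a))" for t
      using integral_lborel_translate(1)[OF e, of "- t *\<^sub>R ?a"] int by (simp add: algebra_simps)
    have shift_norm: "(\<integral>y. \<bar>e (y - t *\<^sub>R ?a)\<bar> \<partial>lborel) = (\<integral>y. \<bar>e y\<bar> \<partial>lborel)" for t
      using integral_lborel_translate(2)[of "\<lambda>y. \<bar>e y\<bar>" "- t *\<^sub>R ?a"] by (simp add: algebra_simps)
    show "(\<lambda>p::real \<times> (real^'n). indicator {0..L} (fst p) * (B * \<bar>e (snd p - r (fst p) *\<^sub>R ?a)\<bar>)) \<in> borel_measurable (lborel \<Otimes>\<^sub>M lborel)"
      by measurable
    have "(\<lambda>s. \<integral>y. norm (indicator {0..L} (fst (s, y)) * (B * \<bar>e (snd (s, y) - r (fst (s, y)) *\<^sub>R ?a)\<bar>)) \<partial>lborel)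
        = (\<lambda>s. indicator {0..L} s * (B * (\<integral>y. \<bar>e y\<bar> \<partial>lborel)))"
      using B0 by (simp add: fun_eq_iff abs_mult shift_norm)
    then show "integrable lborel (\<lambda>s. \<integral>y. norm (indicator {0..L} (fst (s, y)) * (B * \<bar>e (snd (s, y) - r (fst (s, y)) *\<^sub>R ?a)\<bar>)) \<partial>lborel)"
      using indL by simp
    show "AE s in lborel. integrable lborel (\<lambda>y. indicator {0..L} (fst (s, y)) * (B * \<bar>e (snd (s, y) - r (fst (s, y)) *\<^sub>R ?a)\<bar>))"
      using shift by (intro AE_I2) (auto intro!: integrable_mult_right integrable_abs)
  qed
  have int1: "integrable (lborel \<Otimes>\<^sub>M lborel) (\<lambda>(s, x). indicator {0..L} s * e (x - s *\<^sub>R ?a) * ?d x)"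
  proof (rule Bochner_Integration.integrable_bound[OF dominated[of "\<lambda>s. s"]])
    show "AE p in lborel \<Otimes>\<^sub>M lborel. norm (case p of (s, x) \<Rightarrow> indicator {0..L} s * e (x - s *\<^sub>R ?a) * ?d x)
        \<le> norm (indicator {0..L} (fst p) * (B * \<bar>e (snd p - fst p *\<^sub>R ?a)\<bar>))"
    proof (rule AE_I2)
      fix p :: "real \<times> (real^'n)"
      show "norm (case p of (s, x) \<Rightarrow> indicator {0..L} s * e (x - s *\<^sub>R ?a) * ?d x)
        \<le> norm (indicator {0..L} (fst p) * (B * \<bar>e (snd p - fst p *\<^sub>R ?a)\<bar>))"
        using B[of "snd p"] B0 by (cases p) (auto simp: abs_mult indicator_def mult.commute[of "\<bar>e _\<bar>"] intro: mult_right_mono)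
    qed
  qed measurable
  have int2: "integrable (lborel \<Otimes>\<^sub>M lborel) (\<lambda>(s, y). indicator {0..L} s * e y * ?d (y + s *\<^sub>R ?a))"
  proof (rule Bochner_Integration.integrable_bound[OF dominated[of "\<lambda>s. 0"]])
    show "AE p in lborel \<Otimes>\<^sub>M lborel. norm (case p of (s, y) \<Rightarrow> indicator {0..L} s * e y * ?d (y + s *\<^sub>R ?a))
        \<le> norm (indicator {0..L} (fst p) * (B * \<bar>e (snd p - 0 *\<^sub>R ?a)\<bar>))"
    proof (rule AE_I2)
      fix p :: "real \<times> (real^'n)"
      show "norm (case p of (s, y) \<Rightarrow> indicator {0..L} s * e y * ?d (y + s *\<^sub>R ?a))
        \<le> norm (indicator {0..L} (fst p) * (B * \<bar>e (snd p - 0 *\<^sub>R ?a)\<bar>))"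
        using B[of "snd p + fst p *\<^sub>R ?a"] B0 by (cases p) (auto simp: abs_mult indicator_def mult.commute[of "\<bar>e _\<bar>"] intro: mult_right_mono)
    qed
  qed measurable
  have "(\<integral>x. segment_integral i L e x * ?d x \<partial>lborel)
      = (\<integral>x. (\<integral>s. indicator {0..L} s * e (x - s *\<^sub>R ?a) * ?d x \<partial>lborel) \<partial>lborel)"
    by (simp add: segment_integral_def)
  also have "\<dots> = (\<integral>s. (\<integral>x. indicator {0..L} s * e (x - s *\<^sub>R ?a) * ?d x \<partial>lborel) \<partial>lborel)"
    using int1 by (rule lborel_pair.Fubini_integral)
  also have "\<dots> = (\<integral>s. (\<integral>y. indicator {0..L} s * e y * ?d (y + s *\<^sub>R ?a) \<partial>lborel) \<partial>lborel)"
  proof (rule arg_cong[where f="integral\<^sup>L lborel"], rule ext)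
    fix s
    have "(\<lambda>x. indicator {0..L} s * e (x - s *\<^sub>R ?a) * ?d x) \<in> borel_measurable borel"
      by measurable
    from integral_lborel_translate(2)[OF this, of "s *\<^sub>R ?a"]
    show "(\<integral>x. indicator {0..L} s * e (x - s *\<^sub>R ?a) * ?d x \<partial>lborel)
        = (\<integral>y. indicator {0..L} s * e y * ?d (y + s *\<^sub>R ?a) \<partial>lborel)"
      by (simp add: add.commute)
  qed
  also have "\<dots> = (\<integral>y. (\<integral>s. indicator {0..L} s * e y * ?d (y + s *\<^sub>R ?a) \<partial>lborel) \<partial>lborel)"
    using int2 by (rule lborel_pair.Fubini_integral[symmetric])
  also have "\<dots> = (\<integral>y. e y * (\<phi> (y + L *\<^sub>R ?a) - \<phi> y) \<partial>lborel)"
  proof (rule arg_cong[where f="integral\<^sup>L lborel"], rule ext)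
    fix y
    have "(\<integral>s. ?d (y + s *\<^sub>R ?a) * indicator {0..L} s \<partial>lborel) = \<phi> (y + L *\<^sub>R ?a) - \<phi> (y + 0 *\<^sub>R ?a)"
    proof (rule integral_FTC_Icc_real[OF L])
      show "DERIV (\<lambda>s. \<phi> (y + s *\<^sub>R ?a)) s :> ?d (y + s *\<^sub>R ?a)" for s
        by (rule has_derivative_along_axis[OF smooth_differentiable[OF \<phi>]])
      have "continuous_on UNIV (\<lambda>s. ?d (y + s *\<^sub>R ?a))"
        by (rule continuous_on_compose2[OF cont]) (auto intro!: continuous_intros)
      then show "isCont (\<lambda>s. ?d (y + s *\<^sub>R ?a)) s" for s
        by (simp add: continuous_on_eq_continuous_at)
    qed
    then have "e y * (\<integral>s. ?d (y + s *\<^sub>R ?a) * indicator {0..L} s \<partial>lborel) = e y * (\<phi> (y + L *\<^sub>R ?a) - \<phi> y)"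
      by simp
    then show "(\<integral>s. indicator {0..L} s * e y * ?d (y + s *\<^sub>R ?a) \<partial>lborel) = e y * (\<phi> (y + L *\<^sub>R ?a) - \<phi> y)"
      by (simp add: integral_mult_right_zero[symmetric] ac_simps del: integral_mult_right_zero)
  qed
  finally show ?thesis .
qed

text \<open>
  Averaging the indicator of a large ball does not change it on the support of \<open>f\<close>, and the integral
  of \<open>f\<close> is invariant under translation.
\<close>

lemma integral_partial_deriv_eq_0:
  fixes f :: "real^'n::finite \<Rightarrow> real"
  assumes f: "smooth f" and K: "compact (closure {x. f x \<noteq> 0})"
  shows "(\<integral>x. partial_deriv i f x \<partial>lborel) = 0"
proof -
  let ?a = "axis i 1 :: real^'n"
  obtain R where R: "\<And>x. x \<in> closure {x. f x \<noteq> 0} \<Longrightarrow> norm x \<le> R"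
    using compact_imp_bounded[OF K] by (auto simp: bounded_iff)
  define e :: "real^'n \<Rightarrow> real" where "e = indicator (cball 0 (R + 1))"
  have e_meas: "e \<in> borel_measurable borel"
    unfolding e_def by (intro borel_measurable_indicator) simp
  have e_int: "integrable lborel e"
    unfolding e_def by (rule integrable_real_indicator) (use emeasure_lborel_cball_finite[of "0 :: real^'n" "R + 1"] in auto)
  have e1: "e y = 1" if "norm y \<le> R + 1" for y
    using that by (simp add: e_def)
  have supp: "norm x \<le> R" if "f x \<noteq> 0" for x
    using that R closure_subset[of "{x. f x \<noteq> 0}"] by auto
  have avg: "segment_integral i 1 e x = 1" if x: "norm x \<le> R" for x
  proof -
    have "indicator {0..1} s * e (x - s *\<^sub>R ?a) = indicator {0..1} s" for s :: real
    proof (cases "s \<in> {0..1}")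
      case True
      have "norm (x - s *\<^sub>R ?a) \<le> norm x + norm (s *\<^sub>R ?a)"
        by (rule norm_triangle_ineq4)
      then show ?thesis using True x by (simp add: e1)
    qed simp
    then have "segment_integral i 1 e x = (\<integral>s. indicator {0..1::real} s \<partial>lborel)"
      unfolding segment_integral_def by (rule Bochner_Integration.integral_cong[OF refl])
    then show ?thesis by simp
  qed
  have "(\<integral>x. partial_deriv i f x \<partial>lborel) = (\<integral>x. segment_integral i 1 e x * partial_deriv i f x \<partial>lborel)"
  proof (rule arg_cong[where f="integral\<^sup>L lborel"], rule ext)
    fix x show "partial_deriv i f x = segment_integral i 1 e x * partial_deriv i f x"
      using avg[of x] R[of x] partial_deriv_off_support[of x f i] by (cases "norm x \<le> R") auto
  qed
  also have "\<dots> = (\<integral>y. e y * (f (y + 1 *\<^sub>R ?a) - f y) \<partial>lborel)"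
    by (rule integral_segment_integral_partial_deriv[OF f K e_meas e_int]) simp
  also have "\<dots> = (\<integral>y. f (?a + y) - f y \<partial>lborel)"
  proof (rule arg_cong[where f="integral\<^sup>L lborel"], rule ext)
    fix y
    have "f (y + ?a) = 0" "f y = 0" if "\<not> norm y \<le> R + 1"
      using supp[of "y + ?a"] supp[of y] norm_triangle_ineq4[of "y + ?a" ?a] that by auto
    then show "e y * (f (y + 1 *\<^sub>R ?a) - f y) = f (?a + y) - f y"
      using e1[of y] by (cases "norm y \<le> R + 1") (simp_all add: add.commute)
  qed
  also have "\<dots> = (\<integral>y. f (?a + y) \<partial>lborel) - (\<integral>y. f y \<partial>lborel)"
  proof (rule Bochner_Integration.integral_diff)
    have fc: "continuous_on UNIV f" using smooth_continuous[OF f] .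
    then have m: "f \<in> borel_measurable borel" by (rule borel_measurable_continuous_onI)
    show "integrable lborel f"
      by (rule continuous_compact_support_integrable[OF fc K]) (use closure_subset[of "{x. f x \<noteq> 0}"] in auto)
    then show "integrable lborel (\<lambda>y. f (?a + y))"
      using integral_lborel_translate(1)[OF m] by blast
  qed
  also have "\<dots> = 0"
    using integral_lborel_translate(2)[OF borel_measurable_continuous_onI[OF smooth_continuous[OF f]], of ?a] by simp
  finally show ?thesis .
qed

section \<open>A bounded right inverse of the divergence\<close>

text \<open>
  One factor \<open>L\<close> is the cost of the Cauchy-Schwarz inequality on the segment, the other the length of
  the interval of shifts, each of which preserves the norm of \<open>e\<close>.
\<close>

lemma segment_integral_L2_bound:
  fixes e :: "real^'n::finite \<Rightarrow> real"
  assumes e[measurable]: "e \<in> borel_measurable borel" and L: "0 \<le> L"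
  shows "(\<integral>\<^sup>+x. ennreal ((segment_integral i L e x)\<^sup>2) \<partial>lborel) \<le> ennreal (L\<^sup>2) * (\<integral>\<^sup>+x. ennreal ((e x)\<^sup>2) \<partial>lborel)"
proof -
  let ?a = "axis i 1 :: real^'n"
  have pointwise: "ennreal ((segment_integral i L e x)\<^sup>2)
      \<le> ennreal L * (\<integral>\<^sup>+s. indicator {0..L} s * ennreal ((e (x - s *\<^sub>R ?a))\<^sup>2) \<partial>lborel)" for x
  proof -
    have "ennreal \<bar>segment_integral i L e x\<bar> \<le> (\<integral>\<^sup>+s. norm (indicator {0..L} s * e (x - s *\<^sub>R ?a)) \<partial>lborel)"
    proof (cases "integrable lborel (\<lambda>s. indicator {0..L} s * e (x - s *\<^sub>R ?a))")
      case True
      from integral_norm_bound_ennreal[OF this] show ?thesis by (simp add: segment_integral_def)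
    next
      case False
      then show ?thesis by (simp add: segment_integral_def not_integrable_integral_eq)
    qed
    also have "\<dots> = (\<integral>\<^sup>+s. indicator {0..L} s * (indicator {0..L} s * ennreal \<bar>e (x - s *\<^sub>R ?a)\<bar>) \<partial>lborel)"
      by (rule nn_integral_cong) (auto simp: indicator_def)
    finally have "(ennreal \<bar>segment_integral i L e x\<bar>)\<^sup>2 \<le>
        (\<integral>\<^sup>+s. indicator {0..L} s * (indicator {0..L} s * ennreal \<bar>e (x - s *\<^sub>R ?a)\<bar>) \<partial>lborel)\<^sup>2"
      by (rule power_mono) simp
    also have "\<dots> \<le> (\<integral>\<^sup>+s. (indicator {0..L} s)\<^sup>2 \<partial>lborel) *
        (\<integral>\<^sup>+s. (indicator {0..L} s * ennreal \<bar>e (x - s *\<^sub>R ?a)\<bar>)\<^sup>2 \<partial>lborel)"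
      by (rule Cauchy_Schwarz_nn_integral) measurable
    also have "(\<integral>\<^sup>+s. (indicator {0..L} s :: ennreal)\<^sup>2 \<partial>lborel) = (\<integral>\<^sup>+s. indicator {0..L} s \<partial>lborel)"
      by (rule nn_integral_cong) (auto simp: indicator_def)
    also have "\<dots> = ennreal L" using L by simp
    also have "(\<integral>\<^sup>+s. (indicator {0..L} s * ennreal \<bar>e (x - s *\<^sub>R ?a)\<bar>)\<^sup>2 \<partial>lborel)
        = (\<integral>\<^sup>+s. indicator {0..L} s * ennreal ((e (x - s *\<^sub>R ?a))\<^sup>2) \<partial>lborel)"
      by (rule nn_integral_cong) (auto simp: indicator_def ennreal_power)
    finally show ?thesis by (simp add: ennreal_power)
  qed
  have "(\<integral>\<^sup>+x. ennreal ((segment_integral i L e x)\<^sup>2) \<partial>lborel)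
      \<le> (\<integral>\<^sup>+x. ennreal L * (\<integral>\<^sup>+s. indicator {0..L} s * ennreal ((e (x - s *\<^sub>R ?a))\<^sup>2) \<partial>lborel) \<partial>lborel)"
    by (rule nn_integral_mono) (rule pointwise)
  also have "\<dots> = ennreal L * (\<integral>\<^sup>+x. (\<integral>\<^sup>+s. indicator {0..L} s * ennreal ((e (x - s *\<^sub>R ?a))\<^sup>2) \<partial>lborel) \<partial>lborel)"
    by (rule nn_integral_cmult) measurable
  also have "(\<integral>\<^sup>+x. (\<integral>\<^sup>+s. indicator {0..L} s * ennreal ((e (x - s *\<^sub>R ?a))\<^sup>2) \<partial>lborel) \<partial>lborel)
      = (\<integral>\<^sup>+s. (\<integral>\<^sup>+x. indicator {0..L} s * ennreal ((e (x - s *\<^sub>R ?a))\<^sup>2) \<partial>lborel) \<partial>lborel)"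
    by (rule lborel_pair.Fubini') measurable
  also have "\<dots> = (\<integral>\<^sup>+s. indicator {0..L} s * (\<integral>\<^sup>+x. ennreal ((e x)\<^sup>2) \<partial>lborel) \<partial>lborel)"
  proof (rule nn_integral_cong)
    fix s :: real
    have "(\<integral>\<^sup>+x. indicator {0..L} s * ennreal ((e (x - s *\<^sub>R ?a))\<^sup>2) \<partial>lborel)
        = indicator {0..L} s * (\<integral>\<^sup>+x. ennreal ((e (x - s *\<^sub>R ?a))\<^sup>2) \<partial>lborel)"
      by (rule nn_integral_cmult) measurable
    also have "(\<integral>\<^sup>+x. ennreal ((e (x - s *\<^sub>R ?a))\<^sup>2) \<partial>lborel) = (\<integral>\<^sup>+x. ennreal ((e x)\<^sup>2) \<partial>lborel)"
      using nn_integral_lborel_translate[of "\<lambda>x. ennreal ((e x)\<^sup>2)" "- s *\<^sub>R ?a"] by (simp add: algebra_simps)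
    finally show "(\<integral>\<^sup>+x. indicator {0..L} s * ennreal ((e (x - s *\<^sub>R ?a))\<^sup>2) \<partial>lborel)
        = indicator {0..L} s * (\<integral>\<^sup>+x. ennreal ((e x)\<^sup>2) \<partial>lborel)" .
  qed
  also have "\<dots> = ennreal L * (\<integral>\<^sup>+x. ennreal ((e x)\<^sup>2) \<partial>lborel)"
    using L by (subst nn_integral_multc) auto
  finally show ?thesis
    using L by (simp add: mult.assoc[symmetric] ennreal_mult[symmetric] power2_eq_square)
qed

lemma sq_integrable_L2_nn_integral:
  fixes f :: "real^'n::finite \<Rightarrow> real"
  assumes S: "S \<in> sets lebesgue" and f: "f \<in> borel_measurable (lebesgue_on S)"
    and fin: "(\<integral>\<^sup>+x. ennreal (indicator S x * (f x)\<^sup>2) \<partial>lebesgue) < \<infinity>"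
  shows "sq_integrable (lebesgue_on S) f"
    and "ennreal ((L2_norm (lebesgue_on S) f)\<^sup>2) = (\<integral>\<^sup>+x. ennreal (indicator S x * (f x)\<^sup>2) \<partial>lebesgue)"
proof -
  have "(\<lambda>x. (norm (f x))\<^sup>2) \<in> borel_measurable (lebesgue_on S)" using f by simp
  then have m: "(\<lambda>x. indicator S x *\<^sub>R (norm (f x))\<^sup>2) \<in> borel_measurable lebesgue"
    using S by (subst (asm) borel_measurable_restrict_space_iff) auto
  have i: "integrable lebesgue (\<lambda>x. indicator S x *\<^sub>R (norm (f x))\<^sup>2)"
    using m fin by (intro integrableI_nonneg) auto
  then show "sq_integrable (lebesgue_on S) f"
    using f unfolding sq_integrable_def integrable_lebesgue_on_indicator[OF S] by blast
  have "(L2_norm (lebesgue_on S) f)\<^sup>2 = (\<integral>x. indicator S x *\<^sub>R (norm (f x))\<^sup>2 \<partial>lebesgue)"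
    unfolding L2_norm_square L2_inner_def integral_lebesgue_on_indicator[OF S]
    by (simp add: power2_eq_square)
  then show "ennreal ((L2_norm (lebesgue_on S) f)\<^sup>2) = (\<integral>\<^sup>+x. ennreal (indicator S x * (f x)\<^sup>2) \<partial>lebesgue)"
    using nn_integral_eq_integral[OF i] by simp
qed

text \<open>
  The field \<open>w\<close> points in a coordinate direction \<open>a\<close>, and its component at \<open>x\<close> is the integral of \<open>e\<close>, continued
  by zero, over the segment from \<open>x - L a\<close> to \<open>x\<close>. Its divergence is \<open>e(x) - e(x - L a)\<close>, where the
  second term vanishes on \<open>\<Omega>\<close> because a shift by \<open>L\<close> leaves \<open>\<Omega>\<close>. The constant is a bound of the
  diameter, and hence uniform over active domains whose shape varies with the position of the mesh.
\<close>

lemma weak_div_right_inverse: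
  fixes \<Omega> :: "(real^'n::finite) set" and e :: "real^'n \<Rightarrow> real"
  assumes \<Omega>: "open \<Omega>" and e: "sq_integrable (lebesgue_on \<Omega>) e"
    and L: "0 < L" and width: "\<And>x y. x \<in> \<Omega> \<Longrightarrow> y \<in> \<Omega> \<Longrightarrow> dist x y < L"
  obtains w where "has_weak_div \<Omega> w e" "L2_norm (lebesgue_on \<Omega>) w \<le> L * L2_norm (lebesgue_on \<Omega>) e"
proof -
  \<comment> \<open>Any coordinate direction will do.\<close>
  define i :: 'n where "i = undefined"
  let ?a = "axis i 1 :: real^'n"
  have \<Omega>_meas: "\<Omega> \<in> sets lebesgue" and \<Omega>_borel[measurable]: "\<Omega> \<in> sets borel" using \<Omega> by auto
  \<comment> \<open>Joint measurability of \<open>e(x - s a)\<close> in \<open>s\<close> and \<open>x\<close> requires a Borel representative \<open>e'\<close> of \<open>e\<close>.\<close>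
  have "(\<lambda>x. indicator \<Omega> x *\<^sub>R e x) \<in> borel_measurable lebesgue"
    using sq_integrable_borel[OF e] \<Omega>_meas by (subst (asm) borel_measurable_restrict_space_iff) auto
  then obtain e1 where e1[measurable]: "e1 \<in> borel_measurable borel"
    and e1_eq: "AE x in lborel. indicator \<Omega> x *\<^sub>R e x = e1 x"
    using completion_ex_borel_measurable_real[of "\<lambda>x. indicator \<Omega> x *\<^sub>R e x" lborel] by auto
  define e' where "e' x = indicator \<Omega> x * e1 x" for x
  have e'_meas[measurable]: "e' \<in> borel_measurable borel"
    unfolding e'_def[abs_def] by measurable
  have e'_off: "e' x = 0" if "x \<notin> \<Omega>" for x using that by (simp add: e'_def)
  have e'_eq: "AE x in lebesgue. indicator \<Omega> x * e x = e' x"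
    using AE_completion[OF e1_eq] by eventually_elim (auto simp: e'_def indicator_def)
  have e'_sq: "(\<integral>\<^sup>+x. ennreal ((e' x)\<^sup>2) \<partial>lborel) = ennreal ((L2_norm (lebesgue_on \<Omega>) e)\<^sup>2)"
  proof -
    have int: "integrable lebesgue (\<lambda>x. indicator \<Omega> x *\<^sub>R (norm (e x))\<^sup>2)"
      using e unfolding sq_integrable_def integrable_lebesgue_on_indicator[OF \<Omega>_meas] by blast
    have "(\<integral>\<^sup>+x. ennreal ((e' x)\<^sup>2) \<partial>lborel) = (\<integral>\<^sup>+x. ennreal ((e' x)\<^sup>2) \<partial>lebesgue)"
      by (simp add: nn_integral_completion)
    also have "\<dots> = (\<integral>\<^sup>+x. ennreal (indicator \<Omega> x *\<^sub>R (norm (e x))\<^sup>2) \<partial>lebesgue)"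
    proof (rule nn_integral_cong_AE)
      show "AE x in lebesgue. ennreal ((e' x)\<^sup>2) = ennreal (indicator \<Omega> x *\<^sub>R (norm (e x))\<^sup>2)"
        using e'_eq
      proof eventually_elim
        case (elim x)
        then show ?case by (simp add: elim[symmetric] power_mult_distrib indicator_def)
      qed
    qed
    also have "\<dots> = ennreal (\<integral>x. indicator \<Omega> x *\<^sub>R (norm (e x))\<^sup>2 \<partial>lebesgue)"
      by (rule nn_integral_eq_integral[OF int]) auto
    also have "(\<integral>x. indicator \<Omega> x *\<^sub>R (norm (e x))\<^sup>2 \<partial>lebesgue) = (L2_norm (lebesgue_on \<Omega>) e)\<^sup>2"
      unfolding L2_norm_square L2_inner_def integral_lebesgue_on_indicator[OF \<Omega>_meas]
      by (simp add: power2_eq_square)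
    finally show ?thesis .
  qed
  have e'_int: "integrable lborel e'"
  proof (rule Bochner_Integration.integrable_bound)
    have "bounded \<Omega>"
    proof (cases "\<Omega> = {}")
      case False
      then obtain x where "x \<in> \<Omega>" by blast
      then have "\<forall>y\<in>\<Omega>. dist x y \<le> L" using width less_imp_le by blast
      then show ?thesis unfolding bounded_def by blast
    qed simp
    then have "emeasure lborel \<Omega> < \<infinity>" by (rule emeasure_bounded_finite)
    then have "integrable lborel (\<lambda>x. indicator \<Omega> x :: real)"
      by (intro integrable_real_indicator) auto
    moreover have "integrable lborel (\<lambda>x. (e' x)\<^sup>2)"
      using e'_sq by (intro integrableI_nonneg) auto
    ultimately show "integrable lborel (\<lambda>x. indicator \<Omega> x + (e' x)\<^sup>2)" by auto
    show "AE x in lborel. norm (e' x) \<le> norm (indicator \<Omega> x + (e' x)\<^sup>2)"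
    proof (rule AE_I2)
      fix x
      have "2 * \<bar>e' x\<bar> \<le> 1 + (e' x)\<^sup>2"
        using sum_squares_bound[of 1 "\<bar>e' x\<bar>"] by simp
      then show "norm (e' x) \<le> norm (indicator \<Omega> x + (e' x)\<^sup>2)"
        using e'_off[of x] by (cases "x \<in> \<Omega>") auto
    qed
  qed simp
  define w0 where "w0 = segment_integral i L e'"
  have w0_meas[measurable]: "w0 \<in> borel_measurable borel"
    unfolding w0_def by measurable
  have bound: "(\<integral>\<^sup>+x. ennreal (indicator \<Omega> x * (w0 x)\<^sup>2) \<partial>lebesgue) \<le> ennreal ((L * L2_norm (lebesgue_on \<Omega>) e)\<^sup>2)"
  proof -
    have "(\<integral>\<^sup>+x. ennreal (indicator \<Omega> x * (w0 x)\<^sup>2) \<partial>lebesgue) \<le> (\<integral>\<^sup>+x. ennreal ((w0 x)\<^sup>2) \<partial>lborel)"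
      unfolding nn_integral_completion by (intro nn_integral_mono) (auto simp: indicator_def)
    also have "\<dots> \<le> ennreal (L\<^sup>2) * (\<integral>\<^sup>+x. ennreal ((e' x)\<^sup>2) \<partial>lborel)"
      unfolding w0_def using L by (intro segment_integral_L2_bound) auto
    also have "\<dots> = ennreal ((L * L2_norm (lebesgue_on \<Omega>) e)\<^sup>2)"
      unfolding e'_sq by (simp add: ennreal_mult[symmetric] power_mult_distrib)
    finally show ?thesis .
  qed
  have w0_on: "w0 \<in> borel_measurable (lebesgue_on \<Omega>)"
    using w0_meas by (intro measurable_restrict_space1 measurable_completion) auto
  have fin: "(\<integral>\<^sup>+x. ennreal (indicator \<Omega> x * (w0 x)\<^sup>2) \<partial>lebesgue) < \<infinity>"
    using bound by (rule order.strict_trans1) simp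
  note w0_L2 = sq_integrable_L2_nn_integral[OF \<Omega>_meas w0_on fin]
  define w where "w x = w0 x *\<^sub>R ?a" for x
  have w_sq: "sq_integrable (lebesgue_on \<Omega>) w"
  proof -
    have "w \<in> borel_measurable (lebesgue_on \<Omega>)"
      unfolding w_def[abs_def] using w0_on by (intro borel_measurable_scaleR) auto
    then show ?thesis
      using w0_L2(1) by (simp add: sq_integrable_def w_def)
  qed
  have "L2_norm (lebesgue_on \<Omega>) w = L2_norm (lebesgue_on \<Omega>) w0"
    by (simp add: L2_norm_def L2_inner_def w_def inner_axis_axis)
  moreover have "L2_norm (lebesgue_on \<Omega>) w0 \<le> L * L2_norm (lebesgue_on \<Omega>) e"
  proof (rule power2_le_imp_le)
    show "(L2_norm (lebesgue_on \<Omega>) w0)\<^sup>2 \<le> (L * L2_norm (lebesgue_on \<Omega>) e)\<^sup>2"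
      using bound unfolding w0_L2(2)[symmetric] by simp
    show "0 \<le> L * L2_norm (lebesgue_on \<Omega>) e"
      using L by (intro mult_nonneg_nonneg L2_norm_nonneg) simp
  qed
  ultimately have w_bound: "L2_norm (lebesgue_on \<Omega>) w \<le> L * L2_norm (lebesgue_on \<Omega>) e"
    by simp
  have "has_weak_div \<Omega> w e"
    unfolding has_weak_div_def
  proof (intro conjI ballI w_sq e)
    fix \<phi> assume \<phi>: "\<phi> \<in> test_functions \<Omega>"
    have sm: "smooth \<phi>" and K: "compact (closure {x. \<phi> x \<noteq> 0})"
      using \<phi> by (auto simp: test_functions_def)
    have [measurable]: "partial_deriv i \<phi> \<in> borel_measurable borel"
      by (rule borel_measurable_continuous_onI[OF smooth_continuous[OF smooth_partial_deriv[OF sm]]])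
    have [measurable]: "\<phi> \<in> borel_measurable borel"
      by (rule borel_measurable_continuous_onI[OF smooth_continuous[OF sm]])
    have "(\<integral>x. w x \<bullet> gradient \<phi> x \<partial>lebesgue_on \<Omega>) = (\<integral>x. w0 x * partial_deriv i \<phi> x \<partial>lebesgue_on \<Omega>)"
      by (simp add: w_def inner_axis' gradient_def)
    also have "\<dots> = (\<integral>x. w0 x * partial_deriv i \<phi> x \<partial>lebesgue)"
      unfolding integral_lebesgue_on_indicator[OF \<Omega>_meas]
    proof (rule arg_cong[where f="integral\<^sup>L lebesgue"], rule ext)
      fix x show "indicator \<Omega> x *\<^sub>R (w0 x * partial_deriv i \<phi> x) = w0 x * partial_deriv i \<phi> x"
        using test_function_iter_deriv_off[OF \<phi>, of x "[i]"] by (cases "x \<in> \<Omega>") auto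
    qed
    also have "\<dots> = (\<integral>x. segment_integral i L e' x * partial_deriv i \<phi> x \<partial>lborel)"
      unfolding w0_def by (rule integral_completion) measurable
    also have "\<dots> = (\<integral>y. e' y * (\<phi> (y + L *\<^sub>R ?a) - \<phi> y) \<partial>lborel)"
      using L by (intro integral_segment_integral_partial_deriv[OF sm K] e'_int) auto
    also have "\<dots> = (\<integral>y. - (e' y * \<phi> y) \<partial>lborel)"
    proof (rule arg_cong[where f="integral\<^sup>L lborel"], rule ext)
      fix y
      have "y + L *\<^sub>R ?a \<notin> \<Omega>" if "y \<in> \<Omega>"
        using width[of y "y + L *\<^sub>R ?a"] that L by (auto simp: dist_norm)
      then show "e' y * (\<phi> (y + L *\<^sub>R ?a) - \<phi> y) = - (e' y * \<phi> y)"
        using e'_off[of y] test_function_off[OF \<phi>] by (cases "y \<in> \<Omega>") auto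
    qed
    also have "\<dots> = - (\<integral>y. e' y * \<phi> y \<partial>lborel)" by simp
    also have "(\<integral>y. e' y * \<phi> y \<partial>lborel) = (\<integral>y. e' y * \<phi> y \<partial>lebesgue)"
      by (rule integral_completion[symmetric]) measurable
    also have "\<dots> = (\<integral>y. e y * \<phi> y \<partial>lebesgue_on \<Omega>)"
      unfolding integral_lebesgue_on_indicator[OF \<Omega>_meas]
    proof (rule integral_cong_AE)
      show "(\<lambda>y. e' y * \<phi> y) \<in> borel_measurable lebesgue"
        by (rule measurable_completion) measurable
      have "integrable lebesgue (\<lambda>x. indicator \<Omega> x *\<^sub>R (e x * \<phi> x))"
        using integrable_test_div(2)[OF \<Omega> \<phi> e] unfolding integrable_lebesgue_on_indicator[OF \<Omega>_meas] .
      then show "(\<lambda>x. indicator \<Omega> x *\<^sub>R (e x * \<phi> x)) \<in> borel_measurable lebesgue"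
        by (rule borel_measurable_integrable)
      show "AE x in lebesgue. e' x * \<phi> x = indicator \<Omega> x *\<^sub>R (e x * \<phi> x)"
        using e'_eq
      proof eventually_elim
        case (elim x)
        then show ?case by (simp add: elim[symmetric])
      qed
    qed
    finally show "(\<integral>x. w x \<bullet> gradient \<phi> x \<partial>lebesgue_on \<Omega>) = - (\<integral>x. e x * \<phi> x \<partial>lebesgue_on \<Omega>)" .
  qed
  with w_bound show ?thesis using that by blast
qed

section \<open>Green's formula with weak traces\<close>

lemma smooth_sq_integrable_bounded:
  fixes \<Omega> :: "(real^'n::finite) set" and f :: "real^'n \<Rightarrow> 'b::euclidean_space"
  assumes \<Omega>: "open \<Omega>" "bounded \<Omega>" and f: "continuous_on UNIV f"
  shows "sq_integrable (lebesgue_on \<Omega>) f"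
proof -
  have \<Omega>_meas: "\<Omega> \<in> sets lebesgue" using \<Omega> by auto
  have "compact (closure \<Omega>)" using \<Omega>(2) by simp
  moreover have "continuous_on (closure \<Omega>) (\<lambda>x. (norm (f x))\<^sup>2)"
    using f by (intro continuous_intros) (rule continuous_on_subset, auto)
  ultimately have "integrable lborel (\<lambda>x. indicator (closure \<Omega>) x *\<^sub>R (norm (f x))\<^sup>2)"
    by (rule borel_integrable_compact)
  then have "integrable lebesgue (\<lambda>x. indicator (closure \<Omega>) x *\<^sub>R (norm (f x))\<^sup>2)"
    by (rule integrable_lborel_lebesgue)
  then have "integrable lebesgue (\<lambda>x. indicator \<Omega> x *\<^sub>R (indicator (closure \<Omega>) x *\<^sub>R (norm (f x))\<^sup>2))"
    by (rule integrable_mult_indicator[OF \<Omega>_meas])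
  also have "(\<lambda>x. indicator \<Omega> x *\<^sub>R (indicator (closure \<Omega>) x *\<^sub>R (norm (f x))\<^sup>2)) = (\<lambda>x. indicator \<Omega> x *\<^sub>R (norm (f x))\<^sup>2)"
    using closure_subset[of \<Omega>] by (auto simp: fun_eq_iff indicator_def)
  finally have "integrable (lebesgue_on \<Omega>) (\<lambda>x. (norm (f x))\<^sup>2)"
    unfolding integrable_lebesgue_on_indicator[OF \<Omega>_meas] .
  moreover have "f \<in> borel_measurable (lebesgue_on \<Omega>)"
    using borel_measurable_continuous_onI[OF f] by (intro measurable_restrict_space1 measurable_completion) auto
  ultimately show ?thesis by (simp add: sq_integrable_def)
qed

text \<open>
  Integration by parts: the product with a test function has compact support, and therefore its
  partial derivative integrates to zero.
\<close>

lemma smooth_has_weak_deriv: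
  fixes \<phi> :: "real^'n::finite \<Rightarrow> real"
  assumes \<Omega>: "open \<Omega>" "bounded \<Omega>" and \<phi>: "smooth \<phi>"
  shows "has_weak_deriv \<Omega> [i] \<phi> (partial_deriv i \<phi>)"
  unfolding has_weak_deriv_def
proof (intro conjI ballI)
  show sq: "sq_integrable (lebesgue_on \<Omega>) \<phi>" "sq_integrable (lebesgue_on \<Omega>) (partial_deriv i \<phi>)"
    using smooth_sq_integrable_bounded[OF \<Omega>] smooth_continuous[OF \<phi>]
      smooth_continuous[OF smooth_partial_deriv[OF \<phi>]] by blast+
  fix \<psi> assume \<psi>: "\<psi> \<in> test_functions \<Omega>"
  have sm: "smooth \<psi>" and K: "compact (closure {x. \<psi> x \<noteq> 0})"
    using \<psi> by (auto simp: test_functions_def)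
  have \<Omega>_meas: "\<Omega> \<in> sets lebesgue" using \<Omega> by auto
  have prod: "partial_deriv i (\<lambda>x. \<psi> x * \<phi> x) x = partial_deriv i \<psi> x * \<phi> x + \<psi> x * partial_deriv i \<phi> x" for x
    by (intro partial_deriv_mult smooth_differentiable sm \<phi>)
  have "(\<integral>x. partial_deriv i (\<lambda>x. \<psi> x * \<phi> x) x \<partial>lborel) = 0"
  proof (rule integral_partial_deriv_eq_0[OF smooth_mult[OF sm \<phi>]])
    have "closure {x. \<psi> x * \<phi> x \<noteq> 0} \<subseteq> closure {x. \<psi> x \<noteq> 0}"
      by (rule closure_mono) auto
    then show "compact (closure {x. \<psi> x * \<phi> x \<noteq> 0})"
      using K by (meson bounded_subset closed_closure compact_eq_bounded_closed)
  qed
  moreover have "(\<integral>x. partial_deriv i (\<lambda>x. \<psi> x * \<phi> x) x \<partial>lborel) = (\<integral>x. partial_deriv i (\<lambda>x. \<psi> x * \<phi> x) x \<partial>lebesgue)"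
    by (rule integral_completion[symmetric])
      (auto intro!: borel_measurable_continuous_onI smooth_continuous smooth_partial_deriv smooth_mult sm \<phi>)
  moreover have "\<dots> = (\<integral>x. partial_deriv i \<psi> x * \<phi> x + \<psi> x * partial_deriv i \<phi> x \<partial>lebesgue_on \<Omega>)"
    unfolding integral_lebesgue_on_indicator[OF \<Omega>_meas] prod
  proof (rule arg_cong[where f="integral\<^sup>L lebesgue"], rule ext)
    fix x
    show "partial_deriv i \<psi> x * \<phi> x + \<psi> x * partial_deriv i \<phi> x =
        indicator \<Omega> x *\<^sub>R (partial_deriv i \<psi> x * \<phi> x + \<psi> x * partial_deriv i \<phi> x)"
      using test_function_iter_deriv_off[OF \<psi>, of x "[i]"] test_function_off[OF \<psi>, of x] by (cases "x \<in> \<Omega>") auto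
  qed
  moreover have "\<dots> = (\<integral>x. partial_deriv i \<psi> x * \<phi> x \<partial>lebesgue_on \<Omega>) + (\<integral>x. \<psi> x * partial_deriv i \<phi> x \<partial>lebesgue_on \<Omega>)"
    using integrable_test_scaleR(1)[OF \<Omega>(1) \<psi> sq(1), of "[i]"] integrable_test_scaleR(2)[OF \<Omega>(1) \<psi> sq(2)]
    by (intro Bochner_Integration.integral_add) auto
  ultimately show "(\<integral>x. iter_deriv [i] \<psi> x *\<^sub>R \<phi> x \<partial>lebesgue_on \<Omega>) =
      (-1) ^ length [i] *\<^sub>R (\<integral>x. \<psi> x *\<^sub>R partial_deriv i \<phi> x \<partial>lebesgue_on \<Omega>)"
    by simp
qed

lemma L2_norm_vector_square:
  fixes F :: "real^'k::finite \<Rightarrow> real^'n::finite"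
  assumes F: "sq_integrable M F"
  shows "(L2_norm M F)\<^sup>2 = (\<Sum>i\<in>UNIV. (L2_norm M (\<lambda>x. F x $ i))\<^sup>2)"
proof -
  have comp: "sq_integrable M (\<lambda>x. F x $ i)" for i
    using sq_integrable_inner_const[OF F, of "axis i 1"] by (simp add: inner_axis)
  show ?thesis
    unfolding L2_norm_square L2_inner_def inner_vec_def
    using integrable_inner_sq[OF comp comp] by (intro Bochner_Integration.integral_sum) (auto simp: inner_vec_def)
qed

lemma sq_integrable_vecI:
  fixes F :: "_ \<Rightarrow> real^'n::finite"
  assumes "\<And>i. sq_integrable M (\<lambda>x. F x $ i)"
  shows "sq_integrable M F"
  unfolding sq_integrable_def
proof
  show "F \<in> borel_measurable M"
  proof (subst borel_measurable_euclidean_space, intro ballI)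
    fix b :: "real^'n" assume "b \<in> Basis"
    then obtain i where "b = axis i 1" by (auto simp: Basis_vec_def)
    then show "(\<lambda>x. F x \<bullet> b) \<in> borel_measurable M"
      using assms[of i] by (simp add: inner_axis sq_integrable_def)
  qed
  have "integrable M (\<lambda>x. \<Sum>i\<in>UNIV. (norm (F x $ i))\<^sup>2)"
    using assms by (auto simp: sq_integrable_def)
  also have "(\<lambda>x. \<Sum>i\<in>UNIV. (norm (F x $ i))\<^sup>2) = (\<lambda>x. (norm (F x))\<^sup>2)"
    by (rule ext) (simp add: power2_norm_eq_inner inner_vec_def flip: power2_eq_square)
  finally show "integrable M (\<lambda>x. (norm (F x))\<^sup>2)" .
qed

lemma weak_grad_sq_integrable:
  assumes "p \<in> sobolev \<Omega> 1"
  shows "sq_integrable (lebesgue_on \<Omega>) p" "sq_integrable (lebesgue_on \<Omega>) (weak_grad \<Omega> p)"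
proof -
  have p: "p \<in> sobolev \<Omega> (real 1)" using assms by simp
  then show "sq_integrable (lebesgue_on \<Omega>) p" unfolding sobolev_nat_iff by blast
  show "sq_integrable (lebesgue_on \<Omega>) (weak_grad \<Omega> p)"
  proof (rule sq_integrable_vecI)
    fix i
    obtain v where "has_weak_deriv \<Omega> [i] p v" using p unfolding sobolev_nat_iff by force
    from has_weak_derivD(2)[OF weak_deriv_has_weak_deriv[OF this]]
    show "sq_integrable (lebesgue_on \<Omega>) (\<lambda>x. weak_grad \<Omega> p x $ i)" by (simp add: weak_grad_def)
  qed
qed

lemma gradient_diff_le_sobolev_norm:
  fixes \<phi> p :: "real^'n::finite \<Rightarrow> real"
  assumes \<Omega>: "open \<Omega>" "bounded \<Omega>" and \<phi>: "smooth \<phi>" and p: "p \<in> sobolev \<Omega> 1"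
  shows "L2_norm (lebesgue_on \<Omega>) (\<lambda>x. gradient \<phi> x - weak_grad \<Omega> p x)
      \<le> sqrt (real CARD('n)) * sobolev_norm \<Omega> 1 (\<lambda>x. \<phi> x - p x)"
    and "L2_norm (lebesgue_on \<Omega>) (\<lambda>x. \<phi> x - p x) \<le> sobolev_norm \<Omega> 1 (\<lambda>x. \<phi> x - p x)"
proof -
  let ?N = "sobolev_norm \<Omega> (real 1) (\<lambda>x. \<phi> x - p x)"
  have p1: "p \<in> sobolev \<Omega> (real 1)" using p by simp
  have grad_sq: "sq_integrable (lebesgue_on \<Omega>) (\<lambda>x. gradient \<phi> x - weak_grad \<Omega> p x)"
    using smooth_sq_integrable_bounded[OF \<Omega> smooth_gradient_continuous[OF \<phi>]] weak_grad_sq_integrable(2)[OF p]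
    by (rule sq_integrable_diff)
  have comp: "L2_norm (lebesgue_on \<Omega>) (\<lambda>x. (gradient \<phi> x - weak_grad \<Omega> p x) $ i) \<le> ?N" for i
  proof -
    obtain v where "has_weak_deriv \<Omega> [i] p v" using p1 unfolding sobolev_nat_iff by force
    then have "has_weak_deriv \<Omega> [i] p (weak_deriv \<Omega> [i] p)" by (rule weak_deriv_has_weak_deriv)
    from has_weak_deriv_diff[OF \<Omega>(1) smooth_has_weak_deriv[OF \<Omega> \<phi>] this]
    have "L2_norm (lebesgue_on \<Omega>) (\<lambda>x. partial_deriv i \<phi> x - weak_deriv \<Omega> [i] p x)
        = L2_norm (lebesgue_on \<Omega>) (weak_deriv \<Omega> [i] (\<lambda>x. \<phi> x - p x))"
      by (rule L2_norm_weak_deriv[OF \<Omega>(1), symmetric])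
    also have "\<dots> \<le> ?N"
      by (rule L2_norm_weak_deriv_le_sobolev_norm) simp
    finally show ?thesis by (simp add: gradient_def weak_grad_def)
  qed
  have "(L2_norm (lebesgue_on \<Omega>) (\<lambda>x. gradient \<phi> x - weak_grad \<Omega> p x))\<^sup>2 \<le> (\<Sum>i\<in>(UNIV::'n set). ?N\<^sup>2)"
    unfolding L2_norm_vector_square[OF grad_sq]
    by (intro sum_mono power_mono comp L2_norm_nonneg)
  also have "\<dots> = (sqrt (real CARD('n)) * ?N)\<^sup>2"
    by (simp add: power_mult_distrib)
  finally have "L2_norm (lebesgue_on \<Omega>) (\<lambda>x. gradient \<phi> x - weak_grad \<Omega> p x) \<le> sqrt (real CARD('n)) * ?N"
    by (rule power2_le_imp_le) (simp add: sobolev_norm_nat_nonneg[of \<Omega> 1, simplified])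
  then show "L2_norm (lebesgue_on \<Omega>) (\<lambda>x. gradient \<phi> x - weak_grad \<Omega> p x)
      \<le> sqrt (real CARD('n)) * sobolev_norm \<Omega> 1 (\<lambda>x. \<phi> x - p x)" by simp
  have "sq_integrable (lebesgue_on \<Omega>) (\<lambda>x. \<phi> x - p x)"
    using smooth_sq_integrable_bounded[OF \<Omega> smooth_continuous[OF \<phi>]] weak_grad_sq_integrable(1)[OF p]
    by (rule sq_integrable_diff)
  from L2_norm_weak_deriv[OF \<Omega>(1) has_weak_deriv_Nil[OF this]]
    L2_norm_weak_deriv_le_sobolev_norm[of "[]" 1 \<Omega> "\<lambda>x. \<phi> x - p x"]
  show "L2_norm (lebesgue_on \<Omega>) (\<lambda>x. \<phi> x - p x) \<le> sobolev_norm \<Omega> 1 (\<lambda>x. \<phi> x - p x)" by simp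
qed

lemma L2_inner_tendsto:
  assumes v: "sq_integrable M v" and f: "\<And>k. sq_integrable M (f k)" and l: "sq_integrable M l"
    and lim: "(\<lambda>k. L2_norm M (\<lambda>x. f k x - l x)) \<longlonglongrightarrow> 0"
  shows "(\<lambda>k. L2_inner M v (f k)) \<longlonglongrightarrow> L2_inner M v l"
proof (rule LIM_zero_cancel, rule Lim_null_comparison)
  show "\<forall>\<^sub>F k in sequentially. norm (L2_inner M v (f k) - L2_inner M v l) \<le> L2_norm M v * L2_norm M (\<lambda>x. f k x - l x)"
  proof (rule always_eventually, rule allI)
    fix k
    have "\<bar>L2_inner M v (\<lambda>x. f k x - l x)\<bar> \<le> L2_norm M v * L2_norm M (\<lambda>x. f k x - l x)"
      by (rule L2_Cauchy_Schwarz[OF v sq_integrable_diff[OF f l]])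
    then show "norm (L2_inner M v (f k) - L2_inner M v l) \<le> L2_norm M v * L2_norm M (\<lambda>x. f k x - l x)"
      using L2_inner_diff_right[OF f l v] by simp
  qed
  show "(\<lambda>k. L2_norm M v * L2_norm M (\<lambda>x. f k x - l x)) \<longlonglongrightarrow> 0"
    using tendsto_mult_left[OF lim, of "L2_norm M v"] by simp
qed

text \<open>
  For smooth functions this is the definition of the normal trace; it passes to the limit along the
  sequence that defines the trace of \<open>p\<close>.
\<close>

lemma Green_formula:
  fixes \<Omega> :: "(real^'n::finite) set"
  assumes \<Omega>: "open \<Omega>" "bounded \<Omega>" and v: "has_normal_trace \<Omega> v vn" and p: "has_trace \<Omega> p q"
  shows "L2_inner (lebesgue_on \<Omega>) v (weak_grad \<Omega> p) + L2_inner (lebesgue_on \<Omega>) (weak_div \<Omega> v) p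
    = L2_inner (surface \<Omega>) vn q"
proof -
  have p1: "p \<in> sobolev \<Omega> 1" and q: "sq_integrable (surface \<Omega>) q" using p by (auto simp: has_trace_def)
  obtain \<phi> where sm: "\<And>k::nat. smooth (\<phi> k)" and surf: "\<And>k. sq_integrable (surface \<Omega>) (\<phi> k)"
    and lim: "(\<lambda>k. sobolev_norm \<Omega> 1 (\<lambda>x. \<phi> k x - p x)) \<longlonglongrightarrow> 0"
    and lim_surf: "(\<lambda>k. L2_norm (surface \<Omega>) (\<lambda>x. \<phi> k x - q x)) \<longlonglongrightarrow> 0"
    using p unfolding has_trace_def by blast
  have v_H: "v \<in> H_div \<Omega>" and vn: "sq_integrable (surface \<Omega>) vn"
    and green: "\<And>\<phi>. smooth \<phi> \<Longrightarrow> L2_inner (lebesgue_on \<Omega>) v (gradient \<phi>) + L2_inner (lebesgue_on \<Omega>) (weak_div \<Omega> v) \<phi>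
        = L2_inner (surface \<Omega>) vn \<phi>"
    using v unfolding has_normal_trace_def by blast+
  have lim_p: "(\<lambda>k. L2_norm (lebesgue_on \<Omega>) (\<lambda>x. \<phi> k x - p x)) \<longlonglongrightarrow> 0"
    by (rule tendsto_sandwich[OF _ _ tendsto_const lim])
      (auto simp: L2_norm_nonneg intro!: always_eventually gradient_diff_le_sobolev_norm(2)[OF \<Omega> sm p1])
  have lim_g: "(\<lambda>k. L2_norm (lebesgue_on \<Omega>) (\<lambda>x. gradient (\<phi> k) x - weak_grad \<Omega> p x)) \<longlonglongrightarrow> 0"
    by (rule tendsto_sandwich[OF _ _ tendsto_const tendsto_mult_right_zero[OF lim, of "sqrt (real CARD('n))"]])
      (auto simp: L2_norm_nonneg intro!: always_eventually gradient_diff_le_sobolev_norm(1)[OF \<Omega> sm p1])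
  have "(\<lambda>k. L2_inner (lebesgue_on \<Omega>) v (gradient (\<phi> k)) + L2_inner (lebesgue_on \<Omega>) (weak_div \<Omega> v) (\<phi> k))
      \<longlonglongrightarrow> L2_inner (lebesgue_on \<Omega>) v (weak_grad \<Omega> p) + L2_inner (lebesgue_on \<Omega>) (weak_div \<Omega> v) p"
    by (intro tendsto_add L2_inner_tendsto lim_p lim_g H_div_sq_integrable[OF v_H] weak_grad_sq_integrable[OF p1]
        smooth_sq_integrable_bounded[OF \<Omega>] smooth_gradient_continuous smooth_continuous sm)
  moreover have "(\<lambda>k. L2_inner (surface \<Omega>) vn (\<phi> k)) \<longlonglongrightarrow> L2_inner (surface \<Omega>) vn q"
    by (intro L2_inner_tendsto vn surf q lim_surf)
  ultimately show ?thesis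
    unfolding green[OF sm] by (rule LIMSEQ_unique)
qed

section \<open>The active domain\<close>

lemma active_domain_open: "open (active_domain \<Omega> D)"
  by (simp add: active_domain_def)

lemma subset_active_domain:
  assumes "open \<Omega>" "\<Omega> \<subseteq> background D" "conforming_mesh (background D) (bg_mesh D)"
  shows "\<Omega> \<subseteq> active_domain \<Omega> D"
proof -
  have "\<Omega> \<subseteq> \<Union>(active_mesh \<Omega> D)"
  proof
    fix x assume x: "x \<in> \<Omega>"
    then have "x \<in> \<Union>(bg_mesh D)"
      using assms(2,3) closure_subset by (fastforce simp: conforming_mesh_def)
    with x show "x \<in> \<Union>(active_mesh \<Omega> D)" by (auto simp: active_mesh_def)
  qed
  also have "\<dots> \<subseteq> closure (\<Union>(active_mesh \<Omega> D))" by (rule closure_subset)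
  finally show ?thesis
    unfolding active_domain_def using assms(1) by (rule interior_maximal)
qed

text \<open>A cell that meets \<open>\<Omega>\<close> stays within one mesh size of it.\<close>

lemma active_domain_width:
  assumes mesh: "conforming_mesh (background D) (bg_mesh D)" and h: "mesh_size D \<le> h"
    and R: "\<And>x. x \<in> \<Omega> \<Longrightarrow> norm x \<le> R" and x: "x \<in> active_domain \<Omega> D" and y: "y \<in> active_domain \<Omega> D"
  shows "dist x y < 2 * R + 2 * h + 1"
proof -
  have fin: "finite (bg_mesh D)" and poly: "\<And>T. T \<in> bg_mesh D \<Longrightarrow> polytope T"
    using mesh by (auto simp: conforming_mesh_def)
  have "finite (active_mesh \<Omega> D)" using fin by (simp add: active_mesh_def)
  then have "closed (\<Union>(active_mesh \<Omega> D))"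
    using poly by (intro closed_Union) (auto simp: active_mesh_def polytope_imp_closed)
  then have sub: "active_domain \<Omega> D \<subseteq> \<Union>(active_mesh \<Omega> D)"
    unfolding active_domain_def by (simp add: interior_subset)
  have near: "\<exists>z\<in>\<Omega>. dist x z \<le> h" if "x \<in> active_domain \<Omega> D" for x
  proof -
    have "x \<in> \<Union>(active_mesh \<Omega> D)" using that sub by blast
    then obtain T z where T: "T \<in> bg_mesh D" "x \<in> T" "z \<in> T" "z \<in> \<Omega>"
      by (auto simp: active_mesh_def)
    have "dist x z \<le> diameter T"
      using T polytope_imp_bounded[OF poly] by (intro diameter_bounded_bound) auto
    also have "\<dots> \<le> mesh_size D"
      unfolding mesh_size_def using fin T by (intro Max_ge) auto
    finally show ?thesis using T(4) h by (intro bexI[of _ z]) auto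
  qed
  obtain z z' where z: "z \<in> \<Omega>" "dist x z \<le> h" and z': "z' \<in> \<Omega>" "dist y z' \<le> h"
    using near[OF x] near[OF y] by blast
  have "dist z z' \<le> norm z + norm z'"
    unfolding dist_norm by (rule norm_triangle_ineq4)
  then have "dist z z' \<le> 2 * R" using R[OF z(1)] R[OF z'(1)] by simp
  moreover have "dist x y \<le> dist x z + dist z z' + dist z' y"
    using dist_triangle[of x y z] dist_triangle[of z y z'] by linarith
  ultimately show ?thesis using z z' by (simp add: dist_commute)
qed

section \<open>The discrete spaces\<close>

definition piecewise :: "('a::euclidean_space \<Rightarrow> 'b::euclidean_space) set \<Rightarrow> 'a set set \<Rightarrow> ('a \<Rightarrow> 'b) set" where
  "piecewise V \<T> = {v. \<forall>T\<in>\<T>. \<exists>w\<in>local_space V T. AE x in lebesgue_on T. v x = w x}"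

lemma piecewise_iff: "v \<in> piecewise V \<T> \<longleftrightarrow> (\<forall>T\<in>\<T>. \<exists>w\<in>V. AE x in lebesgue_on T. v x = w x)"
proof -
  have "(AE x in lebesgue_on T. v x = restrict w T x) \<longleftrightarrow> (AE x in lebesgue_on T. v x = w x)" for T w
    by (rule AE_cong) simp
  then show ?thesis by (auto simp: piecewise_def local_space_def)
qed

lemma function_subspace_piecewise:
  assumes "polynomial_space V" shows "function_subspace (piecewise V \<T>)"
  unfolding function_subspace_def
proof (intro conjI ballI allI)
  fix v w c assume v: "v \<in> piecewise V \<T>" and w: "w \<in> piecewise V \<T>"
  show "(\<lambda>x. v x + w x) \<in> piecewise V \<T>"
    unfolding piecewise_iff
  proof
    fix T assume "T \<in> \<T>"
    then obtain v' w' where v': "v' \<in> V" "AE x in lebesgue_on T. v x = v' x"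
      and w': "w' \<in> V" "AE x in lebesgue_on T. w x = w' x"
      using v w unfolding piecewise_iff by blast
    have "(\<lambda>x. v' x + w' x) \<in> V"
      using assms v' w' by (simp add: polynomial_space_def)
    moreover have "AE x in lebesgue_on T. v x + w x = v' x + w' x"
      using v'(2) w'(2) by eventually_elim simp
    ultimately show "\<exists>u\<in>V. AE x in lebesgue_on T. v x + w x = u x" by (intro bexI)
  qed
next
  fix v c assume v: "v \<in> piecewise V \<T>"
  show "(\<lambda>x. c *\<^sub>R v x) \<in> piecewise V \<T>"
    unfolding piecewise_iff
  proof
    fix T assume "T \<in> \<T>"
    then obtain v' where v': "v' \<in> V" "AE x in lebesgue_on T. v x = v' x"
      using v unfolding piecewise_iff by blast
    have "(\<lambda>x. c *\<^sub>R v' x) \<in> V"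
      using assms v' by (simp add: polynomial_space_def)
    moreover have "AE x in lebesgue_on T. c *\<^sub>R v x = c *\<^sub>R v' x"
      using v'(2) by eventually_elim simp
    ultimately show "\<exists>u\<in>V. AE x in lebesgue_on T. c *\<^sub>R v x = u x" by (intro bexI)
  qed
qed

lemma function_subspace_Int:
  "function_subspace V \<Longrightarrow> function_subspace W \<Longrightarrow> function_subspace (V \<inter> W)"
  by (simp add: function_subspace_def)

lemma function_subspace_H_div:
  assumes "open \<Omega>" shows "function_subspace (H_div \<Omega>)"
  unfolding function_subspace_def
  using has_weak_div_add[OF assms] has_weak_div_scaleR by (auto simp: H_div_def) blast+

lemma function_subspace_V_d:
  assumes "polynomial_space Pd" shows "function_subspace (V_d \<Omega> Pd D)"
proof -
  have "V_d \<Omega> Pd D = H_div (active_domain \<Omega> D) \<inter> piecewise Pd (active_mesh \<Omega> D)"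
    by (auto simp: V_d_def piecewise_def)
  then show ?thesis
    using assms by (simp add: function_subspace_Int function_subspace_H_div active_domain_open function_subspace_piecewise)
qed

lemma function_subspace_V_0:
  assumes "polynomial_space P0" shows "function_subspace (V_0 \<Omega> P0 D)"
proof -
  have "V_0 \<Omega> P0 D = {q. sq_integrable (lebesgue_on (active_domain \<Omega> D)) q} \<inter> piecewise P0 (active_mesh \<Omega> D)"
    by (auto simp: V_0_def piecewise_def)
  then show ?thesis
    using assms by (simp add: function_subspace_Int function_subspace_sq_integrable function_subspace_piecewise)
qed

lemma V_d_H_div: "v \<in> V_d \<Omega> Pd D \<Longrightarrow> v \<in> H_div (active_domain \<Omega> D)"
  by (simp add: V_d_def)

lemma V_0_sq_integrable: "q \<in> V_0 \<Omega> P0 D \<Longrightarrow> sq_integrable (lebesgue_on (active_domain \<Omega> D)) q"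
  by (simp add: V_0_def)

text \<open>
  A projection that is linear up to null sets could still distinguish functions that agree almost
  everywhere; the stability bound, applied to their difference, rules this out.
\<close>

lemma linear_projection_cong_AE:
  assumes I: "linear_projection M {q. sq_integrable M q} V I"
    and bound: "\<And>q. sq_integrable M q \<Longrightarrow> L2_norm M (\<lambda>x. q x - I q x) \<le> C * L2_norm M q"
    and meas: "\<And>q. q \<in> V \<Longrightarrow> sq_integrable M q"
    and q: "sq_integrable M q" and q': "sq_integrable M q'" and eq: "AE x in M. q x = q' x"
  shows "AE x in M. I q x = I q' x"
proof -
  have q'': "sq_integrable M (\<lambda>x. (-1) *\<^sub>R q' x)" using q' by (rule sq_integrable_scaleR)
  let ?d = "\<lambda>x. q x + (-1) *\<^sub>R q' x"
  have d: "sq_integrable M ?d" using q q'' by (rule sq_integrable_add)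
  have d0: "AE x in M. ?d x = 0" using eq by eventually_elim simp
  then have "L2_norm M ?d = 0" using L2_norm_eq_0_iff[OF d] by blast
  then have "L2_norm M (\<lambda>x. ?d x - I ?d x) \<le> 0" using bound[OF d] by simp
  then have "L2_norm M (\<lambda>x. ?d x - I ?d x) = 0" using L2_norm_nonneg by (rule antisym)
  moreover have "I ?d \<in> V" using I d unfolding linear_projection_def by blast
  then have "sq_integrable M (\<lambda>x. ?d x - I ?d x)" by (intro sq_integrable_diff d meas)
  ultimately have Id: "AE x in M. ?d x - I ?d x = 0" using L2_norm_eq_0_iff by blast
  have "AE x in M. I (\<lambda>x. u x + w x) x = I u x + I w x" if "sq_integrable M u" "sq_integrable M w" for u w
    using I that by (simp add: linear_projection_def)
  from this[OF q q''] have add: "AE x in M. I ?d x = I q x + I (\<lambda>x. (-1) *\<^sub>R q' x) x" .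
  have scale: "AE x in M. I (\<lambda>x. (-1) *\<^sub>R q' x) x = (-1) *\<^sub>R I q' x"
    using I q' unfolding linear_projection_def by blast
  show ?thesis
    using Id d0 add scale
  proof eventually_elim
    case (elim x)
    have "I ?d x = 0" using elim(1,2) by simp
    then have "I q x + (-1) *\<^sub>R I q' x = 0" using elim(3,4) by simp
    then show ?case by simp
  qed
qed

section \<open>Error estimates on one mesh\<close>

text \<open>
  The energy with weight \<open>\<tau>\<close> controls \<open>N\<^sup>2\<close> up to the factor \<open>C max 1 (1/\<tau>)\<close>, and one power of \<open>N\<close>
  cancels.
\<close>

lemma energy_bound:
  fixes A S N C K \<tau> :: real
  assumes "N\<^sup>2 \<le> C * (A + S)" and "A + \<tau> * S \<le> K * N"
    and "0 \<le> A" "0 \<le> S" "0 < \<tau>" "0 < C" "0 \<le> N" "0 \<le> K"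
  shows "N \<le> C * max 1 (1 / \<tau>) * K"
proof (cases "N = 0")
  case True
  then show ?thesis using assms by (simp add: max_def)
next
  case False
  let ?m = "max 1 (1 / \<tau>)"
  have "S = 1 / \<tau> * (\<tau> * S)" using assms by simp
  also have "\<dots> \<le> ?m * (\<tau> * S)" using assms by (intro mult_right_mono) auto
  finally have "S \<le> ?m * (\<tau> * S)" .
  moreover have "1 * A \<le> ?m * A" using assms by (intro mult_right_mono) auto
  ultimately have "A + S \<le> ?m * (A + \<tau> * S)" by (simp add: distrib_left)
  also have "\<dots> \<le> ?m * (K * N)" using assms by (intro mult_left_mono) auto
  finally have "C * (A + S) \<le> C * (?m * (K * N))" using assms by (intro mult_left_mono) auto
  then have "N * N \<le> (C * ?m * K) * N" using assms(1) by (simp add: power2_eq_square mult.assoc)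
  then show ?thesis using False assms by (simp add: mult_le_cancel_right)
qed

text \<open>
  What the analysis uses of a single mesh of the family, with the constants of the family as
  parameters.
\<close>

locale cut_discretisation =
  fixes \<Omega> :: "(real^'n::finite) set" and D :: "'n discretisation"
    and Pd :: "(real^'n \<Rightarrow> real^'n) set" and P0 :: "(real^'n \<Rightarrow> real) set"
    and Cd C0 Nd N0 L :: real
  assumes open_dom: "open \<Omega>" and bounded_dom: "bounded \<Omega>" and active: "\<Omega> \<subseteq> active_domain \<Omega> D"
    and polynomials_d: "polynomial_space Pd" and polynomials_0: "polynomial_space P0"
    and div_V_d: "\<And>v. v \<in> V_d \<Omega> Pd D \<Longrightarrow> weak_div (active_domain \<Omega> D) v \<in> V_0 \<Omega> P0 D"
    and interp_d: "linear_projection (lebesgue_on (active_domain \<Omega> D)) (H_div (active_domain \<Omega> D))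
        (V_d \<Omega> Pd D) (interp_d D)"
    and interp_0: "linear_projection (lebesgue_on (active_domain \<Omega> D))
        {q. sq_integrable (lebesgue_on (active_domain \<Omega> D)) q} (V_0 \<Omega> P0 D) (interp_0 D)"
    and commute: "\<And>u. u \<in> H_div (active_domain \<Omega> D) \<Longrightarrow> AE x in lebesgue_on (active_domain \<Omega> D).
        weak_div (active_domain \<Omega> D) (interp_d D u) x = interp_0 D (weak_div (active_domain \<Omega> D) u) x"
    and interp_d_bound: "\<And>u. u \<in> H_div (active_domain \<Omega> D) \<Longrightarrow>
        L2_norm (lebesgue_on (active_domain \<Omega> D)) (\<lambda>x. u x - interp_d D u x)
        \<le> Cd * L2_norm (lebesgue_on (active_domain \<Omega> D)) u"
    and interp_0_bound: "\<And>q. sq_integrable (lebesgue_on (active_domain \<Omega> D)) q \<Longrightarrow>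
        L2_norm (lebesgue_on (active_domain \<Omega> D)) (\<lambda>x. q x - interp_0 D q x)
        \<le> C0 * L2_norm (lebesgue_on (active_domain \<Omega> D)) q"
    and form_d: "sym_psd_form (V_d \<Omega> Pd D) (stab_d D)" and form_0: "sym_psd_form (V_0 \<Omega> P0 D) (stab_0 D)"
    and upper_d: "\<And>v. v \<in> V_d \<Omega> Pd D \<Longrightarrow> (L2_norm (lebesgue_on \<Omega>) v)\<^sup>2 + stab_d D v v
        \<le> Nd * (L2_norm (lebesgue_on (active_domain \<Omega> D)) v)\<^sup>2"
    and lower_d: "\<And>v. v \<in> V_d \<Omega> Pd D \<Longrightarrow> (L2_norm (lebesgue_on (active_domain \<Omega> D)) v)\<^sup>2
        \<le> Nd * ((L2_norm (lebesgue_on \<Omega>) v)\<^sup>2 + stab_d D v v)"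
    and upper_0: "\<And>q. q \<in> V_0 \<Omega> P0 D \<Longrightarrow> (L2_norm (lebesgue_on \<Omega>) q)\<^sup>2 + stab_0 D q q
        \<le> N0 * (L2_norm (lebesgue_on (active_domain \<Omega> D)) q)\<^sup>2"
    and lower_0: "\<And>q. q \<in> V_0 \<Omega> P0 D \<Longrightarrow> (L2_norm (lebesgue_on (active_domain \<Omega> D)) q)\<^sup>2
        \<le> N0 * ((L2_norm (lebesgue_on \<Omega>) q)\<^sup>2 + stab_0 D q q)"
    and pos: "0 < Cd" "0 < Nd" "0 < N0" "0 < L"
    and width: "\<And>x y. x \<in> active_domain \<Omega> D \<Longrightarrow> y \<in> active_domain \<Omega> D \<Longrightarrow> dist x y < L"
begin

abbreviation "\<Omega>h \<equiv> active_domain \<Omega> D"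
abbreviation "norm_h v \<equiv> L2_norm (lebesgue_on \<Omega>h) v"
abbreviation "norm_dom v \<equiv> L2_norm (lebesgue_on \<Omega>) v"
abbreviation "div_h \<equiv> weak_div \<Omega>h"
abbreviation "inner_dom v w \<equiv> L2_inner (lebesgue_on \<Omega>) v w"

lemma \<Omega>h_open: "open \<Omega>h"
  by (rule active_domain_open)

lemma lebesgue_sets: "\<Omega> \<in> sets lebesgue" "\<Omega>h \<in> sets lebesgue"
  using open_dom \<Omega>h_open by auto

lemma sq_dom: "sq_integrable (lebesgue_on \<Omega>h) v \<Longrightarrow> sq_integrable (lebesgue_on \<Omega>) v"
  and norm_dom_le: "sq_integrable (lebesgue_on \<Omega>h) v \<Longrightarrow> norm_dom v \<le> norm_h v"
  using sq_integrable_lebesgue_on_subset[OF _ active lebesgue_sets] by blast+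

lemma AE_dom: "AE x in lebesgue_on \<Omega>h. P x \<Longrightarrow> AE x in lebesgue_on \<Omega>. P x"
  using AE_lebesgue_on_subset[OF _ active lebesgue_sets] .

lemma sub_d: "function_subspace (V_d \<Omega> Pd D)" and sub_0: "function_subspace (V_0 \<Omega> P0 D)"
  by (rule function_subspace_V_d[OF polynomials_d], rule function_subspace_V_0[OF polynomials_0])

lemma V_d_sq: "v \<in> V_d \<Omega> Pd D \<Longrightarrow> sq_integrable (lebesgue_on \<Omega>h) v"
  using H_div_sq_integrable(1) V_d_H_div by blast

lemma interp_d_in: "u \<in> H_div \<Omega>h \<Longrightarrow> interp_d D u \<in> V_d \<Omega> Pd D"
  using interp_d by (simp add: linear_projection_def)

lemma interp_0_in: "sq_integrable (lebesgue_on \<Omega>h) q \<Longrightarrow> interp_0 D q \<in> V_0 \<Omega> P0 D"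
  using interp_0 by (simp add: linear_projection_def)

lemma interp_0_cong:
  assumes "sq_integrable (lebesgue_on \<Omega>h) q" "sq_integrable (lebesgue_on \<Omega>h) q'" "AE x in lebesgue_on \<Omega>h. q x = q' x"
  shows "AE x in lebesgue_on \<Omega>h. interp_0 D q x = interp_0 D q' x"
  using linear_projection_cong_AE[OF interp_0 interp_0_bound V_0_sq_integrable assms] .

text \<open>The exact lifting of \<open>e\<close> is made discrete by the interpolator, which commutes with the divergence.\<close>

lemma discrete_divergence_lifting:
  assumes e: "e \<in> V_0 \<Omega> P0 D"
  obtains z where "z \<in> V_d \<Omega> Pd D" "AE x in lebesgue_on \<Omega>h. div_h z x = e x"
    "norm_h z \<le> (1 + Cd) * L * norm_h e"
proof -
  have e_sq: "sq_integrable (lebesgue_on \<Omega>h) e" using e by (rule V_0_sq_integrable)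
  obtain w where w: "has_weak_div \<Omega>h w e" "norm_h w \<le> L * norm_h e"
    using weak_div_right_inverse[OF \<Omega>h_open e_sq pos(4) width] by blast
  have wH: "w \<in> H_div \<Omega>h" using w(1) by (rule has_weak_div_H_div)
  let ?z = "interp_d D w"
  have zV: "?z \<in> V_d \<Omega> Pd D" using wH by (rule interp_d_in)
  have "AE x in lebesgue_on \<Omega>h. div_h ?z x = e x"
  proof -
    have 1: "AE x in lebesgue_on \<Omega>h. div_h ?z x = interp_0 D (div_h w) x" using wH by (rule commute)
    have 2: "AE x in lebesgue_on \<Omega>h. interp_0 D (div_h w) x = interp_0 D e x"
      by (rule interp_0_cong[OF H_div_sq_integrable(2)[OF wH] e_sq weak_div_AE_eq[OF \<Omega>h_open w(1)]])
    have 3: "AE x in lebesgue_on \<Omega>h. interp_0 D e x = e x"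
      using interp_0 e by (simp add: linear_projection_def)
    show ?thesis using 1 2 3 by eventually_elim simp
  qed
  moreover have "norm_h ?z \<le> (1 + Cd) * L * norm_h e"
  proof -
    have w_sq: "sq_integrable (lebesgue_on \<Omega>h) w" using wH by (rule H_div_sq_integrable)
    have "norm_h ?z = norm_h (\<lambda>x. w x - (w x - ?z x))" by simp
    also have "\<dots> \<le> norm_h w + norm_h (\<lambda>x. w x - ?z x)"
      by (intro L2_norm_triangle_diff w_sq sq_integrable_diff V_d_sq zV)
    also have "\<dots> \<le> (1 + Cd) * norm_h w"
      using interp_d_bound[OF wH] by (simp add: algebra_simps)
    also have "\<dots> \<le> (1 + Cd) * (L * norm_h e)"
      using w(2) pos(1) by (intro mult_left_mono) auto
    finally show ?thesis by (simp add: mult.assoc)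
  qed
  ultimately show ?thesis using zV that by blast
qed

lemma stab_d_bounded:
  assumes v: "v \<in> V_d \<Omega> Pd D" and w: "w \<in> V_d \<Omega> Pd D"
  shows "\<bar>stab_d D v w\<bar> \<le> Nd * norm_h v * norm_h w"
proof -
  have root: "sqrt (stab_d D u u) \<le> sqrt Nd * norm_h u" if "u \<in> V_d \<Omega> Pd D" for u
  proof -
    have "stab_d D u u \<le> Nd * (norm_h u)\<^sup>2"
      using upper_d[OF that] zero_le_power2[of "norm_dom u"] by linarith
    then have "sqrt (stab_d D u u) \<le> sqrt (Nd * (norm_h u)\<^sup>2)" by (rule real_sqrt_le_mono)
    then show ?thesis by (simp add: real_sqrt_mult L2_norm_nonneg)
  qed
  have "\<bar>stab_d D v w\<bar> \<le> sqrt (stab_d D v v) * sqrt (stab_d D w w)"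
    by (rule sym_psd_form_Cauchy_Schwarz[OF form_d sub_d v w])
  also have "\<dots> \<le> (sqrt Nd * norm_h v) * (sqrt Nd * norm_h w)"
    using sym_psd_form_nonneg[OF form_d] v w pos
    by (intro mult_mono root) (auto simp: L2_norm_nonneg)
  also have "\<dots> = Nd * norm_h v * norm_h w"
    using pos(2) by (simp add: algebra_simps flip: real_sqrt_mult)
  finally show ?thesis .
qed

text \<open>By the norm equivalence the form vanishes on the diagonal at a null function, and then everywhere by
  the Cauchy-Schwarz inequality.\<close>

lemma stab_0_null:
  assumes q: "q \<in> V_0 \<Omega> P0 D" and q': "q' \<in> V_0 \<Omega> P0 D" and null: "AE x in lebesgue_on \<Omega>h. q x = 0"
  shows "stab_0 D q q' = 0"
proof -
  have "norm_h q = 0" using null L2_norm_eq_0_iff[OF V_0_sq_integrable[OF q]] by blast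
  then have "(norm_dom q)\<^sup>2 + stab_0 D q q \<le> 0" using upper_0[OF q] by simp
  then have "stab_0 D q q \<le> 0" using zero_le_power2[of "norm_dom q"] by linarith
  then have "stab_0 D q q = 0" using sym_psd_form_nonneg[OF form_0 q] by simp
  then show ?thesis by (rule sym_psd_form_null[OF form_0 sub_0 q q'])
qed

text \<open>
  The second discrete equation, tested with the error itself: no pressure enters, so that the
  divergence is controlled independently of the flux.
\<close>

lemma divergence_error:
  assumes uh: "uh \<in> V_d \<Omega> Pd D" and r: "sq_integrable (lebesgue_on \<Omega>h) r" and \<tau>: "0 < \<tau>"
    and eq: "\<And>q. q \<in> V_0 \<Omega> P0 D \<Longrightarrow> b_h \<Omega> \<tau> D uh q = - inner_dom r q"
    and \<sigma>: "0 \<le> \<sigma>" "\<And>q. q \<in> V_0 \<Omega> P0 D \<Longrightarrow> stab_0 D (interp_0 D r) q \<le> \<sigma> * norm_h q"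
  shows "norm_h (\<lambda>x. div_h uh x - interp_0 D r x)
    \<le> N0 * max 1 (1 / \<tau>) * (norm_h (\<lambda>x. r x - interp_0 D r x) + \<tau> * \<sigma>)"
proof -
  let ?e = "\<lambda>x. div_h uh x - interp_0 D r x" and ?\<Pi> = "interp_0 D r"
  have \<Pi>: "?\<Pi> \<in> V_0 \<Omega> P0 D" using r by (rule interp_0_in)
  have du: "div_h uh \<in> V_0 \<Omega> P0 D" using uh by (rule div_V_d)
  have e: "?e \<in> V_0 \<Omega> P0 D" using sub_0 du \<Pi> by (rule function_subspaceD(3))
  note sq = V_0_sq_integrable[OF du] V_0_sq_integrable[OF \<Pi>] V_0_sq_integrable[OF e]
  have diff_sq: "sq_integrable (lebesgue_on \<Omega>h) (\<lambda>x. r x - ?\<Pi> x)" using r sq(2) by (rule sq_integrable_diff)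
  have neg: "(\<lambda>x. (-1) *\<^sub>R ?e x) \<in> V_0 \<Omega> P0 D" using sub_0 e e by (rule function_subspaceD(2))
  \<comment> \<open>The consistency bound is one-sided; tested with \<open>-e\<close> it bounds the form from below.\<close>
  have "- stab_0 D ?\<Pi> ?e = stab_0 D ?\<Pi> (\<lambda>x. (-1) *\<^sub>R ?e x)"
    using sym_psd_form_scale[OF form_0 e \<Pi>, of "-1"] sym_psd_form_sym[OF form_0 \<Pi> e] sym_psd_form_sym[OF form_0 \<Pi> neg]
    by simp
  also have "\<dots> \<le> \<sigma> * norm_h (\<lambda>x. (-1) *\<^sub>R ?e x)" using neg by (rule \<sigma>(2))
  also have "norm_h (\<lambda>x. (-1) *\<^sub>R ?e x) = norm_h ?e" using L2_norm_minus[of _ ?e] by simp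
  finally have stab: "- stab_0 D ?\<Pi> ?e \<le> \<sigma> * norm_h ?e" .
  have "inner_dom (div_h uh) ?e + \<tau> * stab_0 D (div_h uh) ?e = inner_dom r ?e"
    using eq[OF e] by (simp add: b_h_def)
  then have eq_e: "inner_dom r ?e = inner_dom (div_h uh) ?e + \<tau> * stab_0 D (div_h uh) ?e" by simp
  have in_e: "inner_dom ?e ?e = inner_dom (div_h uh) ?e - inner_dom ?\<Pi> ?e"
    by (intro L2_inner_diff_left sq_dom sq)
  have st_e: "stab_0 D ?e ?e = stab_0 D (div_h uh) ?e - stab_0 D ?\<Pi> ?e"
    by (rule sym_psd_form_diff[OF form_0 sub_0 du \<Pi> e])
  have in_r: "inner_dom (\<lambda>x. r x - ?\<Pi> x) ?e = inner_dom r ?e - inner_dom ?\<Pi> ?e"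
    by (intro L2_inner_diff_left sq_dom r sq)
  have "inner_dom ?e ?e + \<tau> * stab_0 D ?e ?e = inner_dom (\<lambda>x. r x - ?\<Pi> x) ?e + \<tau> * (- stab_0 D ?\<Pi> ?e)"
    unfolding in_e st_e in_r eq_e by (simp add: algebra_simps)
  also have "\<dots> \<le> norm_h (\<lambda>x. r x - ?\<Pi> x) * norm_h ?e + \<tau> * (\<sigma> * norm_h ?e)"
  proof (rule add_mono)
    have "inner_dom (\<lambda>x. r x - ?\<Pi> x) ?e \<le> norm_dom (\<lambda>x. r x - ?\<Pi> x) * norm_dom ?e"
      using L2_Cauchy_Schwarz[OF sq_dom[OF diff_sq] sq_dom[OF sq(3)]] by simp
    also have "\<dots> \<le> norm_h (\<lambda>x. r x - ?\<Pi> x) * norm_h ?e"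
      by (intro mult_mono norm_dom_le diff_sq sq L2_norm_nonneg)
    finally show "inner_dom (\<lambda>x. r x - ?\<Pi> x) ?e \<le> norm_h (\<lambda>x. r x - ?\<Pi> x) * norm_h ?e" .
    show "\<tau> * (- stab_0 D ?\<Pi> ?e) \<le> \<tau> * (\<sigma> * norm_h ?e)" using stab \<tau> by (intro mult_left_mono) auto
  qed
  finally have "(norm_dom ?e)\<^sup>2 + \<tau> * stab_0 D ?e ?e \<le> (norm_h (\<lambda>x. r x - ?\<Pi> x) + \<tau> * \<sigma>) * norm_h ?e"
    by (simp add: L2_norm_square algebra_simps)
  then show ?thesis
    using \<tau> \<sigma>(1) pos(3) sym_psd_form_nonneg[OF form_0 e]
    by (intro energy_bound[OF lower_0[OF e]]) (auto simp: L2_norm_nonneg)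
qed

text \<open>
  For divergence-free test functions the discrete pressure drops out of the first discrete equation,
  stabilisation included, and the exact pressure by Green's formula.
\<close>

lemma divergence_free_consistency:
  assumes f: "sq_integrable (lebesgue_on \<Omega>) f"
    and darcy: "darcy_solution \<Omega> f g p\<^sub>\<Gamma> u p"
    and discrete: "discrete_solution \<Omega> Pd P0 \<tau>d \<tau>0 D f g p\<^sub>\<Gamma> uh ph"
    and v: "v \<in> V_d \<Omega> Pd D" and div0: "AE x in lebesgue_on \<Omega>h. div_h v x = 0"
  shows "a_h \<Omega> \<tau>d D uh v = inner_dom u v"
proof -
  have uH: "u \<in> H_div \<Omega>" and p1: "p \<in> sobolev \<Omega> 1" and law: "AE x in lebesgue_on \<Omega>. u x + weak_grad \<Omega> p x = f x"
    and trace: "has_trace \<Omega> p p\<^sub>\<Gamma>"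
    using darcy by (auto simp: darcy_solution_def)
  have ph: "ph \<in> V_0 \<Omega> P0 D" using discrete by (simp add: discrete_solution_def)
  obtain vn where vn: "has_normal_trace \<Omega> v vn"
    and eq: "a_h \<Omega> \<tau>d D uh v + b_h \<Omega> \<tau>0 D v ph = inner_dom f v - L2_inner (surface \<Omega>) vn p\<^sub>\<Gamma>"
    using discrete v unfolding discrete_solution_def by blast
  have vH: "v \<in> H_div \<Omega>h" using v by (rule V_d_H_div)
  note v_sq = sq_dom[OF V_d_sq[OF v]]
  note grad = weak_grad_sq_integrable[OF p1]
  have zero: "inner_dom q w = 0" if "AE x in lebesgue_on \<Omega>. q x = 0" for q w :: "real^'n \<Rightarrow> real"
    unfolding L2_inner_def by (rule integral_eq_zero_AE) (use that in eventually_elim, simp)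
  have "AE x in lebesgue_on \<Omega>. weak_div \<Omega> v x = 0"
    using weak_div_subset_AE_eq(2)[OF vH active open_dom \<Omega>h_open] AE_dom[OF div0] by eventually_elim simp
  then have "inner_dom (weak_div \<Omega> v) p = 0" by (rule zero)
  with Green_formula[OF open_dom bounded_dom vn trace]
  have "inner_dom v (weak_grad \<Omega> p) = L2_inner (surface \<Omega>) vn p\<^sub>\<Gamma>" by simp
  moreover have "inner_dom f v = inner_dom (\<lambda>x. u x + weak_grad \<Omega> p x) v"
  proof (rule L2_inner_cong_AE)
    show "AE x in lebesgue_on \<Omega>. f x = u x + weak_grad \<Omega> p x" using law by eventually_elim simp
  qed (use f v_sq sq_integrable_add[OF H_div_sq_integrable(1)[OF uH] grad(2)] in \<open>auto simp: sq_integrable_borel\<close>)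
  moreover have "\<dots> = inner_dom u v + inner_dom (weak_grad \<Omega> p) v"
    by (intro L2_inner_add_left H_div_sq_integrable[OF uH] grad v_sq)
  moreover have "b_h \<Omega> \<tau>0 D v ph = 0"
    using zero[OF AE_dom[OF div0]] stab_0_null[OF div_V_d[OF v] ph div0] by (simp add: b_h_def)
  ultimately show ?thesis using eq by (simp add: L2_inner_commute)
qed

text \<open>
  The difference of \<open>u\<^sub>h\<close> and the interpolant is not divergence-free; subtracting the lifting \<open>z\<close> of its
  divergence makes it an admissible test function.
\<close>

lemma flux_error:
  assumes uh: "uh \<in> V_d \<Omega> Pd D" and u: "u \<in> H_div \<Omega>h" and z: "z \<in> V_d \<Omega> Pd D" and \<tau>: "0 < \<tau>"
    and div_z: "AE x in lebesgue_on \<Omega>h. div_h z x = div_h uh x - interp_0 D (div_h u) x"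
    and eq: "\<And>v. v \<in> V_d \<Omega> Pd D \<Longrightarrow> (AE x in lebesgue_on \<Omega>h. div_h v x = 0) \<Longrightarrow> a_h \<Omega> \<tau> D uh v = inner_dom u v"
    and \<sigma>: "0 \<le> \<sigma>" "\<And>v. v \<in> V_d \<Omega> Pd D \<Longrightarrow> stab_d D (interp_d D u) v \<le> \<sigma> * norm_h v"
  shows "norm_h (\<lambda>x. uh x - interp_d D u x - z x)
    \<le> Nd * max 1 (1 / \<tau>) * (norm_h (\<lambda>x. u x - interp_d D u x) + norm_h z + \<tau> * \<sigma> + \<tau> * Nd * norm_h z)"
proof -
  let ?\<Pi> = "interp_d D u"
  let ?d = "\<lambda>x. uh x - ?\<Pi> x"
  let ?v = "\<lambda>x. ?d x - z x"
  have \<Pi>: "?\<Pi> \<in> V_d \<Omega> Pd D" using u by (rule interp_d_in)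
  have d: "?d \<in> V_d \<Omega> Pd D" using sub_d uh \<Pi> by (rule function_subspaceD(3))
  have v: "?v \<in> V_d \<Omega> Pd D" using sub_d d z by (rule function_subspaceD(3))
  note H = V_d_H_div[OF uh] V_d_H_div[OF \<Pi>] V_d_H_div[OF d] V_d_H_div[OF z]
  note sq = V_d_sq[OF uh] V_d_sq[OF \<Pi>] V_d_sq[OF d] V_d_sq[OF z] V_d_sq[OF v]
  have u_sq: "sq_integrable (lebesgue_on \<Omega>h) u" using u by (rule H_div_sq_integrable)
  have diff_sq: "sq_integrable (lebesgue_on \<Omega>h) (\<lambda>x. u x - ?\<Pi> x)" using u_sq sq(2) by (rule sq_integrable_diff)
  have "AE x in lebesgue_on \<Omega>h. div_h ?v x = 0"
    using weak_div_diff_AE[OF \<Omega>h_open H(3,4)] weak_div_diff_AE[OF \<Omega>h_open H(1,2)] commute[OF u] div_z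
    by eventually_elim simp
  then have eq_v: "inner_dom uh ?v + \<tau> * stab_d D uh ?v = inner_dom u ?v"
    using eq[OF v] by (simp add: a_h_def)
  have neg: "(\<lambda>x. (-1) *\<^sub>R ?v x) \<in> V_d \<Omega> Pd D" using sub_d v v by (rule function_subspaceD(2))
  \<comment> \<open>As for the divergence, the one-sided consistency bound is tested with \<open>-v\<close>.\<close>
  have "- stab_d D ?\<Pi> ?v = stab_d D ?\<Pi> (\<lambda>x. (-1) *\<^sub>R ?v x)"
    using sym_psd_form_scale[OF form_d v \<Pi>, of "-1"] sym_psd_form_sym[OF form_d \<Pi> v] sym_psd_form_sym[OF form_d \<Pi> neg]
    by simp
  also have "\<dots> \<le> \<sigma> * norm_h (\<lambda>x. (-1) *\<^sub>R ?v x)" using neg by (rule \<sigma>(2))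
  also have "norm_h (\<lambda>x. (-1) *\<^sub>R ?v x) = norm_h ?v"
    by (simp only: scaleR_minus_left scaleR_one L2_norm_minus)
  finally have stab: "- stab_d D ?\<Pi> ?v \<le> \<sigma> * norm_h ?v" .
  have in_d: "inner_dom ?d ?v = inner_dom uh ?v - inner_dom ?\<Pi> ?v"
    by (intro L2_inner_diff_left sq_dom sq)
  have in_v: "inner_dom ?v ?v = inner_dom ?d ?v - inner_dom z ?v"
    by (intro L2_inner_diff_left sq_dom sq)
  have st_d: "stab_d D ?d ?v = stab_d D uh ?v - stab_d D ?\<Pi> ?v"
    by (rule sym_psd_form_diff[OF form_d sub_d uh \<Pi> v])
  have st_v: "stab_d D ?v ?v = stab_d D ?d ?v - stab_d D z ?v"
    by (rule sym_psd_form_diff[OF form_d sub_d d z v])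
  have in_u: "inner_dom (\<lambda>x. u x - ?\<Pi> x) ?v = inner_dom u ?v - inner_dom ?\<Pi> ?v"
    by (intro L2_inner_diff_left sq_dom u_sq sq)
  have "inner_dom ?v ?v + \<tau> * stab_d D ?v ?v
      = inner_dom (\<lambda>x. u x - ?\<Pi> x) ?v + (- inner_dom z ?v) + \<tau> * (- stab_d D ?\<Pi> ?v) + \<tau> * (- stab_d D z ?v)"
    unfolding in_v st_v in_d st_d in_u eq_v[symmetric] by (simp add: algebra_simps)
  also have "\<dots> \<le> norm_h (\<lambda>x. u x - ?\<Pi> x) * norm_h ?v + norm_h z * norm_h ?v
      + \<tau> * (\<sigma> * norm_h ?v) + \<tau> * (Nd * norm_h z * norm_h ?v)"
  proof (intro add_mono)
    have CS: "\<bar>inner_dom w ?v\<bar> \<le> norm_h w * norm_h ?v" if "sq_integrable (lebesgue_on \<Omega>h) w" for w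
    proof -
      have "\<bar>inner_dom w ?v\<bar> \<le> norm_dom w * norm_dom ?v"
        by (rule L2_Cauchy_Schwarz[OF sq_dom[OF that] sq_dom[OF sq(5)]])
      also have "\<dots> \<le> norm_h w * norm_h ?v"
        by (intro mult_mono norm_dom_le that sq L2_norm_nonneg)
      finally show ?thesis .
    qed
    show "inner_dom (\<lambda>x. u x - ?\<Pi> x) ?v \<le> norm_h (\<lambda>x. u x - ?\<Pi> x) * norm_h ?v"
      using CS[OF diff_sq] by (rule order_trans[OF abs_ge_self])
    show "- inner_dom z ?v \<le> norm_h z * norm_h ?v"
      using CS[OF sq(4)] by (rule order_trans[OF abs_ge_minus_self])
    show "\<tau> * (- stab_d D ?\<Pi> ?v) \<le> \<tau> * (\<sigma> * norm_h ?v)" using stab \<tau> by (intro mult_left_mono) auto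
    have "- stab_d D z ?v \<le> Nd * norm_h z * norm_h ?v"
      using stab_d_bounded[OF z v] by (rule order_trans[OF abs_ge_minus_self])
    then show "\<tau> * (- stab_d D z ?v) \<le> \<tau> * (Nd * norm_h z * norm_h ?v)" using \<tau> by (intro mult_left_mono) auto
  qed
  finally have "(norm_dom ?v)\<^sup>2 + \<tau> * stab_d D ?v ?v
      \<le> (norm_h (\<lambda>x. u x - ?\<Pi> x) + norm_h z + \<tau> * \<sigma> + \<tau> * Nd * norm_h z) * norm_h ?v"
    unfolding L2_norm_square by (simp only: distrib_right mult.assoc)
  then show ?thesis
    using \<tau> \<sigma>(1) pos(2) sym_psd_form_nonneg[OF form_d v]
    by (intro energy_bound[OF lower_d[OF v]]) (auto simp: L2_norm_nonneg intro!: add_nonneg_nonneg mult_nonneg_nonneg)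
qed

text \<open>
  The equations hold on \<open>\<Omega>\<close>, but the discrete spaces live on the active domain, so that the exact flux
  enters through an extension \<open>U\<close> with divergence \<open>r\<close>. The error splits as
  \<open>u - u\<^sub>h = (U - \<Pi> U) - z - v\<close> with the lifting \<open>z\<close> and the divergence-free part \<open>v\<close>; here \<open>\<kappa>\<close> bounds
  the discrete divergence error and \<open>\<zeta>\<close> its lifting.
\<close>

lemma total_error:
  assumes f: "sq_integrable (lebesgue_on \<Omega>) f" and g: "sq_integrable (lebesgue_on \<Omega>) g"
    and \<tau>d: "0 < \<tau>d" and \<tau>0: "0 < \<tau>0"
    and darcy: "darcy_solution \<Omega> f g p\<^sub>\<Gamma> u p"
    and discrete: "discrete_solution \<Omega> Pd P0 \<tau>d \<tau>0 D f g p\<^sub>\<Gamma> uh ph"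
    and U: "U \<in> H_div \<Omega>h" and extends: "AE x in lebesgue_on \<Omega>. U x = u x"
    and r: "sq_integrable (lebesgue_on \<Omega>h) r" and div_U: "AE x in lebesgue_on \<Omega>h. div_h U x = r x"
    and \<eta>: "norm_h (\<lambda>x. U x - interp_d D U x) \<le> \<eta>" and \<rho>: "norm_h (\<lambda>x. r x - interp_0 D r x) \<le> \<rho>"
    and \<sigma>d: "0 \<le> \<sigma>d" "\<And>v. v \<in> V_d \<Omega> Pd D \<Longrightarrow> stab_d D (interp_d D U) v \<le> \<sigma>d * norm_h v"
    and \<sigma>0: "0 \<le> \<sigma>0" "\<And>q. q \<in> V_0 \<Omega> P0 D \<Longrightarrow> stab_0 D (interp_0 D r) q \<le> \<sigma>0 * norm_h q"
    and \<kappa>: "\<kappa> = N0 * max 1 (1 / \<tau>0) * (\<rho> + \<tau>0 * \<sigma>0)" and \<zeta>: "\<zeta> = (1 + Cd) * L * \<kappa>"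
  shows "norm_dom (\<lambda>x. u x - uh x) \<le> \<eta> + \<zeta> + Nd * max 1 (1 / \<tau>d) * (\<eta> + \<zeta> + \<tau>d * \<sigma>d + \<tau>d * Nd * \<zeta>)"
    and "norm_dom (\<lambda>x. weak_div \<Omega> u x - div_h uh x) \<le> \<rho> + \<kappa>"
proof -
  have uH: "u \<in> H_div \<Omega>" and mass: "AE x in lebesgue_on \<Omega>. weak_div \<Omega> u x = - g x"
    using darcy by (auto simp: darcy_solution_def)
  have uh: "uh \<in> V_d \<Omega> Pd D" and eq_h: "\<And>q. q \<in> V_0 \<Omega> P0 D \<Longrightarrow> b_h \<Omega> \<tau>0 D uh q = inner_dom g q"
    using discrete by (auto simp: discrete_solution_def)
  note u_sq = H_div_sq_integrable[OF uH]
  note U_sq = H_div_sq_integrable[OF U]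
  have div_u: "AE x in lebesgue_on \<Omega>. weak_div \<Omega> u x = r x"
  proof -
    have "has_weak_div \<Omega> u (div_h U)"
      by (rule has_weak_div_cong_AE[OF open_dom has_weak_div_subset[OF weak_div_has_weak_div[OF U] active open_dom \<Omega>h_open]
            extends u_sq(1)])
    from weak_div_AE_eq[OF open_dom this] AE_dom[OF div_U] show ?thesis by eventually_elim simp
  qed
  let ?\<Pi> = "interp_d D U" and ?P = "interp_0 D r"
  let ?e = "\<lambda>x. div_h uh x - ?P x"
  have \<Pi>: "?\<Pi> \<in> V_d \<Omega> Pd D" using U by (rule interp_d_in)
  have P: "?P \<in> V_0 \<Omega> P0 D" using r by (rule interp_0_in)
  have du: "div_h uh \<in> V_0 \<Omega> P0 D" using uh by (rule div_V_d)
  have e: "?e \<in> V_0 \<Omega> P0 D" using sub_0 du P by (rule function_subspaceD(3))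
  have e_bound: "norm_h ?e \<le> \<kappa>"
  proof -
    have "b_h \<Omega> \<tau>0 D uh q = - inner_dom r q" if q: "q \<in> V_0 \<Omega> P0 D" for q
    proof -
      have "inner_dom g q = inner_dom (\<lambda>x. - r x) q"
      proof (rule L2_inner_cong_AE)
        show "AE x in lebesgue_on \<Omega>. g x = - r x" using div_u mass by eventually_elim simp
      qed (use g sq_dom[OF r] sq_dom[OF V_0_sq_integrable[OF q]] in \<open>auto simp: sq_integrable_borel\<close>)
      then show ?thesis using eq_h[OF q] by (simp add: L2_inner_minus_left)
    qed
    from divergence_error[OF uh r \<tau>0 this \<sigma>0]
    have "norm_h ?e \<le> N0 * max 1 (1 / \<tau>0) * (norm_h (\<lambda>x. r x - ?P x) + \<tau>0 * \<sigma>0)" .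
    also have "\<dots> \<le> \<kappa>"
      unfolding \<kappa> using \<rho> pos by (intro mult_left_mono add_right_mono) auto
    finally show ?thesis .
  qed
  obtain z where z: "z \<in> V_d \<Omega> Pd D" and div_z: "AE x in lebesgue_on \<Omega>h. div_h z x = ?e x"
    and z_le: "norm_h z \<le> (1 + Cd) * L * norm_h ?e"
    using e by (rule discrete_divergence_lifting)
  have z_bound: "norm_h z \<le> \<zeta>"
  proof -
    have "(1 + Cd) * L * norm_h ?e \<le> \<zeta>"
      unfolding \<zeta> using e_bound pos by (intro mult_left_mono) auto
    with z_le show ?thesis by simp
  qed
  let ?v = "\<lambda>x. uh x - ?\<Pi> x - z x"
  have v: "?v \<in> V_d \<Omega> Pd D"
    by (rule function_subspaceD(3)[OF sub_d function_subspaceD(3)[OF sub_d uh \<Pi>] z])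
  have v_bound: "norm_h ?v \<le> Nd * max 1 (1 / \<tau>d) * (\<eta> + \<zeta> + \<tau>d * \<sigma>d + \<tau>d * Nd * \<zeta>)"
  proof -
    have "norm_h ?v \<le> Nd * max 1 (1 / \<tau>d)
        * (norm_h (\<lambda>x. U x - ?\<Pi> x) + norm_h z + \<tau>d * \<sigma>d + \<tau>d * Nd * norm_h z)"
    proof (rule flux_error[OF uh U z \<tau>d _ _ \<sigma>d])
      have "AE x in lebesgue_on \<Omega>h. interp_0 D (div_h U) x = ?P x"
        by (rule interp_0_cong[OF U_sq(2) r div_U])
      with div_z show "AE x in lebesgue_on \<Omega>h. div_h z x = div_h uh x - interp_0 D (div_h U) x"
        by eventually_elim simp
      fix v assume v: "v \<in> V_d \<Omega> Pd D" and "AE x in lebesgue_on \<Omega>h. div_h v x = 0"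
      from divergence_free_consistency[OF f darcy discrete this]
      have "a_h \<Omega> \<tau>d D uh v = inner_dom u v" .
      also have "\<dots> = inner_dom U v"
      proof (rule L2_inner_cong_AE)
        show "AE x in lebesgue_on \<Omega>. u x = U x" using extends by eventually_elim simp
      qed (use u_sq(1) sq_dom[OF U_sq(1)] sq_dom[OF V_d_sq[OF v]] in \<open>auto simp: sq_integrable_borel\<close>)
      finally show "a_h \<Omega> \<tau>d D uh v = inner_dom U v" .
    qed
    also have "\<dots> \<le> Nd * max 1 (1 / \<tau>d) * (\<eta> + \<zeta> + \<tau>d * \<sigma>d + \<tau>d * Nd * \<zeta>)"
      using \<eta> z_bound pos \<tau>d by (intro mult_left_mono add_mono order_refl) auto
    finally show ?thesis .
  qed
  have diff_sq: "sq_integrable (lebesgue_on \<Omega>h) (\<lambda>x. U x - ?\<Pi> x)"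
    by (rule sq_integrable_diff[OF U_sq(1) V_d_sq[OF \<Pi>]])
  note zv_sq = V_d_sq[OF z] V_d_sq[OF v]
  have zv: "sq_integrable (lebesgue_on \<Omega>h) (\<lambda>x. z x + ?v x)" by (rule sq_integrable_add[OF zv_sq])
  have all: "sq_integrable (lebesgue_on \<Omega>h) (\<lambda>x. (U x - ?\<Pi> x) - (z x + ?v x))"
    by (rule sq_integrable_diff[OF diff_sq zv])
  have "norm_dom (\<lambda>x. u x - uh x) = norm_dom (\<lambda>x. (U x - ?\<Pi> x) - (z x + ?v x))"
  proof (rule L2_norm_cong_AE)
    show "AE x in lebesgue_on \<Omega>. u x - uh x = (U x - ?\<Pi> x) - (z x + ?v x)"
      using extends by eventually_elim simp
    show "(\<lambda>x. u x - uh x) \<in> borel_measurable (lebesgue_on \<Omega>)"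
      by (rule sq_integrable_borel[OF sq_integrable_diff[OF u_sq(1) sq_dom[OF V_d_sq[OF uh]]]])
    show "(\<lambda>x. (U x - ?\<Pi> x) - (z x + ?v x)) \<in> borel_measurable (lebesgue_on \<Omega>)"
      by (rule sq_integrable_borel[OF sq_dom[OF all]])
  qed
  also have "\<dots> \<le> norm_h (\<lambda>x. (U x - ?\<Pi> x) - (z x + ?v x))" by (rule norm_dom_le[OF all])
  also have "\<dots> \<le> norm_h (\<lambda>x. U x - ?\<Pi> x) + norm_h (\<lambda>x. z x + ?v x)"
    by (rule L2_norm_triangle_diff[OF diff_sq zv])
  also have "\<dots> \<le> norm_h (\<lambda>x. U x - ?\<Pi> x) + (norm_h z + norm_h ?v)"
    by (rule add_left_mono[OF L2_norm_triangle[OF zv_sq]])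
  also have "\<dots> \<le> \<eta> + (\<zeta> + Nd * max 1 (1 / \<tau>d) * (\<eta> + \<zeta> + \<tau>d * \<sigma>d + \<tau>d * Nd * \<zeta>))"
    by (intro add_mono \<eta> z_bound v_bound)
  finally show "norm_dom (\<lambda>x. u x - uh x) \<le> \<eta> + \<zeta> + Nd * max 1 (1 / \<tau>d) * (\<eta> + \<zeta> + \<tau>d * \<sigma>d + \<tau>d * Nd * \<zeta>)"
    by (simp only: add.assoc)
  have rP_sq: "sq_integrable (lebesgue_on \<Omega>h) (\<lambda>x. r x - ?P x)"
    by (rule sq_integrable_diff[OF r V_0_sq_integrable[OF P]])
  note e_sq = V_0_sq_integrable[OF e]
  have "norm_dom (\<lambda>x. weak_div \<Omega> u x - div_h uh x) = norm_dom (\<lambda>x. (r x - ?P x) - ?e x)"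
  proof (rule L2_norm_cong_AE)
    show "AE x in lebesgue_on \<Omega>. weak_div \<Omega> u x - div_h uh x = (r x - ?P x) - ?e x"
      using div_u by eventually_elim simp
    show "(\<lambda>x. weak_div \<Omega> u x - div_h uh x) \<in> borel_measurable (lebesgue_on \<Omega>)"
      by (rule sq_integrable_borel[OF sq_integrable_diff[OF u_sq(2) sq_dom[OF V_0_sq_integrable[OF du]]]])
    show "(\<lambda>x. (r x - ?P x) - ?e x) \<in> borel_measurable (lebesgue_on \<Omega>)"
      by (rule sq_integrable_borel[OF sq_dom[OF sq_integrable_diff[OF rP_sq e_sq]]])
  qed
  also have "\<dots> \<le> norm_h (\<lambda>x. (r x - ?P x) - ?e x)"
    by (rule norm_dom_le[OF sq_integrable_diff[OF rP_sq e_sq]])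
  also have "\<dots> \<le> norm_h (\<lambda>x. r x - ?P x) + norm_h ?e"
    by (rule L2_norm_triangle_diff[OF rP_sq e_sq])
  also have "\<dots> \<le> \<rho> + \<kappa>" by (intro add_mono \<rho> e_bound)
  finally show "norm_dom (\<lambda>x. weak_div \<Omega> u x - div_h uh x) \<le> \<rho> + \<kappa>" .
qed

end

section \<open>Uniform estimates over the family\<close>

theorem theorem5p6:
  fixes \<Omega> \<Omega>ext :: "(real^'n::finite) set"
    and E :: "(real^'n \<Rightarrow> real^'n) \<Rightarrow> (real^'n \<Rightarrow> real^'n)"
    and Pd :: "(real^'n \<Rightarrow> real^'n) set" and P0 :: "(real^'n \<Rightarrow> real) set"
    and ku kp :: nat and \<tau>d \<tau>0 h\<^sub>0 :: real
    and \<F> :: "'n discretisation set"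
  assumes "bounded \<Omega>" and "lipschitz_domain \<Omega>" and "smooth_domain \<Omega>ext"
    and "elliptic_regularity \<Omega>"
    and "stable_extension \<Omega> \<Omega>ext ku kp E"
    and "h\<^sub>0 > 0" and "mesh_family \<Omega> \<Omega>ext h\<^sub>0 \<F>"
    and "discrete_complex \<Omega> Pd P0 ku kp \<F>"
    and "stabilisation \<Omega> \<Omega>ext Pd P0 ku kp \<F>"
    and "kernel_approximation \<Omega> \<Omega>ext P0 kp \<F>"
    and "\<tau>d > 0" and "\<tau>0 > 0"
  shows "\<exists>C>0. \<exists>h\<^sub>1>0. \<forall>D\<in>\<F>. \<forall>f g p\<^sub>\<Gamma> u p uh ph.
    mesh_size D \<le> h\<^sub>1 \<longrightarrow>
    sq_integrable (lebesgue_on \<Omega>) f \<longrightarrow> sq_integrable (lebesgue_on \<Omega>) g \<longrightarrow>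
    p\<^sub>\<Gamma> \<in> H_half_boundary \<Omega> \<longrightarrow>
    darcy_solution \<Omega> f g p\<^sub>\<Gamma> u p \<longrightarrow>
    E u \<in> sobolev \<Omega>ext (real (max (ku + 1) (kp + 2))) \<longrightarrow>
    discrete_solution \<Omega> Pd P0 \<tau>d \<tau>0 D f g p\<^sub>\<Gamma> uh ph \<longrightarrow>
    L2_norm (lebesgue_on \<Omega>) (\<lambda>x. u x - uh x)
      \<le> C * (mesh_size D ^ (ku + 1) * sobolev_norm \<Omega> (real (ku + 1)) u
             + mesh_size D ^ (kp + 1) * sobolev_norm \<Omega> (real (kp + 2)) u) \<and>
    L2_norm (lebesgue_on \<Omega>) (\<lambda>x. weak_div \<Omega> u x - weak_div (active_domain \<Omega> D) uh x)
      \<le> C * (mesh_size D ^ (kp + 1) * sobolev_norm \<Omega> (real (kp + 2)) u)"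
proof -
  let ?H = "active_domain \<Omega>" and ?N = "\<lambda>D. L2_norm (lebesgue_on (active_domain \<Omega> D))"
  have \<Omega>: "open \<Omega>" and \<Omega>ext: "open \<Omega>ext"
    using assms(2,3) by (simp_all add: lipschitz_domain_def smooth_domain_def)
  obtain R where R: "0 < R" "\<And>x. x \<in> \<Omega> \<Longrightarrow> norm x \<le> R"
    using assms(1) by (auto simp: bounded_pos)
  define L where "L = 2 * R + 2 * h\<^sub>0 + 1"
  have L: "0 < L" using R(1) assms(6) by (simp add: L_def)
  note dc = assms(8)[unfolded discrete_complex_def Let_def]
  have approx_d: "\<forall>r\<le>ku + 1. \<exists>C>0. \<forall>D\<in>\<F>. \<forall>u\<in>sobolev (?H D) (real r) \<inter> H_div (?H D).
      ?N D (\<lambda>x. u x - interp_d D u x)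
      \<le> C * mesh_size D ^ r * sobolev_norm (?H D) (real r) u"
    and approx_0: "\<forall>t\<le>kp + 1. \<exists>C>0. \<forall>D\<in>\<F>. \<forall>p\<in>sobolev (?H D) (real t).
      ?N D (\<lambda>x. p x - interp_0 D p x)
      \<le> C * mesh_size D ^ t * sobolev_norm (?H D) (real t) p"
    using dc by blast+
  obtain Cd where Cd: "0 < Cd" "\<And>D u. D \<in> \<F> \<Longrightarrow> u \<in> sobolev (?H D) (real 0) \<Longrightarrow> u \<in> H_div (?H D) \<Longrightarrow>
      ?N D (\<lambda>x. u x - interp_d D u x)
      \<le> Cd * mesh_size D ^ 0 * sobolev_norm (?H D) (real 0) u"
    using approx_d[rule_format, of 0] by blast
  obtain C0 where C0: "0 < C0" "\<And>D p. D \<in> \<F> \<Longrightarrow> p \<in> sobolev (?H D) (real 0) \<Longrightarrow>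
      ?N D (\<lambda>x. p x - interp_0 D p x)
      \<le> C0 * mesh_size D ^ 0 * sobolev_norm (?H D) (real 0) p"
    using approx_0[rule_format, of 0] by blast
  obtain Ad where Ad: "0 < Ad" "\<And>D u. D \<in> \<F> \<Longrightarrow> u \<in> sobolev (?H D) (real (ku + 1)) \<Longrightarrow> u \<in> H_div (?H D) \<Longrightarrow>
      ?N D (\<lambda>x. u x - interp_d D u x)
      \<le> Ad * mesh_size D ^ (ku + 1) * sobolev_norm (?H D) (real (ku + 1)) u"
    using approx_d[rule_format, of "ku + 1"] by blast
  obtain A0 where A0: "0 < A0" "\<And>D p. D \<in> \<F> \<Longrightarrow> p \<in> sobolev (?H D) (real (kp + 1)) \<Longrightarrow>
      ?N D (\<lambda>x. p x - interp_0 D p x)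
      \<le> A0 * mesh_size D ^ (kp + 1) * sobolev_norm (?H D) (real (kp + 1)) p"
    using approx_0[rule_format, of "kp + 1"] by blast
  have forms: "\<And>D. D \<in> \<F> \<Longrightarrow> sym_psd_form (V_d \<Omega> Pd D) (stab_d D) \<and> sym_psd_form (V_0 \<Omega> P0 D) (stab_0 D)"
    and ne_d: "norm_equivalence \<Omega> \<F> (V_d \<Omega> Pd) stab_d" and ne_0: "norm_equivalence \<Omega> \<F> (V_0 \<Omega> P0) stab_0"
    using assms(9) by (simp_all add: stabilisation_def)
  obtain Nd where Nd: "0 < Nd" "\<And>D v. D \<in> \<F> \<Longrightarrow> v \<in> V_d \<Omega> Pd D \<Longrightarrow>
      (L2_norm (lebesgue_on \<Omega>) v)\<^sup>2 + stab_d D v v \<le> Nd * (?N D v)\<^sup>2 \<and>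
      (?N D v)\<^sup>2 \<le> Nd * ((L2_norm (lebesgue_on \<Omega>) v)\<^sup>2 + stab_d D v v)"
    using ne_d unfolding norm_equivalence_def by blast
  obtain N0 where N0: "0 < N0" "\<And>D q. D \<in> \<F> \<Longrightarrow> q \<in> V_0 \<Omega> P0 D \<Longrightarrow>
      (L2_norm (lebesgue_on \<Omega>) q)\<^sup>2 + stab_0 D q q \<le> N0 * (?N D q)\<^sup>2 \<and>
      (?N D q)\<^sup>2 \<le> N0 * ((L2_norm (lebesgue_on \<Omega>) q)\<^sup>2 + stab_0 D q q)"
    using ne_0 unfolding norm_equivalence_def by blast
  have consist_d: "\<forall>s. 0 \<le> s \<and> s \<le> real (ku + 1) \<longrightarrow> (\<exists>C>0. \<forall>D\<in>\<F>.
        \<forall>w\<in>sobolev \<Omega>ext s \<inter> H_div (?H D). \<forall>v\<in>V_d \<Omega> Pd D.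
          stab_d D (interp_d D w) v
          \<le> C * mesh_size D powr s * sobolev_norm \<Omega>ext s w * ?N D v)"
    and consist_0: "\<forall>t. 0 \<le> t \<and> t \<le> real (kp + 1) \<longrightarrow> (\<exists>C>0. \<forall>D\<in>\<F>. \<forall>r\<in>sobolev \<Omega>ext t. \<forall>q\<in>V_0 \<Omega> P0 D.
          stab_0 D (interp_0 D r) q
          \<le> C * mesh_size D powr t * sobolev_norm \<Omega>ext t r * ?N D q)"
    using assms(9) unfolding stabilisation_def by blast+
  obtain Sd where Sd: "0 < Sd" "\<And>D w v. D \<in> \<F> \<Longrightarrow> w \<in> sobolev \<Omega>ext (real (ku + 1)) \<Longrightarrow> w \<in> H_div (?H D) \<Longrightarrow>
      v \<in> V_d \<Omega> Pd D \<Longrightarrow> stab_d D (interp_d D w) v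
        \<le> Sd * mesh_size D powr real (ku + 1) * sobolev_norm \<Omega>ext (real (ku + 1)) w * ?N D v"
    using consist_d[THEN spec, THEN mp, OF conjI[OF of_nat_0_le_iff order_refl]] by blast
  obtain S0 where S0: "0 < S0" "\<And>D r q. D \<in> \<F> \<Longrightarrow> r \<in> sobolev \<Omega>ext (real (kp + 1)) \<Longrightarrow> q \<in> V_0 \<Omega> P0 D \<Longrightarrow>
      stab_0 D (interp_0 D r) q
        \<le> S0 * mesh_size D powr real (kp + 1) * sobolev_norm \<Omega>ext (real (kp + 1)) r * ?N D q"
    using consist_0[THEN spec, THEN mp, OF conjI[OF of_nat_0_le_iff order_refl]] by blast
  have ext: "\<forall>u. sq_integrable (lebesgue_on \<Omega>) u \<longrightarrow> (AE x in lebesgue_on \<Omega>. E u x = u x)"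
    and ext_flux: "\<forall>r. 0 \<le> r \<and> r \<le> real (ku + 1) \<longrightarrow>
        (\<exists>C>0. \<forall>u\<in>sobolev \<Omega> r. E u \<in> sobolev \<Omega>ext r \<and> sobolev_norm \<Omega>ext r (E u) \<le> C * sobolev_norm \<Omega> r u)"
    and ext_div: "\<forall>s. 0 \<le> s \<and> s \<le> real (kp + 1) \<longrightarrow>
        (\<exists>C>0. \<forall>u\<in>sobolev \<Omega> (s + 1). E u \<in> H_div \<Omega>ext \<and> weak_div \<Omega>ext (E u) \<in> sobolev \<Omega>ext s \<and>
           sobolev_norm \<Omega>ext s (weak_div \<Omega>ext (E u)) \<le> C * sobolev_norm \<Omega> (s + 1) u)"
    using assms(5) unfolding stable_extension_def by blast+
  have ext_d: "\<exists>C>0. \<forall>u\<in>sobolev \<Omega> (real (ku + 1)). E u \<in> sobolev \<Omega>ext (real (ku + 1)) \<and>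
      sobolev_norm \<Omega>ext (real (ku + 1)) (E u) \<le> C * sobolev_norm \<Omega> (real (ku + 1)) u"
    by (rule ext_flux[THEN spec, THEN mp, OF conjI[OF of_nat_0_le_iff order_refl]])
  have ext_0: "\<exists>C>0. \<forall>u\<in>sobolev \<Omega> (real (kp + 1) + 1). E u \<in> H_div \<Omega>ext \<and> weak_div \<Omega>ext (E u) \<in> sobolev \<Omega>ext (real (kp + 1)) \<and>
      sobolev_norm \<Omega>ext (real (kp + 1)) (weak_div \<Omega>ext (E u)) \<le> C * sobolev_norm \<Omega> (real (kp + 1) + 1) u"
    by (rule ext_div[THEN spec, THEN mp, OF conjI[OF of_nat_0_le_iff order_refl]])
  have order: "real (kp + 1) + 1 = real (kp + 2)" by simp
  obtain Xd where Xd: "0 < Xd" "\<And>u. u \<in> sobolev \<Omega> (real (ku + 1)) \<Longrightarrow> E u \<in> sobolev \<Omega>ext (real (ku + 1)) \<and>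
      sobolev_norm \<Omega>ext (real (ku + 1)) (E u) \<le> Xd * sobolev_norm \<Omega> (real (ku + 1)) u"
    using ext_d by blast
  obtain X0 where X0: "0 < X0" "\<And>u. u \<in> sobolev \<Omega> (real (kp + 2)) \<Longrightarrow> E u \<in> H_div \<Omega>ext \<and>
      weak_div \<Omega>ext (E u) \<in> sobolev \<Omega>ext (real (kp + 1)) \<and>
      sobolev_norm \<Omega>ext (real (kp + 1)) (weak_div \<Omega>ext (E u)) \<le> X0 * sobolev_norm \<Omega> (real (kp + 2)) u"
    using ext_0 unfolding order by blast
  \<comment> \<open>The constants in front of the powers of the mesh size in the discrete divergence error, in its
    lifting, and in the contributions of order \<open>h^(ku+1)\<close> and \<open>h^(kp+1)\<close> to the flux error.\<close>
  define K\<kappa> where "K\<kappa> = N0 * max 1 (1 / \<tau>0) * (A0 * X0 + \<tau>0 * (S0 * X0))"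
  define K\<zeta> where "K\<zeta> = (1 + Cd) * L * K\<kappa>"
  define Kb where "Kb = Ad * Xd + Nd * max 1 (1 / \<tau>d) * (Ad * Xd + \<tau>d * (Sd * Xd))"
  define Ka where "Ka = K\<zeta> + Nd * max 1 (1 / \<tau>d) * (K\<zeta> + \<tau>d * Nd * K\<zeta>)"
  have K_nonneg: "0 \<le> K\<kappa>" "0 \<le> K\<zeta>" "0 \<le> Kb" "0 \<le> Ka"
    using N0(1) A0(1) X0(1) S0(1) Cd(1) L Ad(1) Xd(1) Sd(1) Nd(1) assms(11,12)
    unfolding Ka_def Kb_def K\<zeta>_def K\<kappa>_def
    by (auto intro!: add_nonneg_nonneg mult_nonneg_nonneg)
  define C where "C = Kb + Ka + K\<kappa> + A0 * X0"
  have C_pos: "0 < C" using K_nonneg mult_pos_pos[OF A0(1) X0(1)] by (simp add: C_def)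
  have main: "L2_norm (lebesgue_on \<Omega>) (\<lambda>x. u x - uh x)
      \<le> C * (mesh_size D ^ (ku + 1) * sobolev_norm \<Omega> (real (ku + 1)) u
             + mesh_size D ^ (kp + 1) * sobolev_norm \<Omega> (real (kp + 2)) u) \<and>
    L2_norm (lebesgue_on \<Omega>) (\<lambda>x. weak_div \<Omega> u x - weak_div (?H D) uh x)
      \<le> C * (mesh_size D ^ (kp + 1) * sobolev_norm \<Omega> (real (kp + 2)) u)"
    if D: "D \<in> \<F>" and f: "sq_integrable (lebesgue_on \<Omega>) f" and g: "sq_integrable (lebesgue_on \<Omega>) g"
      and darcy: "darcy_solution \<Omega> f g p\<^sub>\<Gamma> u p"
      and reg: "E u \<in> sobolev \<Omega>ext (real (max (ku + 1) (kp + 2)))"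
      and discrete: "discrete_solution \<Omega> Pd P0 \<tau>d \<tau>0 D f g p\<^sub>\<Gamma> uh ph"
    for D f g p\<^sub>\<Gamma> u p uh ph
  proof -
    have mesh: "\<Omega> \<subseteq> background D" "conforming_mesh (background D) (bg_mesh D)" "0 < mesh_size D" "mesh_size D \<le> h\<^sub>0"
      "?H D \<subseteq> \<Omega>ext"
      using assms(7) D by (auto simp: mesh_family_def)
    let ?\<Omega>h = "?H D"
    have h_open: "open ?\<Omega>h" by (rule active_domain_open)
    have active: "\<Omega> \<subseteq> ?\<Omega>h" using subset_active_domain[OF \<Omega> mesh(1,2)] .
    have sub: "\<Omega> \<subseteq> \<Omega>ext" using active mesh(5) by blast
    interpret cut_discretisation \<Omega> D Pd P0 Cd C0 Nd N0 L
    proof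
      show "open \<Omega>" "bounded \<Omega>" "\<Omega> \<subseteq> ?\<Omega>h" by fact+
      show "polynomial_space Pd" "polynomial_space P0" using dc by blast+
      show "weak_div ?\<Omega>h v \<in> V_0 \<Omega> P0 D" if "v \<in> V_d \<Omega> Pd D" for v using dc D that by blast
      show "linear_projection (lebesgue_on ?\<Omega>h) (H_div ?\<Omega>h) (V_d \<Omega> Pd D) (interp_d D)"
        "linear_projection (lebesgue_on ?\<Omega>h) {q. sq_integrable (lebesgue_on ?\<Omega>h) q} (V_0 \<Omega> P0 D) (interp_0 D)"
        using dc D by blast+
      show "AE x in lebesgue_on ?\<Omega>h. weak_div ?\<Omega>h (interp_d D u) x = interp_0 D (weak_div ?\<Omega>h u) x"
        if "u \<in> H_div ?\<Omega>h" for u using dc D that by blast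
      show "?N D (\<lambda>x. u x - interp_d D u x) \<le> Cd * ?N D u"
        if "u \<in> H_div ?\<Omega>h" for u
        using Cd(2)[OF D _ that] sobolev_zero[OF h_open H_div_sq_integrable(1)[OF that]] by simp
      show "?N D (\<lambda>x. q x - interp_0 D q x) \<le> C0 * ?N D q"
        if "sq_integrable (lebesgue_on ?\<Omega>h) q" for q
        using C0(2)[OF D sobolev_zero(1)[OF h_open that]] sobolev_zero(2)[OF h_open that] by simp
      show "sym_psd_form (V_d \<Omega> Pd D) (stab_d D)" "sym_psd_form (V_0 \<Omega> P0 D) (stab_0 D)"
        using forms[OF D] by blast+
      show "dist x y < L" if "x \<in> ?\<Omega>h" "y \<in> ?\<Omega>h" for x y
        unfolding L_def by (rule active_domain_width[OF mesh(2,4) R(2) that])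
    qed (use Nd N0 Cd(1) L D in blast)+
    have uH: "u \<in> H_div \<Omega>" using darcy by (simp add: darcy_solution_def)
    have u_sq: "sq_integrable (lebesgue_on \<Omega>) u" using uH by (rule H_div_sq_integrable)
    have extends: "AE x in lebesgue_on \<Omega>. E u x = u x" using ext u_sq by blast
    have u_reg: "u \<in> sobolev \<Omega> (real (max (ku + 1) (kp + 2)))"
      by (rule sobolev_cong_AE[OF \<Omega> sobolev_subset(1)[OF reg sub \<Omega> \<Omega>ext] extends u_sq])
    have u_d: "u \<in> sobolev \<Omega> (real (ku + 1))" and u_0: "u \<in> sobolev \<Omega> (real (kp + 2))"
      by (rule sobolev_order_mono[OF u_reg], simp)+
    let ?r = "weak_div \<Omega>ext (E u)"
    let ?b = "mesh_size D ^ (ku + 1) * sobolev_norm \<Omega> (real (ku + 1)) u"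
    let ?a = "mesh_size D ^ (kp + 1) * sobolev_norm \<Omega> (real (kp + 2)) u"
    have nonneg: "0 \<le> ?a" "0 \<le> ?b"
      using mesh(3) sobolev_norm_nat_nonneg[of \<Omega> "ku + 1" u] sobolev_norm_nat_nonneg[of \<Omega> "kp + 2" u]
      by (auto intro!: mult_nonneg_nonneg)
    have Eu: "E u \<in> sobolev \<Omega>ext (real (ku + 1))" "E u \<in> H_div \<Omega>ext" "?r \<in> sobolev \<Omega>ext (real (kp + 1))"
      using Xd(2)[OF u_d] X0(2)[OF u_0] by blast+
    have Eu_h: "E u \<in> sobolev ?\<Omega>h (real (ku + 1))" "E u \<in> H_div ?\<Omega>h" "?r \<in> sobolev ?\<Omega>h (real (kp + 1))"
      and div_Eu: "AE x in lebesgue_on ?\<Omega>h. weak_div ?\<Omega>h (E u) x = ?r x"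
      using sobolev_subset(1)[OF Eu(1) mesh(5) h_open \<Omega>ext] sobolev_subset(1)[OF Eu(3) mesh(5) h_open \<Omega>ext]
        weak_div_subset_AE_eq[OF Eu(2) mesh(5) h_open \<Omega>ext] by blast+
    have r_sq: "sq_integrable (lebesgue_on ?\<Omega>h) ?r" using Eu_h(3) unfolding sobolev_nat_iff by blast
    have b_ext: "mesh_size D ^ (ku + 1) * sobolev_norm \<Omega>ext (real (ku + 1)) (E u) \<le> Xd * ?b"
      using mult_left_mono[OF conjunct2[OF Xd(2)[OF u_d]], of "mesh_size D ^ (ku + 1)"] mesh(3)
      by (simp add: algebra_simps)
    have a_ext: "mesh_size D ^ (kp + 1) * sobolev_norm \<Omega>ext (real (kp + 1)) ?r \<le> X0 * ?a"
      using mult_left_mono[OF conjunct2[OF conjunct2[OF X0(2)[OF u_0]]], of "mesh_size D ^ (kp + 1)"] mesh(3)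
      by (simp add: algebra_simps)
    have \<eta>: "?N D (\<lambda>x. E u x - interp_d D (E u) x) \<le> Ad * Xd * ?b"
    proof -
      have "?N D (\<lambda>x. E u x - interp_d D (E u) x)
          \<le> Ad * (mesh_size D ^ (ku + 1) * sobolev_norm ?\<Omega>h (real (ku + 1)) (E u))"
        using Ad(2)[OF D Eu_h(1,2)] by (simp add: mult.assoc)
      also have "\<dots> \<le> Ad * (mesh_size D ^ (ku + 1) * sobolev_norm \<Omega>ext (real (ku + 1)) (E u))"
        using sobolev_subset(2)[OF Eu(1) mesh(5) h_open \<Omega>ext] Ad(1) mesh(3) by (intro mult_left_mono) auto
      also have "\<dots> \<le> Ad * (Xd * ?b)" using b_ext Ad(1) by (intro mult_left_mono) auto
      finally show ?thesis by (simp add: mult.assoc)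
    qed
    have \<rho>: "?N D (\<lambda>x. ?r x - interp_0 D ?r x) \<le> A0 * X0 * ?a"
    proof -
      have "?N D (\<lambda>x. ?r x - interp_0 D ?r x)
          \<le> A0 * (mesh_size D ^ (kp + 1) * sobolev_norm ?\<Omega>h (real (kp + 1)) ?r)"
        using A0(2)[OF D Eu_h(3)] by (simp add: mult.assoc)
      also have "\<dots> \<le> A0 * (mesh_size D ^ (kp + 1) * sobolev_norm \<Omega>ext (real (kp + 1)) ?r)"
        using sobolev_subset(2)[OF Eu(3) mesh(5) h_open \<Omega>ext] A0(1) mesh(3) by (intro mult_left_mono) auto
      also have "\<dots> \<le> A0 * (X0 * ?a)" using a_ext A0(1) by (intro mult_left_mono) auto
      finally show ?thesis by (simp add: mult.assoc)
    qed
    have \<sigma>d: "stab_d D (interp_d D (E u)) v \<le> Sd * Xd * ?b * ?N D v" if "v \<in> V_d \<Omega> Pd D" for v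
    proof -
      have "stab_d D (interp_d D (E u)) v
          \<le> Sd * (mesh_size D ^ (ku + 1) * sobolev_norm \<Omega>ext (real (ku + 1)) (E u)) * ?N D v"
        using Sd(2)[OF D Eu(1) Eu_h(2) that] unfolding powr_realpow[OF mesh(3)] by (simp only: mult.assoc)
      also have "\<dots> \<le> Sd * (Xd * ?b) * ?N D v"
        using b_ext Sd(1) by (intro mult_right_mono mult_left_mono) (auto simp: L2_norm_nonneg)
      finally show ?thesis by (simp only: mult.assoc)
    qed
    have \<sigma>0: "stab_0 D (interp_0 D ?r) q \<le> S0 * X0 * ?a * ?N D q" if "q \<in> V_0 \<Omega> P0 D" for q
    proof -
      have "stab_0 D (interp_0 D ?r) q
          \<le> S0 * (mesh_size D ^ (kp + 1) * sobolev_norm \<Omega>ext (real (kp + 1)) ?r) * ?N D q"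
        using S0(2)[OF D Eu(3) that] unfolding powr_realpow[OF mesh(3)] by (simp only: mult.assoc)
      also have "\<dots> \<le> S0 * (X0 * ?a) * ?N D q"
        using a_ext S0(1) by (intro mult_right_mono mult_left_mono) (auto simp: L2_norm_nonneg)
      finally show ?thesis by (simp only: mult.assoc)
    qed
    have \<kappa>: "K\<kappa> * ?a = N0 * max 1 (1 / \<tau>0) * (A0 * X0 * ?a + \<tau>0 * (S0 * X0 * ?a))"
      unfolding K\<kappa>_def by (simp only: distrib_left distrib_right mult.assoc)
    have \<zeta>: "K\<zeta> * ?a = (1 + Cd) * L * (K\<kappa> * ?a)"
      unfolding K\<zeta>_def by (simp only: mult.assoc)
    have "0 \<le> Sd * Xd * ?b" "0 \<le> S0 * X0 * ?a"
      using nonneg Sd(1) Xd(1) S0(1) X0(1) by (auto intro!: mult_nonneg_nonneg)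
    note bounds = total_error[OF f g assms(11,12) darcy discrete Eu_h(2) extends r_sq div_Eu \<eta> \<rho> this(1) \<sigma>d this(2) \<sigma>0 \<kappa> \<zeta>]
    have "Ad * Xd * ?b + K\<zeta> * ?a + Nd * max 1 (1 / \<tau>d) *
          (Ad * Xd * ?b + K\<zeta> * ?a + \<tau>d * (Sd * Xd * ?b) + \<tau>d * Nd * (K\<zeta> * ?a)) = Kb * ?b + Ka * ?a"
      unfolding Ka_def Kb_def by (simp add: algebra_simps)
    also have "\<dots> \<le> C * ?b + C * ?a"
      using K_nonneg nonneg mult_pos_pos[OF A0(1) X0(1)] unfolding C_def by (intro add_mono mult_right_mono) auto
    finally have flux: "Ad * Xd * ?b + K\<zeta> * ?a + Nd * max 1 (1 / \<tau>d) *
          (Ad * Xd * ?b + K\<zeta> * ?a + \<tau>d * (Sd * Xd * ?b) + \<tau>d * Nd * (K\<zeta> * ?a)) \<le> C * (?b + ?a)"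
      by (simp only: distrib_left)
    have "A0 * X0 * ?a + K\<kappa> * ?a = (A0 * X0 + K\<kappa>) * ?a" by (simp only: distrib_right)
    also have "\<dots> \<le> C * ?a"
      using K_nonneg nonneg unfolding C_def by (intro mult_right_mono) auto
    finally have divergence: "A0 * X0 * ?a + K\<kappa> * ?a \<le> C * ?a" .
    show ?thesis
      using order_trans[OF bounds(1) flux] order_trans[OF bounds(2) divergence] by blast
  qed
  show ?thesis
  proof (intro exI[of _ C] exI[of _ 1] conjI[OF C_pos] conjI[OF zero_less_one] ballI allI impI)
  qed (rule main)
qed

end
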